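(* Let $X$ be a symplectic orbispace, $\nabla$ a symplectic connection on $X$ with curvature form $R$, and $D=\nabla+\delta+\frac i\lambda[r,\cdot]$ the flat connection on $\Lambda^\bullet\widehat{\mathbb W}X$, where $r\in\Gamma^\infty_{\mathrm{str}}(\Lambda^1\widehat{\mathbb W}X)$ is the unique element with $\deg_{\mathrm F}(r)\ge\deg_{\mathrm F}(\delta^-R)$ and $r=\delta^-R+\delta^-\big(\nabla r+\frac i\lambda r^2\big)$. Let $\widehat{\mathbb W}_DX=\{a\in\Gamma^\infty_{\mathrm{str}}(\widehat{\mathbb W}X)\mid Da=0\}$, and let $Q:C^\infty(X)[[\lambda]]\to\widehat{\mathbb W}_DX$ be the inverse of the linear isomorphism $\sigma:\widehat{\mathbb W}_DX\to C^\infty(X)[[\lambda]]$ given by the symbol map. Let $\star:C^\infty(X)[[\lambda]]\times C^\infty(X)[[\lambda]]\to C^\infty(X)[[\lambda]]$ be the uniquely determined $\mathbb C[[\lambda]]$-bilinear map such that $$f\star g=\sigma\big(Q(f)\circ Q(g)\big)\qquad\text{for all }f,g\in C^\infty(X).$$ Then $\star$ is a star product for $X$.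
   Context: Orbispaces. $\mathfrak{Man}^{\mathrm{sym}}$ has as objects pairs $(M,G)$ of a finite dimensional smooth manifold $M$ and a compact Lie group $G$ acting smoothly on $M$; a morphism $(\varphi,\iota):(N,H)\to(M,G)$ is a smooth map $\varphi$ together with a continuous homomorphism $\iota:H\to G$ with $\varphi(hy)=\iota(h)\varphi(y)$; it induces $\overline\varphi:N/H\to M/G$. It is an open embedding if $\varphi$ is an open smooth embedding and $\overline\varphi$ is a homeomorphism onto an open subset. An orbispace chart of a Hausdorff space $X$ is a triple $(\tilde U,G,\varrho)$ with $(\tilde U,G)\in\mathfrak{Man}^{\mathrm{sym}}$ and $\varrho:\tilde U\to X$ continuous, $G$-invariant, inducing a homeomorphism $\tilde U/G\to U$ onto an open set $U\subset X$ (the image). Morphisms of charts $(\tilde V,H,\upsilon)\to(\tilde U,G,\varrho)$ are morphisms $(\varphi,\iota)$ with $\varrho\circ\varphi=\upsilon$. For an open covering $\mathcal U$ of $X$, $\overline{\mathcal U}$ is the category whose objects are the connected components of finite intersections of elements of $\mathcal U$ and whose morphisms are the inclusions. An orbispace is a second countable, locally connected, paracompact Hausdorff space $X$ with a functor $\mathsf X$ from $\overline{\mathcal U}$ to orbispace charts of $X$ such that $\mathsf X(U)$ has image $U$ and connected domain $\tilde U$, and each $\mathsf X_{VU}=\mathsf X(V\to U)$ is an open embedding. $C^\infty(X)$ is the algebra of smooth functions on $X$, i.e. of continuous functions $f$ with $f\circ\varrho$ smooth for all orbispace charts; here, as products are $\mathbb C[[\lambda]]$-bilinear, functions are complex valued.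 $f$ is identified with the family $(f\circ\varrho)$. A symplectic form on $X$ is a family $\omega=(\omega_{\tilde U})$ of $G$-invariant symplectic forms on the domains $\tilde U$ of the charts of $\mathsf X$ with $\varphi^*\omega_{\tilde U}=\omega_{\tilde V}$ for every morphism $(\varphi,\iota)=\mathsf X_{VU}$. A symplectic orbispace is an orbispace with a symplectic form. A connection on $X$ is a family $\nabla=(\nabla_{\tilde U})$ of $G$-invariant affine connections on the $\tilde U$ such that $\varphi^*(\nabla_{\tilde U}\xi_{\tilde U})=\nabla_{\tilde V}\xi_{\tilde V}$ for every vector field $(\xi_{\tilde U})$ on $X$ and every morphism $(\varphi,\iota)=\mathsf X_{VU}$; it is called symplectic if $\nabla_{\tilde U}\omega_{\tilde U}=0$ for all $\tilde U$. It is assumed (without loss of generality) that every $\tilde U$ is an open $G$-invariant subset of $\mathbb R^{2n}$ on which $G$ acts by linear symplectic maps, with $\omega_{\tilde U}=\sum_{j=1}^nd\tilde x_j\wedge d\tilde x_{n+j}$ in the natural coordinates $\tilde x_1,\dots,\tilde x_{2n}$. Poisson bracket and star products. On $C^\infty(X)$ put $\{f,g\}(\varrho(\tilde x))=\{f\circ\varrho,g\circ\varrho\}_{\tilde U}(\tilde x)$, where $\{\cdot,\cdot\}_{\tilde U}$ is the Poisson bracket on $C^\infty(\tilde U)$ given by $\omega_{\tilde U}$. A star product (formal deformation quantization) for $X$ is a $\mathbb C[[\lambda]]$-bilinear associative product $\star$ on $C^\infty(X)[[\lambda]]$ such that for all $f,g\in C^\infty(X)$: (DQ1) $f\star g=\sum_{k\ge0}\mu_k(f,g)\lambda^k$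 with bilinear maps $\mu_k:C^\infty(X)\times C^\infty(X)\to C^\infty(X)$ and $\mu_0$ the pointwise product; (DQ2) $f\star g-g\star f-i\lambda\{f,g\}\in\lambda^2C^\infty(X)[[\lambda]]$; (DQ3) $f\star1=1\star f=f$. Weyl algebra orbibundle. For a finite dimensional Poisson vector space $V$ with Poisson bivector $\Pi=\sum_i\Pi_{1i}\otimes\Pi_{2i}$, $\Pi_{1i},\Pi_{2i}\in V$, the completed formal Weyl algebra is $\widehat{\mathbb W}V=\big(\prod_{s\ge0}\mathrm{Sym}^s(V^* )\big)[[\lambda]]$ (complexified symmetric powers). Elements of $V$ act on it as derivations; with $\hat\Pi(a\otimes b)=\sum_i\Pi_{1i}a\otimes\Pi_{2i}b$ and $\mu$ the commutative multiplication, the Moyal--Weyl product is $a\circ b=\sum_{k\ge0}\frac{(-i\lambda)^k}{k!}\mu\big(\hat\Pi^k(a\otimes b)\big)$. On alternating forms with values in $\widehat{\mathbb W}V$, i.e. on $\Lambda^\bullet\widehat{\mathbb W}V=\Lambda^\bullet V^*\otimes\widehat{\mathbb W}V$, $\circ$ denotes the product induced by $\circ$ and the exterior product. Applying this fiberwise to $T\tilde U$, with the Poisson bivector corresponding to $\omega_{\tilde U}$, gives the bundles $\widehat{\mathbb W}\tilde U$ and $\Lambda^\bullet\widehat{\mathbb W}\tilde U$. Let $\tilde y_j$ be the copy of $d\tilde x_j$ in $\mathrm{Sym}^1(T^*\tilde U)$; sections are formal series $b_{\tilde U}=\sum b_{\tilde U,k\alpha j_1\cdots j_l}\,\tilde y^\alpha\,d\tilde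 x_{j_1}\wedge\cdots\wedge d\tilde x_{j_l}\,\lambda^k$ with smooth coefficient functions. The bundles $\widehat{\mathbb W}\tilde U$, $\Lambda^\bullet\widehat{\mathbb W}\tilde U$ form vector orbibundles $\widehat{\mathbb W}X$, $\Lambda^\bullet\widehat{\mathbb W}X$ over $X$. The space $\Gamma^\infty_{\mathrm{str}}(\Lambda^\bullet\widehat{\mathbb W}X)$ of smooth stratified sections is identified with the space of families $b=(b_{\tilde U})$ of $G$-equivariant smooth sections of $\Lambda^\bullet\widehat{\mathbb W}\tilde U$ that are compatible with all morphisms $\mathsf X_{VU}$ ($\varphi^*b_{\tilde U}=b_{\tilde V}$); $\Gamma^\infty_{\mathrm{str}}(\widehat{\mathbb W}X)$ is the part of form degree $0$. All operations, in particular $\circ$, are performed chart by chart; $[\cdot,\cdot]$ is the graded commutator with respect to $\circ$, and $r^2=r\circ r$. The Fedosov degree $\deg_{\mathrm F}(b)$ is the minimum of $s+2k$ over all nonvanishing components of $b$ of degree $s$ in $\tilde y$ and degree $k$ in $\lambda$. Operators. $\nabla$ is extended to $\Lambda^\bullet\widehat{\mathbb W}X$ by $(\nabla b)_{\tilde U}=\sum_j\sum\nabla_{\tilde U,\partial/\partial\tilde x_j}\big(b_{\tilde U,k\alpha j_1\cdots j_l}\tilde y^\alpha\big)\,d\tilde x_j\wedge d\tilde x_{j_1}\wedge\cdots\wedge d\tilde x_{j_l}\,\lambda^k$, and $(\nabla b)_{\tilde U}=db_{\tilde U}+\frac i\lambda[\Gamma_{\tilde U},b_{\tilde U}]$, where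 $\Gamma_{\tilde U}=\frac12\sum_{i,j,k}\Gamma_{\tilde U,ijk}\,\tilde y_i\tilde y_j\,d\tilde x_k$ and the $\Gamma_{\tilde U,ijk}$ are the Christoffel symbols, $\nabla_{\tilde U,\partial/\partial\tilde x_i}\frac{\partial}{\partial\tilde x_j}=\sum_{k,l}\Gamma_{\tilde U,ijk}\,\omega_{kl}\frac{\partial}{\partial\tilde x_l}$, with $\omega_{kl}$ the components of $\omega_{\tilde U}$. The curvature form of $\nabla$ is $R=(R_{\tilde U})$, $R_{\tilde U}=d\Gamma_{\tilde U}+\frac12[\Gamma_{\tilde U},\Gamma_{\tilde U}]$; it satisfies $\nabla^2b=\frac i\lambda[R,b]$. Locally, $\delta b=\sum_kd\tilde x_k\wedge\frac{\partial b}{\partial\tilde y_k}$, $\delta^*b=\sum_k\tilde y_k\cdot\big(\frac{\partial}{\partial\tilde x_k}\llcorner b\big)$, and $\delta^-b=\sum_{q+l>0}\frac1{q+l}\delta^*(b_{ql})$, where $b_{ql}$ is the part of $b$ of degree $q$ in $\tilde y$ and form degree $l$. The symbol map is $\sigma(b)=(b_{\tilde U,00})\in C^\infty(X)[[\lambda]]$. That $D$ is flat ($D^2=0$) and that $\sigma$ restricts to an isomorphism $\widehat{\mathbb W}_DX\to C^\infty(X)[[\lambda]]$ is part of the setting (established separately).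
   Formalization: The curvature form is taken as R = dΓ + (i/2λ)[Γ,Γ], the form with ∇²b = (i/λ)[R,b], and D = ∇ ± δ + (i/λ)[r,·] is allowed with either sign of δ, because with +δ and this r the connection D is flat only when R = 0. *)

theory Defs
  imports
    "HOL-Analysis.Analysis"
    "HOL-Algebra.Group"
    "HOL-Library.Multiset"
    "HOL-Library.Function_Algebras"
    "HOL-Library.Extended_Nat"
    "HOL-Computational_Algebra.Formal_Power_Series"
begin

text \<open>
  Since dimensions vary (Lie groups of dimension 0 are the finite groups, and different charts may
  have different dimensions), \<open>\<real>\<^sup>m\<close> is the library's \<open>Euclidean_space m\<close>: the functions
  \<open>nat \<Rightarrow> real\<close> vanishing at all indices \<open>\<ge> m\<close>. Indices start at 0.
  Sums of fields, forms and series are the pointwise ones of \<open>Function_Algebras\<close>.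
\<close>

type_synonym vec = "nat \<Rightarrow> real"

section \<open>Smooth maps on open subsets of Euclidean spaces\<close>

definition pd :: "nat \<Rightarrow> (vec \<Rightarrow> 'b::real_normed_vector) \<Rightarrow> vec \<Rightarrow> 'b" where
  "pd i f x = vector_derivative (\<lambda>t. f (x(i := t))) (at (x i))"

primrec iter_pd :: "nat list \<Rightarrow> (vec \<Rightarrow> 'b::real_normed_vector) \<Rightarrow> vec \<Rightarrow> 'b" where
  "iter_pd [] f = f"
| "iter_pd (i # is) f = pd i (iter_pd is f)"

text \<open>All iterated partial derivatives exist and are continuous on the (open) set \<open>U\<close>.\<close>

definition smooth_fun :: "nat \<Rightarrow> vec set \<Rightarrow> (vec \<Rightarrow> 'b::real_normed_vector) \<Rightarrow> bool" where
  "smooth_fun m U f \<longleftrightarrow>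
     (\<forall>is. set is \<subseteq> {..<m} \<longrightarrow>
        continuous_map (subtopology (Euclidean_space m) U) euclidean (iter_pd is f) \<and>
        (\<forall>i<m. \<forall>x\<in>U. (\<lambda>t. iter_pd is f (x(i := t))) differentiable (at (x i))))"

definition smooth_map :: "nat \<Rightarrow> vec set \<Rightarrow> nat \<Rightarrow> (vec \<Rightarrow> vec) \<Rightarrow> bool" where
  "smooth_map m U k \<phi> \<longleftrightarrow>
     \<phi> ` U \<subseteq> topspace (Euclidean_space k) \<and> (\<forall>i<k. smooth_fun m U (\<lambda>x. \<phi> x i))"

definition jac :: "(vec \<Rightarrow> vec) \<Rightarrow> vec \<Rightarrow> nat \<Rightarrow> nat \<Rightarrow> real" where
  "jac \<phi> x i j = pd j (\<lambda>z. \<phi> z i) x"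

definition push :: "nat \<Rightarrow> (vec \<Rightarrow> vec) \<Rightarrow> vec \<Rightarrow> vec \<Rightarrow> vec" where
  "push m \<phi> x v = (\<lambda>i. \<Sum>j<m. jac \<phi> x i j * v j)"

text \<open>The two components of a point of \<open>\<real>\<^sup>d\<^sup>+\<^sup>e = \<real>\<^sup>d \<times> \<real>\<^sup>e\<close>.\<close>

definition fstc :: "nat \<Rightarrow> vec \<Rightarrow> vec" where
  "fstc d z = (\<lambda>i. if i < d then z i else 0)"

definition sndc :: "nat \<Rightarrow> vec \<Rightarrow> vec" where
  "sndc d z = (\<lambda>i. z (d + i))"

section \<open>Compact Lie groups\<close>

text \<open>A Lie group carries a topology and a smooth atlas of charts \<open>\<kappa> : W \<rightarrow> \<real>\<^sup>d\<close>.\<close>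

record 'g liegroup = "'g monoid" +
  gtop :: "'g topology"
  gdim :: nat
  gatlas :: "('g set \<times> ('g \<Rightarrow> vec)) set"

definition lie_group :: "'g liegroup \<Rightarrow> bool" where
  "lie_group G \<longleftrightarrow>
     group G \<and> topspace (gtop G) = carrier G \<and> Hausdorff_space (gtop G) \<and> second_countable (gtop G) \<and>
     continuous_map (prod_topology (gtop G) (gtop G)) (gtop G) (\<lambda>(g, h). g \<otimes>\<^bsub>G\<^esub> h) \<and>
     continuous_map (gtop G) (gtop G) (\<lambda>g. inv\<^bsub>G\<^esub> g) \<and>
     \<Union> (fst ` gatlas G) = carrier G \<and>
     (\<forall>(W, \<kappa>) \<in> gatlas G.
        openin (gtop G) W \<and> openin (Euclidean_space (gdim G)) (\<kappa> ` W) \<and>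
        homeomorphic_map (subtopology (gtop G) W) (subtopology (Euclidean_space (gdim G)) (\<kappa> ` W)) \<kappa>) \<and>
     (\<forall>(W, \<kappa>) \<in> gatlas G. \<forall>(W', \<kappa>') \<in> gatlas G.
        smooth_map (gdim G) (\<kappa> ` (W \<inter> W')) (gdim G) (\<lambda>z. \<kappa>' (inv_into W \<kappa> z)) \<and>
        smooth_map (gdim G) {z \<in> \<kappa> ` W. inv\<^bsub>G\<^esub> (inv_into W \<kappa> z) \<in> W'} (gdim G)
          (\<lambda>z. \<kappa>' (inv\<^bsub>G\<^esub> (inv_into W \<kappa> z)))) \<and>
     (\<forall>(W1, \<kappa>1) \<in> gatlas G. \<forall>(W2, \<kappa>2) \<in> gatlas G. \<forall>(W3, \<kappa>3) \<in> gatlas G.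
        smooth_map (gdim G + gdim G)
          {z \<in> topspace (Euclidean_space (gdim G + gdim G)).
             fstc (gdim G) z \<in> \<kappa>1 ` W1 \<and> sndc (gdim G) z \<in> \<kappa>2 ` W2 \<and>
             inv_into W1 \<kappa>1 (fstc (gdim G) z) \<otimes>\<^bsub>G\<^esub> inv_into W2 \<kappa>2 (sndc (gdim G) z) \<in> W3}
          (gdim G)
          (\<lambda>z. \<kappa>3 (inv_into W1 \<kappa>1 (fstc (gdim G) z) \<otimes>\<^bsub>G\<^esub> inv_into W2 \<kappa>2 (sndc (gdim G) z))))"

definition compact_lie_group :: "'g liegroup \<Rightarrow> bool" where
  "compact_lie_group G \<longleftrightarrow> lie_group G \<and> compact_space (gtop G)"

section \<open>Orbispaces\<close>

text \<open>A chart \<open>(U\<^sup>~, G, \<rho>)\<close>: the domain \<open>cdom\<close> is an open subset of \<open>\<real>\<^sup>m\<close>, \<open>m = cdim\<close>.\<close>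

record ('g, 'x) chart =
  cdim :: nat
  cdom :: "vec set"
  cgrp :: "'g liegroup"
  cact :: "'g \<Rightarrow> vec \<Rightarrow> vec"
  crho :: "vec \<Rightarrow> 'x"

definition smooth_action :: "'g liegroup \<Rightarrow> nat \<Rightarrow> vec set \<Rightarrow> ('g \<Rightarrow> vec \<Rightarrow> vec) \<Rightarrow> bool" where
  "smooth_action G m U act \<longleftrightarrow>
     (\<forall>g \<in> carrier G. \<forall>x \<in> U. act g x \<in> U) \<and>
     (\<forall>x \<in> U. act \<one>\<^bsub>G\<^esub> x = x) \<and>
     (\<forall>g \<in> carrier G. \<forall>h \<in> carrier G. \<forall>x \<in> U. act (g \<otimes>\<^bsub>G\<^esub> h) x = act g (act h x)) \<and>
     (\<forall>(W, \<kappa>) \<in> gatlas G.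
        smooth_map (gdim G + m)
          {z \<in> topspace (Euclidean_space (gdim G + m)). fstc (gdim G) z \<in> \<kappa> ` W \<and> sndc (gdim G) z \<in> U}
          m (\<lambda>z. act (inv_into W \<kappa> (fstc (gdim G) z)) (sndc (gdim G) z)))"

definition orbit :: "('g, 'x) chart \<Rightarrow> vec \<Rightarrow> vec set" where
  "orbit c x = (\<lambda>g. cact c g x) ` carrier (cgrp c)"

text \<open>The quotient topology on the set of orbits.\<close>

definition orbit_space :: "('g, 'x) chart \<Rightarrow> vec set topology" where
  "orbit_space c = topology (\<lambda>\<O>. \<O> \<subseteq> orbit c ` cdom c \<and>
     openin (Euclidean_space (cdim c)) {x \<in> cdom c. orbit c x \<in> \<O>})"

lemma istopology_orbit_space:
  "istopology (\<lambda>\<O>. \<O> \<subseteq> orbit c ` cdom c \<and>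
     openin (Euclidean_space (cdim c)) {x \<in> cdom c. orbit c x \<in> \<O>})"
proof -
  have 1: "{x \<in> cdom c. orbit c x \<in> A \<inter> B} =
      {x \<in> cdom c. orbit c x \<in> A} \<inter> {x \<in> cdom c. orbit c x \<in> B}" for A B
    by auto
  have 2: "{x \<in> cdom c. orbit c x \<in> \<Union>\<K>} = (\<Union>A\<in>\<K>. {x \<in> cdom c. orbit c x \<in> A})" for \<K>
    by auto
  show ?thesis
    unfolding istopology_def 1 2 by (auto intro!: openin_clauses(3))
qed

definition orbispace_chart :: "'x topology \<Rightarrow> ('g, 'x) chart \<Rightarrow> bool" where
  "orbispace_chart T c \<longleftrightarrow>
     openin (Euclidean_space (cdim c)) (cdom c) \<and>
     compact_lie_group (cgrp c) \<and>
     smooth_action (cgrp c) (cdim c) (cdom c) (cact c) \<and>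
     continuous_map (subtopology (Euclidean_space (cdim c)) (cdom c)) T (crho c) \<and>
     (\<forall>g \<in> carrier (cgrp c). \<forall>x \<in> cdom c. crho c (cact c g x) = crho c x) \<and>
     openin T (crho c ` cdom c) \<and>
     (\<exists>h. homeomorphic_map (orbit_space c) (subtopology T (crho c ` cdom c)) h \<and>
          (\<forall>x \<in> cdom c. h (orbit c x) = crho c x))"

text \<open>The morphisms of charts that are open embeddings.\<close>

definition chart_embedding ::
    "('g, 'x) chart \<Rightarrow> ('g, 'x) chart \<Rightarrow> (vec \<Rightarrow> vec) \<Rightarrow> ('g \<Rightarrow> 'g) \<Rightarrow> bool" where
  "chart_embedding c c' \<phi> \<iota> \<longleftrightarrow>
     cdim c = cdim c' \<and> \<phi> ` cdom c \<subseteq> cdom c' \<and> smooth_map (cdim c) (cdom c) (cdim c') \<phi> \<and>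
     \<iota> \<in> hom (cgrp c) (cgrp c') \<and> continuous_map (gtop (cgrp c)) (gtop (cgrp c')) \<iota> \<and>
     (\<forall>h \<in> carrier (cgrp c). \<forall>y \<in> cdom c. \<phi> (cact c h y) = cact c' (\<iota> h) (\<phi> y)) \<and>
     (\<forall>y \<in> cdom c. crho c' (\<phi> y) = crho c y) \<and>
     openin (Euclidean_space (cdim c')) (\<phi> ` cdom c) \<and>
     (\<exists>\<psi>. smooth_map (cdim c') (\<phi> ` cdom c) (cdim c) \<psi> \<and> (\<forall>y \<in> cdom c. \<psi> (\<phi> y) = y)) \<and>
     (\<exists>h. embedding_map (orbit_space c) (orbit_space c') h \<and>
          openin (orbit_space c') (h ` topspace (orbit_space c)) \<and>
          (\<forall>y \<in> cdom c. h (orbit c y) = orbit c' (\<phi> y)))"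

definition paracompact_space :: "'x topology \<Rightarrow> bool" where
  "paracompact_space T \<longleftrightarrow>
     (\<forall>\<C>. (\<forall>C \<in> \<C>. openin T C) \<and> \<Union>\<C> = topspace T \<longrightarrow>
        (\<exists>\<D>. (\<forall>D \<in> \<D>. openin T D \<and> (\<exists>C \<in> \<C>. D \<subseteq> C)) \<and> \<Union>\<D> = topspace T \<and> locally_finite_in T \<D>))"

text \<open>
  The functor: \<open>ochart X U\<close> is the chart of the object \<open>U\<close>, and \<open>ophi X V U\<close>, \<open>oiota X V U\<close> are the two
  components of the image of the inclusion \<open>V \<subseteq> U\<close>.
\<close>

record ('g, 'x) orbispace =
  otop :: "'x topology"
  ocover :: "'x set set"
  ochart :: "'x set \<Rightarrow> ('g, 'x) chart"
  ophi :: "'x set \<Rightarrow> 'x set \<Rightarrow> vec \<Rightarrow> vec"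
  oiota :: "'x set \<Rightarrow> 'x set \<Rightarrow> 'g \<Rightarrow> 'g"

definition objs :: "('g, 'x) orbispace \<Rightarrow> 'x set set" where
  "objs X = (\<Union>\<F> \<in> {\<F>. finite \<F> \<and> \<F> \<noteq> {} \<and> \<F> \<subseteq> ocover X}.
               connected_components_of (subtopology (otop X) (\<Inter>\<F>)))"

definition is_orbispace :: "('g, 'x) orbispace \<Rightarrow> bool" where
  "is_orbispace X \<longleftrightarrow>
     second_countable (otop X) \<and> locally_connected_space (otop X) \<and>
     paracompact_space (otop X) \<and> Hausdorff_space (otop X) \<and>
     (\<forall>U \<in> ocover X. openin (otop X) U) \<and> \<Union> (ocover X) = topspace (otop X) \<and>
     (\<forall>U \<in> objs X.
        orbispace_chart (otop X) (ochart X U) \<and>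
        crho (ochart X U) ` cdom (ochart X U) = U \<and>
        connectedin (Euclidean_space (cdim (ochart X U))) (cdom (ochart X U)) \<and>
        (\<forall>x \<in> cdom (ochart X U). ophi X U U x = x) \<and>
        (\<forall>g \<in> carrier (cgrp (ochart X U)). oiota X U U g = g)) \<and>
     (\<forall>U \<in> objs X. \<forall>V \<in> objs X. V \<subseteq> U \<longrightarrow>
        chart_embedding (ochart X V) (ochart X U) (ophi X V U) (oiota X V U)) \<and>
     (\<forall>U \<in> objs X. \<forall>V \<in> objs X. \<forall>W \<in> objs X. W \<subseteq> V \<and> V \<subseteq> U \<longrightarrow>
        (\<forall>x \<in> cdom (ochart X W). ophi X V U (ophi X W V x) = ophi X W U x) \<and>
        (\<forall>g \<in> carrier (cgrp (ochart X W)). oiota X V U (oiota X W V g) = oiota X W U g))"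

section \<open>Symplectic orbispaces\<close>

text \<open>Components of \<open>\<Sum>\<^sub>j dx\<^sub>j \<and> dx\<^sub>n\<^sub>+\<^sub>j\<close> on \<open>\<real>\<^sup>2\<^sup>n\<close>.\<close>

definition omega :: "nat \<Rightarrow> nat \<Rightarrow> nat \<Rightarrow> real" where
  "omega n k l = (if k < n \<and> l = n + k then 1 else if l < n \<and> k = n + l then -1 else 0)"

definition omega_form :: "nat \<Rightarrow> vec \<Rightarrow> vec \<Rightarrow> real" where
  "omega_form n v w = (\<Sum>k<2*n. \<Sum>l<2*n. omega n k l * v k * w l)"

definition hdim :: "('g, 'x) orbispace \<Rightarrow> 'x set \<Rightarrow> nat" where
  "hdim X U = cdim (ochart X U) div 2"

text \<open>
  The charts are in Darboux form: even-dimensional, \<open>\<omega>\<close> standard (so nondegenerate and closed), the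
  groups acting by symplectic matrices (so \<open>\<omega>\<close> is invariant); and \<open>\<phi>\<^sup>*\<omega> = \<omega>\<close> for all morphisms.
\<close>

definition symplectic_orbispace :: "('g, 'x) orbispace \<Rightarrow> bool" where
  "symplectic_orbispace X \<longleftrightarrow>
     is_orbispace X \<and>
     (\<forall>U \<in> objs X. cdim (ochart X U) = 2 * hdim X U \<and>
        (\<forall>g \<in> carrier (cgrp (ochart X U)). \<exists>A :: nat \<Rightarrow> nat \<Rightarrow> real.
           (\<forall>x \<in> cdom (ochart X U). \<forall>i < 2 * hdim X U.
              cact (ochart X U) g x i = (\<Sum>j < 2 * hdim X U. A i j * x j)) \<and>
           (\<forall>k < 2 * hdim X U. \<forall>l < 2 * hdim X U.
              omega_form (hdim X U) (\<lambda>i. A i k) (\<lambda>i. A i l) = omega (hdim X U) k l))) \<and>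
     (\<forall>U \<in> objs X. \<forall>V \<in> objs X. V \<subseteq> U \<longrightarrow>
        (\<forall>y \<in> cdom (ochart X V). \<forall>k < 2 * hdim X V. \<forall>l < 2 * hdim X V.
           omega_form (hdim X U) (\<lambda>i. jac (ophi X V U) y i k) (\<lambda>i. jac (ophi X V U) y i l)
             = omega (hdim X V) k l))"

section \<open>Smooth functions and star products\<close>

text \<open>Functions on \<open>X\<close> are represented by total functions vanishing outside \<open>X\<close>.\<close>

definition smooth_functions :: "('g, 'x) orbispace \<Rightarrow> ('x \<Rightarrow> complex) set" where
  "smooth_functions X = {f.
     continuous_map (otop X) euclidean f \<and> (\<forall>x. x \<notin> topspace (otop X) \<longrightarrow> f x = 0) \<and>
     (\<forall>U \<in> objs X. smooth_fun (cdim (ochart X U)) (cdom (ochart X U)) (\<lambda>z. f (crho (ochart X U) z)))}"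

definition one_fun :: "('g, 'x) orbispace \<Rightarrow> 'x \<Rightarrow> complex" where
  "one_fun X x = (if x \<in> topspace (otop X) then 1 else 0)"

definition pbracket :: "nat \<Rightarrow> (vec \<Rightarrow> complex) \<Rightarrow> (vec \<Rightarrow> complex) \<Rightarrow> vec \<Rightarrow> complex" where
  "pbracket n f g x = (\<Sum>k<2*n. \<Sum>l<2*n. of_real (omega n k l) * pd k f x * pd l g x)"

text \<open>The function on \<open>X\<close> whose lift to every chart is the family \<open>F\<close>.\<close>

definition descend ::
    "('g, 'x) orbispace \<Rightarrow> ('x set \<Rightarrow> vec \<Rightarrow> complex) \<Rightarrow> 'x \<Rightarrow> complex" where
  "descend X F x = (if x \<in> topspace (otop X)
     then (THE z. \<exists>U \<in> objs X. \<exists>u \<in> cdom (ochart X U). crho (ochart X U) u = x \<and> z = F U u)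
     else 0)"

definition poisson_bracket ::
    "('g, 'x) orbispace \<Rightarrow> ('x \<Rightarrow> complex) \<Rightarrow> ('x \<Rightarrow> complex) \<Rightarrow> 'x \<Rightarrow> complex" where
  "poisson_bracket X f g =
     descend X (\<lambda>U. pbracket (hdim X U) (f \<circ> crho (ochart X U)) (g \<circ> crho (ochart X U)))"

text \<open>Formal power series in \<open>\<lambda>\<close> with coefficients functions on \<open>X\<close>: \<open>F k\<close> is the coefficient of \<open>\<lambda>\<^sup>k\<close>.\<close>

type_synonym 'x fseries = "nat \<Rightarrow> 'x \<Rightarrow> complex"

definition smooth_series :: "('g, 'x) orbispace \<Rightarrow> 'x fseries set" where
  "smooth_series X = {F. \<forall>k. F k \<in> smooth_functions X}"

definition const_series :: "('x \<Rightarrow> complex) \<Rightarrow> 'x fseries" where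
  "const_series f = (\<lambda>k. if k = 0 then f else 0)"

definition series_scale :: "complex fps \<Rightarrow> 'x fseries \<Rightarrow> 'x fseries" where
  "series_scale c F = (\<lambda>k x. \<Sum>i\<le>k. fps_nth c i * F (k - i) x)"

definition bilinear_product ::
    "('g, 'x) orbispace \<Rightarrow> ('x fseries \<Rightarrow> 'x fseries \<Rightarrow> 'x fseries) \<Rightarrow> bool" where
  "bilinear_product X star \<longleftrightarrow>
     (\<forall>F \<in> smooth_series X. \<forall>G \<in> smooth_series X. star F G \<in> smooth_series X) \<and>
     (\<forall>F \<in> smooth_series X. \<forall>F' \<in> smooth_series X. \<forall>G \<in> smooth_series X.
        star (F + F') G = star F G + star F' G \<and> star G (F + F') = star G F + star G F') \<and>
     (\<forall>c. \<forall>F \<in> smooth_series X. \<forall>G \<in> smooth_series X.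
        star (series_scale c F) G = series_scale c (star F G) \<and>
        star F (series_scale c G) = series_scale c (star F G))"

definition bilinear_functions ::
    "('g, 'x) orbispace \<Rightarrow> (('x \<Rightarrow> complex) \<Rightarrow> ('x \<Rightarrow> complex) \<Rightarrow> 'x \<Rightarrow> complex) \<Rightarrow> bool" where
  "bilinear_functions X \<mu> \<longleftrightarrow>
     (\<forall>f \<in> smooth_functions X. \<forall>g \<in> smooth_functions X. \<mu> f g \<in> smooth_functions X) \<and>
     (\<forall>f \<in> smooth_functions X. \<forall>f' \<in> smooth_functions X. \<forall>g \<in> smooth_functions X.
        \<mu> (f + f') g = \<mu> f g + \<mu> f' g \<and> \<mu> g (f + f') = \<mu> g f + \<mu> g f') \<and>
     (\<forall>c. \<forall>f \<in> smooth_functions X. \<forall>g \<in> smooth_functions X.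
        \<mu> (\<lambda>x. c * f x) g = (\<lambda>x. c * \<mu> f g x) \<and> \<mu> f (\<lambda>x. c * g x) = (\<lambda>x. c * \<mu> f g x))"

definition star_product ::
    "('g, 'x) orbispace \<Rightarrow> ('x fseries \<Rightarrow> 'x fseries \<Rightarrow> 'x fseries) \<Rightarrow> bool" where
  "star_product X star \<longleftrightarrow>
     bilinear_product X star \<and>
     (\<forall>F \<in> smooth_series X. \<forall>G \<in> smooth_series X. \<forall>H \<in> smooth_series X.
        star (star F G) H = star F (star G H)) \<and>
     (\<exists>\<mu>. (\<forall>k. bilinear_functions X (\<mu> k)) \<and>
        (\<forall>f \<in> smooth_functions X. \<forall>g \<in> smooth_functions X.
           star (const_series f) (const_series g) = (\<lambda>k. \<mu> k f g) \<and> \<mu> 0 f g = (\<lambda>x. f x * g x))) \<and>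
     (\<forall>f \<in> smooth_functions X. \<forall>g \<in> smooth_functions X.
        \<exists>H \<in> smooth_series X.
          star (const_series f) (const_series g) - star (const_series g) (const_series f)
            - series_scale (fps_const \<i> * fps_X) (const_series (poisson_bracket X f g))
          = series_scale (fps_X ^ 2) H) \<and>
     (\<forall>f \<in> smooth_functions X.
        star (const_series f) (const_series (one_fun X)) = const_series f \<and>
        star (const_series (one_fun X)) (const_series f) = const_series f)"

section \<open>The Weyl algebra with exterior coefficients\<close>

text \<open>
  An element \<open>\<Sum> a k \<alpha> J \<sqdot> y\<^sup>\<alpha> dx\<^sub>J \<lambda>\<^sup>k\<close> is represented by its coefficients; \<open>\<alpha>\<close> is a multiset of indices
  and \<open>dx\<^sub>J\<close> is the wedge product of the \<open>dx\<^sub>j\<close>, \<open>j \<in> J\<close>, in increasing order.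
\<close>

type_synonym welem = "nat \<Rightarrow> nat multiset \<Rightarrow> nat set \<Rightarrow> complex"

definition welems :: "nat \<Rightarrow> welem set" where
  "welems n = {a. \<forall>k \<alpha> J. a k \<alpha> J \<noteq> 0 \<longrightarrow> set_mset \<alpha> \<subseteq> {..<2*n} \<and> J \<subseteq> {..<2*n}}"

definition wscale :: "complex \<Rightarrow> welem \<Rightarrow> welem" where
  "wscale c a = (\<lambda>k \<alpha> J. c * a k \<alpha> J)"

definition wone :: welem where
  "wone = (\<lambda>k \<alpha> J. if k = 0 \<and> \<alpha> = {#} \<and> J = {} then 1 else 0)"

definition ydiff :: "nat \<Rightarrow> welem \<Rightarrow> welem" where
  "ydiff i a = (\<lambda>k \<alpha> J. of_nat (count \<alpha> i + 1) * a k (add_mset i \<alpha>) J)"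

definition ymul :: "nat \<Rightarrow> welem \<Rightarrow> welem" where
  "ymul i a = (\<lambda>k \<alpha> J. if i \<in># \<alpha> then a k (\<alpha> - {#i#}) J else 0)"

text \<open>Left multiplication by \<open>dx\<^sub>j\<close>, and contraction with \<open>\<partial>/\<partial>x\<^sub>j\<close>.\<close>

definition dxwedge :: "nat \<Rightarrow> welem \<Rightarrow> welem" where
  "dxwedge j a = (\<lambda>k \<alpha> J. if j \<in> J then (-1) ^ card {l \<in> J. l < j} * a k \<alpha> (J - {j}) else 0)"

definition dxcontract :: "nat \<Rightarrow> welem \<Rightarrow> welem" where
  "dxcontract j a = (\<lambda>k \<alpha> J. if j \<notin> J then (-1) ^ card {l \<in> J. l < j} * a k \<alpha> (insert j J) else 0)"

text \<open>The product of the symmetric and exterior algebras: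
  \<open>dx\<^sub>K \<and> dx\<^sub>L = \<plusminus> dx\<^sub>K\<^sub>\<union>\<^sub>L\<close> with the sign of the shuffle, for disjoint \<open>K\<close>, \<open>L\<close>.\<close>

definition wmult :: "welem \<Rightarrow> welem \<Rightarrow> welem" where
  "wmult a b = (\<lambda>k \<alpha> J.
     \<Sum>p\<le>k. \<Sum>\<beta> \<in> {\<beta>. \<beta> \<subseteq># \<alpha>}. \<Sum>K \<in> Pow J.
       (-1) ^ card {(i, j). i \<in> K \<and> j \<in> J - K \<and> j < i} * a p \<beta> K * b (k - p) (\<alpha> - \<beta>) (J - K))"

text \<open>
  Components of the Poisson bivector \<open>\<Pi> = \<Sum>\<^sub>j \<partial>\<^sub>n\<^sub>+\<^sub>j \<and> \<partial>\<^sub>j\<close> with \<open>u \<and> v = (u \<otimes> v - v \<otimes> u)/2\<close>. This sign and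
  normalization are the ones for which \<open>[y\<^sub>j, y\<^sub>n\<^sub>+\<^sub>j] = i\<lambda>\<close>, as required by
  \<open>\<nabla>b = db + (i/\<lambda>)[\<Gamma>, b]\<close> and by \<open>f \<star> g - g \<star> f = i\<lambda>{f, g} + O(\<lambda>\<^sup>2)\<close>.
\<close>

definition bivec :: "nat \<Rightarrow> nat \<Rightarrow> nat \<Rightarrow> real" where
  "bivec n i j = - omega n i j / 2"

text \<open>\<open>\<mu>(\<Pi>\<^sup>s (a \<otimes> b))\<close>\<close>

primrec moyal_term :: "nat \<Rightarrow> nat \<Rightarrow> welem \<Rightarrow> welem \<Rightarrow> welem" where
  "moyal_term n 0 a b = wmult a b"
| "moyal_term n (Suc s) a b =
     (\<Sum>i<2*n. \<Sum>j<2*n. wscale (of_real (bivec n i j)) (moyal_term n s (ydiff i a) (ydiff j b)))"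

definition moyal :: "nat \<Rightarrow> welem \<Rightarrow> welem \<Rightarrow> welem" where
  "moyal n a b = (\<lambda>k \<alpha> J. \<Sum>s\<le>k. (- \<i>) ^ s / fact s * moyal_term n s a b (k - s) \<alpha> J)"

definition form_part :: "nat \<Rightarrow> welem \<Rightarrow> welem" where
  "form_part l a = (\<lambda>k \<alpha> J. if card J = l then a k \<alpha> J else 0)"

definition gcomm :: "nat \<Rightarrow> welem \<Rightarrow> welem \<Rightarrow> welem" where
  "gcomm n a b = (\<Sum>p\<le>2*n. \<Sum>q\<le>2*n.
     moyal n (form_part p a) (form_part q b)
       - wscale ((-1) ^ (p * q)) (moyal n (form_part q b) (form_part p a)))"

text \<open>\<open>(i/\<lambda>) c\<close>, applied only to \<open>c\<close> with vanishing coefficient of \<open>\<lambda>\<^sup>0\<close> (graded commutators, squares of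
  1-forms).\<close>

definition i_over_lambda :: "welem \<Rightarrow> welem" where
  "i_over_lambda c = (\<lambda>k. wscale \<i> c (Suc k))"

definition delta :: "nat \<Rightarrow> welem \<Rightarrow> welem" where
  "delta n a = (\<Sum>k<2*n. dxwedge k (ydiff k a))"

definition delta_star :: "nat \<Rightarrow> welem \<Rightarrow> welem" where
  "delta_star n a = (\<Sum>k<2*n. ymul k (dxcontract k a))"

text \<open>\<open>size \<alpha>\<close> and \<open>card J\<close> are the \<open>y\<close>-degree and the form degree of a component.\<close>

definition delta_inv :: "nat \<Rightarrow> welem \<Rightarrow> welem" where
  "delta_inv n a = delta_star n
     (\<lambda>k \<alpha> J. if size \<alpha> + card J > 0 then a k \<alpha> J / of_nat (size \<alpha> + card J) else 0)"

text \<open>Pullback along a linear map with matrix \<open>A\<close>: \<open>y\<^sub>j \<mapsto> \<Sum>\<^sub>k A\<^sub>j\<^sub>k y\<^sub>k\<close>, \<open>dx\<^sub>j \<mapsto> \<Sum>\<^sub>k A\<^sub>j\<^sub>k dx\<^sub>k\<close>;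
  \<open>subst_monomial\<close> is the image of \<open>y\<^sup>\<alpha> dx\<^sub>J\<close>, and \<open>m\<close>, \<open>m'\<close> are the dimensions of source and target.\<close>

definition subst_monomial :: "nat \<Rightarrow> (nat \<Rightarrow> nat \<Rightarrow> real) \<Rightarrow> nat multiset \<Rightarrow> nat set \<Rightarrow> welem" where
  "subst_monomial m A \<alpha> J =
     foldr (\<lambda>j a. \<Sum>k<m. wscale (of_real (A j k)) (ymul k a)) (sorted_list_of_multiset \<alpha>)
       (foldr (\<lambda>j a. \<Sum>k<m. wscale (of_real (A j k)) (dxwedge k a)) (sorted_list_of_set J) wone)"

definition wpull :: "nat \<Rightarrow> nat \<Rightarrow> (nat \<Rightarrow> nat \<Rightarrow> real) \<Rightarrow> welem \<Rightarrow> welem" where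
  "wpull m m' A b = (\<lambda>k \<beta> K.
     \<Sum>\<alpha> \<in> {\<alpha>. set_mset \<alpha> \<subseteq> {..<m'} \<and> size \<alpha> = size \<beta>}. \<Sum>J \<in> Pow {..<m'}.
       b k \<alpha> J * subst_monomial m A \<alpha> J 0 \<beta> K)"

section \<open>Stratified sections\<close>

text \<open>A section is a family indexed by the objects; values outside the objects and domains are 0.\<close>

type_synonym 'x wsection = "'x set \<Rightarrow> vec \<Rightarrow> welem"

definition str_sections :: "('g, 'x) orbispace \<Rightarrow> 'x wsection set" where
  "str_sections X = {b.
     (\<forall>U z. \<not> (U \<in> objs X \<and> z \<in> cdom (ochart X U)) \<longrightarrow> b U z = 0) \<and>
     (\<forall>U \<in> objs X.
        (\<forall>z \<in> cdom (ochart X U). b U z \<in> welems (hdim X U)) \<and>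
        (\<forall>k \<alpha> J. smooth_fun (2 * hdim X U) (cdom (ochart X U)) (\<lambda>z. b U z k \<alpha> J)) \<and>
        (\<forall>g \<in> carrier (cgrp (ochart X U)). \<forall>z \<in> cdom (ochart X U).
           wpull (2 * hdim X U) (2 * hdim X U) (jac (cact (ochart X U) g) z)
             (b U (cact (ochart X U) g z)) = b U z)) \<and>
     (\<forall>U \<in> objs X. \<forall>V \<in> objs X. V \<subseteq> U \<longrightarrow>
        (\<forall>y \<in> cdom (ochart X V).
           wpull (2 * hdim X V) (2 * hdim X U) (jac (ophi X V U) y) (b U (ophi X V U y)) = b V y))}"

definition str_forms :: "('g, 'x) orbispace \<Rightarrow> nat \<Rightarrow> 'x wsection set" where
  "str_forms X l = {b \<in> str_sections X. \<forall>U z k \<alpha> J. b U z k \<alpha> J \<noteq> 0 \<longrightarrow> card J = l}"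

definition fedosov_degree :: "'x wsection \<Rightarrow> enat" where
  "fedosov_degree b = (INF (U, z, k, \<alpha>, J) \<in> {(U, z, k, \<alpha>, J). b U z k \<alpha> J \<noteq> 0}. enat (size \<alpha> + 2 * k))"

definition symbol_map :: "('g, 'x) orbispace \<Rightarrow> 'x wsection \<Rightarrow> 'x fseries" where
  "symbol_map X b = (\<lambda>k. descend X (\<lambda>U z. b U z k {#} {}))"

definition section_scale :: "complex \<Rightarrow> 'x wsection \<Rightarrow> 'x wsection" where
  "section_scale c b = (\<lambda>U z. wscale c (b U z))"

definition section_moyal :: "('g, 'x) orbispace \<Rightarrow> 'x wsection \<Rightarrow> 'x wsection \<Rightarrow> 'x wsection" where
  "section_moyal X a b = (\<lambda>U z. moyal (hdim X U) (a U z) (b U z))"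

definition section_gcomm :: "('g, 'x) orbispace \<Rightarrow> 'x wsection \<Rightarrow> 'x wsection \<Rightarrow> 'x wsection" where
  "section_gcomm X a b = (\<lambda>U z. gcomm (hdim X U) (a U z) (b U z))"

definition section_i_over_lambda :: "'x wsection \<Rightarrow> 'x wsection" where
  "section_i_over_lambda c = (\<lambda>U z. i_over_lambda (c U z))"

definition section_delta :: "('g, 'x) orbispace \<Rightarrow> 'x wsection \<Rightarrow> 'x wsection" where
  "section_delta X b = (\<lambda>U z. delta (hdim X U) (b U z))"

definition section_delta_inv :: "('g, 'x) orbispace \<Rightarrow> 'x wsection \<Rightarrow> 'x wsection" where
  "section_delta_inv X b = (\<lambda>U z. delta_inv (hdim X U) (b U z))"

definition on_domains :: "('g, 'x) orbispace \<Rightarrow> 'x wsection \<Rightarrow> 'x wsection" where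
  "on_domains X b = (\<lambda>U z. if U \<in> objs X \<and> z \<in> cdom (ochart X U) then b U z else 0)"

section \<open>Connections\<close>

type_synonym vfield = "vec \<Rightarrow> vec"

definition is_vfield :: "nat \<Rightarrow> vec set \<Rightarrow> vfield \<Rightarrow> bool" where
  "is_vfield m U \<xi> \<longleftrightarrow> smooth_map m U m \<xi>"

definition fmul :: "(vec \<Rightarrow> real) \<Rightarrow> vfield \<Rightarrow> vfield" where
  "fmul f \<xi> = (\<lambda>x i. f x * \<xi> x i)"

definition coord_field :: "nat \<Rightarrow> vfield" where
  "coord_field j = (\<lambda>x i. if i = j then 1 else 0)"

definition dderiv :: "nat \<Rightarrow> vfield \<Rightarrow> (vec \<Rightarrow> real) \<Rightarrow> vec \<Rightarrow> real" where
  "dderiv m \<xi> f x = (\<Sum>i<m. \<xi> x i * pd i f x)"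

text \<open>\<open>nab \<xi> \<eta>\<close> is the covariant derivative of \<open>\<eta>\<close> in the direction \<open>\<xi>\<close>. Only the values of fields on \<open>U\<close>
  are meaningful, hence the congruence condition.\<close>

definition affine_connection :: "nat \<Rightarrow> vec set \<Rightarrow> (vfield \<Rightarrow> vfield \<Rightarrow> vfield) \<Rightarrow> bool" where
  "affine_connection m U nab \<longleftrightarrow>
     (\<forall>\<xi> \<eta>. is_vfield m U \<xi> \<and> is_vfield m U \<eta> \<longrightarrow>
        is_vfield m U (nab \<xi> \<eta>) \<and>
        (\<forall>\<xi>' \<eta>'. (\<forall>x \<in> U. \<xi> x = \<xi>' x \<and> \<eta> x = \<eta>' x) \<longrightarrow> (\<forall>x \<in> U. nab \<xi> \<eta> x = nab \<xi>' \<eta>' x)) \<and>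
        (\<forall>\<zeta>. is_vfield m U \<zeta> \<longrightarrow>
           (\<forall>x \<in> U. nab (\<xi> + \<zeta>) \<eta> x = nab \<xi> \<eta> x + nab \<zeta> \<eta> x \<and>
                    nab \<xi> (\<eta> + \<zeta>) x = nab \<xi> \<eta> x + nab \<xi> \<zeta> x)) \<and>
        (\<forall>f. smooth_fun m U f \<longrightarrow>
           (\<forall>x \<in> U. nab (fmul f \<xi>) \<eta> x = fmul f (nab \<xi> \<eta>) x \<and>
                    nab \<xi> (fmul f \<eta>) x = fmul (dderiv m \<xi> f) \<eta> x + fmul f (nab \<xi> \<eta>) x)))"

definition related :: "nat \<Rightarrow> vec set \<Rightarrow> (vec \<Rightarrow> vec) \<Rightarrow> vfield \<Rightarrow> vfield \<Rightarrow> bool" where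
  "related m V \<phi> \<xi> \<xi>' \<longleftrightarrow> (\<forall>y \<in> V. push m \<phi> y (\<xi> y) = \<xi>' (\<phi> y))"

text \<open>\<open>\<phi>\<^sup>*(\<nabla>'\<xi>') = \<nabla>\<xi>\<close> as vector-valued 1-forms on the domain \<open>V\<close> of \<open>\<phi>\<close>, evaluated on the coordinate
  fields and moved to the target by \<open>T\<phi>\<close>; \<open>m\<close>, \<open>m'\<close> are the dimensions of source and target.\<close>

definition pulls_back ::
    "nat \<Rightarrow> nat \<Rightarrow> vec set \<Rightarrow> (vec \<Rightarrow> vec) \<Rightarrow> (vfield \<Rightarrow> vfield \<Rightarrow> vfield) \<Rightarrow>
     (vfield \<Rightarrow> vfield \<Rightarrow> vfield) \<Rightarrow> vfield \<Rightarrow> vfield \<Rightarrow> bool" where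
  "pulls_back m m' V \<phi> nab nab' \<xi> \<xi>' \<longleftrightarrow>
     (\<forall>y \<in> V. \<forall>j<m. push m \<phi> y (nab (coord_field j) \<xi> y) =
        (\<lambda>l. \<Sum>i<m'. jac \<phi> y i j * nab' (coord_field i) \<xi>' (\<phi> y) l))"

definition orbi_vfield :: "('g, 'x) orbispace \<Rightarrow> ('x set \<Rightarrow> vfield) \<Rightarrow> bool" where
  "orbi_vfield X \<xi> \<longleftrightarrow>
     (\<forall>U \<in> objs X. is_vfield (cdim (ochart X U)) (cdom (ochart X U)) (\<xi> U) \<and>
        (\<forall>g \<in> carrier (cgrp (ochart X U)).
           related (cdim (ochart X U)) (cdom (ochart X U)) (cact (ochart X U) g) (\<xi> U) (\<xi> U))) \<and>
     (\<forall>U \<in> objs X. \<forall>V \<in> objs X. V \<subseteq> U \<longrightarrow>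
        related (cdim (ochart X V)) (cdom (ochart X V)) (ophi X V U) (\<xi> V) (\<xi> U))"

definition connection :: "('g, 'x) orbispace \<Rightarrow> ('x set \<Rightarrow> vfield \<Rightarrow> vfield \<Rightarrow> vfield) \<Rightarrow> bool" where
  "connection X nab \<longleftrightarrow>
     (\<forall>U \<in> objs X.
        affine_connection (cdim (ochart X U)) (cdom (ochart X U)) (nab U) \<and>
        (\<forall>g \<in> carrier (cgrp (ochart X U)). \<forall>\<xi> \<xi>'.
           is_vfield (cdim (ochart X U)) (cdom (ochart X U)) \<xi> \<and>
           is_vfield (cdim (ochart X U)) (cdom (ochart X U)) \<xi>' \<and>
           related (cdim (ochart X U)) (cdom (ochart X U)) (cact (ochart X U) g) \<xi> \<xi>' \<longrightarrow>
           pulls_back (cdim (ochart X U)) (cdim (ochart X U)) (cdom (ochart X U))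
             (cact (ochart X U) g) (nab U) (nab U) \<xi> \<xi>')) \<and>
     (\<forall>\<xi>. orbi_vfield X \<xi> \<longrightarrow>
        (\<forall>U \<in> objs X. \<forall>V \<in> objs X. V \<subseteq> U \<longrightarrow>
           pulls_back (cdim (ochart X V)) (cdim (ochart X U)) (cdom (ochart X V))
             (ophi X V U) (nab V) (nab U) (\<xi> V) (\<xi> U)))"

definition symplectic_connection ::
    "('g, 'x) orbispace \<Rightarrow> ('x set \<Rightarrow> vfield \<Rightarrow> vfield \<Rightarrow> vfield) \<Rightarrow> bool" where
  "symplectic_connection X nab \<longleftrightarrow>
     connection X nab \<and>
     (\<forall>U \<in> objs X. \<forall>\<zeta> \<xi> \<eta>.
        is_vfield (2 * hdim X U) (cdom (ochart X U)) \<zeta> \<and>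
        is_vfield (2 * hdim X U) (cdom (ochart X U)) \<xi> \<and>
        is_vfield (2 * hdim X U) (cdom (ochart X U)) \<eta> \<longrightarrow>
        (\<forall>x \<in> cdom (ochart X U).
           dderiv (2 * hdim X U) \<zeta> (\<lambda>z. omega_form (hdim X U) (\<xi> z) (\<eta> z)) x
             - omega_form (hdim X U) (nab U \<zeta> \<xi> x) (\<eta> x)
             - omega_form (hdim X U) (\<xi> x) (nab U \<zeta> \<eta> x) = 0))"

text \<open>The Christoffel symbols, i.e. the solution of
  \<open>\<nabla>\<^bsub>\<partial>i\<^esub> \<partial>\<^sub>j = \<Sum>\<^sub>k\<^sub>l \<Gamma>\<^sub>i\<^sub>j\<^sub>k \<omega>\<^sub>k\<^sub>l \<partial>\<^sub>l\<close> (the matrix \<open>\<omega>\<close> is orthogonal).\<close>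

definition christoffel ::
    "nat \<Rightarrow> (vfield \<Rightarrow> vfield \<Rightarrow> vfield) \<Rightarrow> nat \<Rightarrow> nat \<Rightarrow> nat \<Rightarrow> vec \<Rightarrow> real" where
  "christoffel n nab i j k x = (\<Sum>l<2*n. omega n k l * nab (coord_field i) (coord_field j) x l)"

definition gamma_form :: "nat \<Rightarrow> (vfield \<Rightarrow> vfield \<Rightarrow> vfield) \<Rightarrow> vec \<Rightarrow> welem" where
  "gamma_form n nab x = wscale (1 / 2) (\<Sum>i<2*n. \<Sum>j<2*n. \<Sum>k<2*n.
     wscale (of_real (christoffel n nab i j k x)) (ymul i (ymul j (dxwedge k wone))))"

definition wpd :: "nat \<Rightarrow> (vec \<Rightarrow> welem) \<Rightarrow> vec \<Rightarrow> welem" where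
  "wpd j b x = (\<lambda>k \<alpha> J. pd j (\<lambda>z. b z k \<alpha> J) x)"

definition wd :: "nat \<Rightarrow> (vec \<Rightarrow> welem) \<Rightarrow> vec \<Rightarrow> welem" where
  "wd n b x = (\<Sum>j<2*n. dxwedge j (wpd j b x))"

text \<open>The covariant derivative in direction \<open>\<partial>\<^sub>j\<close> of the symmetric tensor part: \<open>\<nabla>\<^bsub>\<partial>j\<^esub>\<close> is the derivation
  with \<open>\<nabla>\<^bsub>\<partial>j\<^esub> y\<^sub>p = - \<Sum>\<^sub>q dx\<^sub>p(\<nabla>\<^bsub>\<partial>j\<^esub> \<partial>\<^sub>q) y\<^sub>q\<close>, the dual connection.\<close>

definition cov_deriv ::
    "nat \<Rightarrow> (vfield \<Rightarrow> vfield \<Rightarrow> vfield) \<Rightarrow> nat \<Rightarrow> (vec \<Rightarrow> welem) \<Rightarrow> vec \<Rightarrow> welem" where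
  "cov_deriv n nab j b x = wpd j b x - (\<Sum>p<2*n. \<Sum>q<2*n.
     wscale (of_real (nab (coord_field j) (coord_field q) x p)) (ymul q (ydiff p (b x))))"

definition nabla ::
    "('g, 'x) orbispace \<Rightarrow> ('x set \<Rightarrow> vfield \<Rightarrow> vfield \<Rightarrow> vfield) \<Rightarrow> 'x wsection \<Rightarrow> 'x wsection" where
  "nabla X nab b = on_domains X (\<lambda>U z.
     \<Sum>j < 2 * hdim X U. dxwedge j (cov_deriv (hdim X U) (nab U) j (b U) z))"

text \<open>\<open>R = d\<Gamma> + (1/2)(i/\<lambda>)[\<Gamma>, \<Gamma>]\<close>, the form with \<open>\<nabla>\<^sup>2 b = (i/\<lambda>)[R, b]\<close>; the factor \<open>i/\<lambda>\<close> is
  the one in \<open>\<nabla> = d + (i/\<lambda>)[\<Gamma>, \<cdot>]\<close>.\<close>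

definition curvature ::
    "('g, 'x) orbispace \<Rightarrow> ('x set \<Rightarrow> vfield \<Rightarrow> vfield \<Rightarrow> vfield) \<Rightarrow> 'x wsection" where
  "curvature X nab = on_domains X (\<lambda>U z.
     wd (hdim X U) (gamma_form (hdim X U) (nab U)) z
       + wscale (1 / 2) (i_over_lambda
           (gcomm (hdim X U) (gamma_form (hdim X U) (nab U) z) (gamma_form (hdim X U) (nab U) z))))"

section \<open>The Fedosov connection\<close>

text \<open>
  \<open>D = \<nabla> + \<epsilon>\<delta> + (i/\<lambda>)[r, \<cdot>]\<close> with a sign \<open>\<epsilon>\<close>. For torsion-free \<open>\<nabla>\<close>,
  \<open>D\<^sup>2 = (i/\<lambda>)[R + \<epsilon>\<delta>r + \<nabla>r + (i/\<lambda>)r\<^sup>2, \<cdot>]\<close>, and \<open>r = \<delta>\<^sup>-(R + \<nabla>r + (i/\<lambda>)r\<^sup>2)\<close> gives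
  \<open>\<delta>r = R + \<nabla>r + (i/\<lambda>)r\<^sup>2\<close> for \<open>\<epsilon> = -1\<close>, the sign of Fedosov's construction. For \<open>\<epsilon> = 1\<close> and this
  normalization of \<open>r\<close>, \<open>D\<close> is flat only if \<open>R = 0\<close>. Both signs are allowed.
\<close>

definition fedosov_D ::
    "('g, 'x) orbispace \<Rightarrow> ('x set \<Rightarrow> vfield \<Rightarrow> vfield \<Rightarrow> vfield) \<Rightarrow> complex \<Rightarrow> 'x wsection \<Rightarrow>
     'x wsection \<Rightarrow> 'x wsection" where
  "fedosov_D X nab eps r b =
     nabla X nab b + section_scale eps (section_delta X b) + section_i_over_lambda (section_gcomm X r b)"

definition flat_sections ::
    "('g, 'x) orbispace \<Rightarrow> ('x wsection \<Rightarrow> 'x wsection) \<Rightarrow> 'x wsection set" where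
  "flat_sections X D = {a \<in> str_forms X 0. D a = 0}"

end

theory Submission
  imports Defs "Jordan_Normal_Form.Determinant"
begin

text \<open>
  A product over formal series is determined by its values on constant series, so \<open>F \<star> G\<close> is the symbol of
  \<open>Q(F) \<circ> Q(G)\<close> for all series. The operator \<open>D\<close> is a derivation of \<open>\<circ>\<close> on sections of form degree 0: the part
  of \<open>\<nabla>\<close> acting on the fibres is a linear Hamiltonian vector field because \<open>\<nabla>\<close> is symplectic. Pullback along
  symplectic maps preserves \<open>\<circ>\<close>. Hence flat sections form an algebra with unit 1, \<open>Q(F \<star> G) = Q(F) \<circ> Q(G)\<close>,
  and \<open>\<star>\<close> inherits associativity and the unit from \<open>\<circ>\<close>. As \<open>r\<close> has Fedosov degree at least 2, the lowest
  order part of \<open>D a = 0\<close> expresses the \<open>y\<close>-linear part of \<open>a = Q(f)\<close> as \<open>\<mp> df\<close>, which turns the first order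
  term of the Moyal commutator into the Poisson bracket.
\<close>

text \<open>Apart from a degree count for the curvature, every Moyal product in the argument has a
  factor of form degree 0. The shuffle signs of \<open>wmult\<close> are then trivial, so the
  coefficient of each dx_J may be read off as a power series in y and \<lambda> by
  \<open>body J\<close>, and the Moyal product becomes a bidifferential product on a commutative
  ring. Its properties are therefore proved for abstract commuting derivations. Even the one-form r
  acts only through its components \<open>body {j}\<close>: a commutator vanishes at order 0 in
  \<lambda>, so dividing it by \<lambda> loses nothing and leaves a derivation. The degree of r is
  bounded through R: \<Gamma> is quadratic in y, so the part of R of order 0 in \<lambda> has no
  term free of y, and \<open>\<delta>\<^sup>-\<close> multiplies by one more y. Both signs of
  \<open>eps\<close> give the same bracket, because df and dg enter it with the same factor, whose
  square is 1. Invariance of the bivector has to be derived from invariance of the form: from A^T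
  \<omega> A = \<omega> one needs A \<omega> A^T = \<omega>.\<close>

lemma sum_fun_apply: "sum f A x = (\<Sum>a\<in>A. f a x)"
  by (induction A rule: infinite_finite_induct) auto

text \<open>Every Cauchy product below depends on this, since a sum over an infinite set is 0. In
  the induction a submultiset either avoids the added element or is an old one with that element put
  back.\<close>

lemma finite_submultisets [simp]: "finite {\<beta>. \<beta> \<subseteq># \<alpha>}"
proof (induction \<alpha>)
  case (add x \<alpha>)
  have "{\<beta>. \<beta> \<subseteq># add_mset x \<alpha>} \<subseteq> {\<beta>. \<beta> \<subseteq># \<alpha>} \<union> add_mset x ` {\<beta>. \<beta> \<subseteq># \<alpha>}"
  proof
    fix \<beta> assume b: "\<beta> \<in> {\<beta>. \<beta> \<subseteq># add_mset x \<alpha>}"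
    show "\<beta> \<in> {\<beta>. \<beta> \<subseteq># \<alpha>} \<union> add_mset x ` {\<beta>. \<beta> \<subseteq># \<alpha>}"
    proof (cases "x \<in># \<beta>")
      case True
      then have "\<beta> = add_mset x (\<beta> - {#x#})" by simp
      moreover have "\<beta> - {#x#} \<subseteq># \<alpha>" using b by (simp add: subset_eq_diff_conv)
      ultimately show ?thesis by blast
    next
      case False
      then have "\<beta> \<subseteq># \<alpha>" using b
        by (metis diff_single_trivial mem_Collect_eq subset_eq_diff_conv add_mset_add_single)
      then show ?thesis by simp
    qed
  qed
  then show ?case by (rule finite_subset) (use add in auto)
qed simp

lemma diff_diff_submultiset: "\<beta> \<subseteq># \<alpha> \<Longrightarrow> \<alpha> - (\<alpha> - \<beta>) = \<beta>"
  by (simp add: multiset_eq_iff subseteq_mset_def)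

section \<open>Formal power series in several variables\<close>

text \<open>The product of functions in \<open>Function_Algebras\<close> is pointwise, so the Cauchy
  product needs a type of its own. Monomials are multisets, as in \<open>welem\<close>.\<close>

typedef ('i, 'a) mps = "UNIV :: ('i multiset \<Rightarrow> 'a) set"
  morphisms mps_coeff Mps ..

setup_lifting type_definition_mps

lemma mps_eqI: "(\<And>\<alpha>. mps_coeff f \<alpha> = mps_coeff g \<alpha>) \<Longrightarrow> f = g"
  by transfer auto

lemma mps_coeff_Mps [simp]: "mps_coeff (Mps f) = f"
  by (simp add: Mps_inverse)

instantiation mps :: (type, comm_ring_1) comm_ring_1
begin

lift_definition zero_mps :: "('a, 'b) mps" is "\<lambda>_. 0" .
lift_definition one_mps :: "('a, 'b) mps" is "\<lambda>\<alpha>. if \<alpha> = {#} then 1 else 0" .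
lift_definition plus_mps :: "('a, 'b) mps \<Rightarrow> ('a, 'b) mps \<Rightarrow> ('a, 'b) mps" is "\<lambda>f g \<alpha>. f \<alpha> + g \<alpha>" .
lift_definition minus_mps :: "('a, 'b) mps \<Rightarrow> ('a, 'b) mps \<Rightarrow> ('a, 'b) mps" is "\<lambda>f g \<alpha>. f \<alpha> - g \<alpha>" .
lift_definition uminus_mps :: "('a, 'b) mps \<Rightarrow> ('a, 'b) mps" is "\<lambda>f \<alpha>. - f \<alpha>" .
lift_definition times_mps :: "('a, 'b) mps \<Rightarrow> ('a, 'b) mps \<Rightarrow> ('a, 'b) mps"
  is "\<lambda>f g \<alpha>. \<Sum>\<beta> | \<beta> \<subseteq># \<alpha>. f \<beta> * g (\<alpha> - \<beta>)" .

instance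
proof
  fix a b c :: "('a, 'b) mps"
  show "a * b * c = a * (b * c)"
  proof transfer
    fix a b c :: "'a multiset \<Rightarrow> 'b"
    show "(\<lambda>\<alpha>. \<Sum>\<beta> | \<beta> \<subseteq># \<alpha>. (\<Sum>\<gamma> | \<gamma> \<subseteq># \<beta>. a \<gamma> * b (\<beta> - \<gamma>)) * c (\<alpha> - \<beta>)) =
      (\<lambda>\<alpha>. \<Sum>\<beta> | \<beta> \<subseteq># \<alpha>. a \<beta> * (\<Sum>\<gamma> | \<gamma> \<subseteq># \<alpha> - \<beta>. b \<gamma> * c (\<alpha> - \<beta> - \<gamma>)))"
    proof
      fix \<alpha> :: "'a multiset"
      have "(\<Sum>\<beta> | \<beta> \<subseteq># \<alpha>. (\<Sum>\<gamma> | \<gamma> \<subseteq># \<beta>. a \<gamma> * b (\<beta> - \<gamma>)) * c (\<alpha> - \<beta>)) =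
        (\<Sum>(\<beta>, \<gamma>) \<in> Sigma {\<beta>. \<beta> \<subseteq># \<alpha>} (\<lambda>\<beta>. {\<gamma>. \<gamma> \<subseteq># \<beta>}). a \<gamma> * b (\<beta> - \<gamma>) * c (\<alpha> - \<beta>))"
        by (subst sum.Sigma [symmetric]) (auto simp: sum_distrib_right)
      \<comment> \<open>A chain \<gamma> \<subseteq> \<beta> \<subseteq> \<alpha> amounts to two
        disjoint blocks \<gamma> and \<beta> - \<gamma> cut out of \<alpha>.\<close>
      also have "\<dots> = (\<Sum>(\<beta>, \<gamma>) \<in> Sigma {\<beta>. \<beta> \<subseteq># \<alpha>} (\<lambda>\<beta>. {\<gamma>. \<gamma> \<subseteq># \<alpha> - \<beta>}).
          a \<beta> * (b \<gamma> * c (\<alpha> - \<beta> - \<gamma>)))"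
        by (rule sum.reindex_bij_witness [where i = "\<lambda>(\<beta>, \<gamma>). (\<beta> + \<gamma>, \<beta>)" and j = "\<lambda>(\<beta>, \<gamma>). (\<gamma>, \<beta> - \<gamma>)"])
           (auto simp: mult.assoc multiset_eq_iff subseteq_mset_def le_diff_conv2 add.commute diff_le_mono
             intro: order_trans)
      also have "\<dots> = (\<Sum>\<beta> | \<beta> \<subseteq># \<alpha>. a \<beta> * (\<Sum>\<gamma> | \<gamma> \<subseteq># \<alpha> - \<beta>. b \<gamma> * c (\<alpha> - \<beta> - \<gamma>)))"
        by (subst sum.Sigma [symmetric]) (auto simp: sum_distrib_left)
      finally show "(\<Sum>\<beta> | \<beta> \<subseteq># \<alpha>. (\<Sum>\<gamma> | \<gamma> \<subseteq># \<beta>. a \<gamma> * b (\<beta> - \<gamma>)) * c (\<alpha> - \<beta>)) =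
        (\<Sum>\<beta> | \<beta> \<subseteq># \<alpha>. a \<beta> * (\<Sum>\<gamma> | \<gamma> \<subseteq># \<alpha> - \<beta>. b \<gamma> * c (\<alpha> - \<beta> - \<gamma>)))" .
    qed
  qed
  show "a * b = b * a"
  proof transfer
    fix a b :: "'a multiset \<Rightarrow> 'b"
    have "(\<Sum>\<beta> | \<beta> \<subseteq># \<alpha>. a \<beta> * b (\<alpha> - \<beta>)) = (\<Sum>\<beta> | \<beta> \<subseteq># \<alpha>. b \<beta> * a (\<alpha> - \<beta>))" for \<alpha>
      by (rule sum.reindex_bij_witness [where i = "\<lambda>\<beta>. \<alpha> - \<beta>" and j = "\<lambda>\<beta>. \<alpha> - \<beta>"])
         (auto simp: mult.commute diff_diff_submultiset)
    then show "(\<lambda>\<alpha>. \<Sum>\<beta> | \<beta> \<subseteq># \<alpha>. a \<beta> * b (\<alpha> - \<beta>)) = (\<lambda>\<alpha>. \<Sum>\<beta> | \<beta> \<subseteq># \<alpha>. b \<beta> * a (\<alpha> - \<beta>))"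
      by simp
  qed
  show "1 * a = a"
  proof transfer
    fix a :: "'a multiset \<Rightarrow> 'b"
    have "(\<Sum>\<beta> | \<beta> \<subseteq># \<alpha>. (if \<beta> = {#} then 1 else 0) * a (\<alpha> - \<beta>)) =
      (\<Sum>\<beta> \<in> {{#}}. (if \<beta> = {#} then 1 else 0) * a (\<alpha> - \<beta>))" for \<alpha>
      by (rule sum.mono_neutral_right) auto
    then show "(\<lambda>\<alpha>. \<Sum>\<beta> | \<beta> \<subseteq># \<alpha>. (if \<beta> = {#} then 1 else 0) * a (\<alpha> - \<beta>)) = a"
      by simp
  qed
  show "(a + b) * c = a * c + b * c"
    by transfer (simp add: distrib_right sum.distrib)
  show "(0::('a, 'b) mps) \<noteq> 1"
    by transfer (metis zero_neq_one)
qed (transfer; simp add: fun_eq_iff add.assoc add.commute)+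

end

lemma mps_coeff_add [simp]: "mps_coeff (f + g) \<alpha> = mps_coeff f \<alpha> + mps_coeff g \<alpha>"
  and mps_coeff_diff [simp]: "mps_coeff (f - g) \<alpha> = mps_coeff f \<alpha> - mps_coeff g \<alpha>"
  and mps_coeff_uminus [simp]: "mps_coeff (- f) \<alpha> = - mps_coeff f \<alpha>"
  and mps_coeff_0 [simp]: "mps_coeff 0 \<alpha> = 0"
  and mps_coeff_1: "mps_coeff 1 \<alpha> = (if \<alpha> = {#} then 1 else 0)"
  and mps_coeff_mult: "mps_coeff (f * g) \<alpha> = (\<Sum>\<beta> | \<beta> \<subseteq># \<alpha>. mps_coeff f \<beta> * mps_coeff g (\<alpha> - \<beta>))"
  by (transfer, simp)+

lemma mps_coeff_sum: "mps_coeff (sum f A) \<alpha> = (\<Sum>a\<in>A. mps_coeff (f a) \<alpha>)"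
  by (induction A rule: infinite_finite_induct) auto

lift_definition mps_const :: "'a \<Rightarrow> ('i, 'a::comm_ring_1) mps" is "\<lambda>c \<alpha>. if \<alpha> = {#} then c else 0" .
lift_definition mps_var :: "'i \<Rightarrow> ('i, 'a::comm_ring_1) mps" is "\<lambda>i \<alpha>. if \<alpha> = {#i#} then 1 else 0" .
lift_definition mps_deriv :: "'i \<Rightarrow> ('i, 'a::comm_ring_1) mps \<Rightarrow> ('i, 'a) mps"
  is "\<lambda>i f \<alpha>. of_nat (count \<alpha> i + 1) * f (add_mset i \<alpha>)" .

lemma mps_coeff_deriv: "mps_coeff (mps_deriv i f) \<alpha> = of_nat (count \<alpha> i + 1) * mps_coeff f (add_mset i \<alpha>)"
  by transfer simp

lemma mps_coeff_const_mult [simp]: "mps_coeff (mps_const c * f) \<alpha> = c * mps_coeff f \<alpha>"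
proof -
  have "mps_coeff (mps_const c * f) \<alpha> = (\<Sum>\<beta>\<in>{{#}}. mps_coeff (mps_const c) \<beta> * mps_coeff f (\<alpha> - \<beta>))"
    unfolding mps_coeff_mult by (rule sum.mono_neutral_right) (auto simp: mps_const.rep_eq)
  then show ?thesis by (simp add: mps_const.rep_eq)
qed

lemma mps_coeff_var_mult:
  "mps_coeff (mps_var i * f) \<alpha> = (if i \<in># \<alpha> then mps_coeff f (\<alpha> - {#i#}) else 0)"
proof -
  have "mps_coeff (mps_var i * f) \<alpha> =
      (\<Sum>\<beta>\<in>(if i \<in># \<alpha> then {{#i#}} else {}). mps_coeff (mps_var i) \<beta> * mps_coeff f (\<alpha> - \<beta>))"
    unfolding mps_coeff_mult by (rule sum.mono_neutral_right) (auto simp: mps_var.rep_eq)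
  then show ?thesis by (simp add: mps_var.rep_eq)
qed

lemma mps_const_add: "mps_const (a + b) = mps_const a + mps_const b"
  by transfer auto

lemma mps_const_mult: "mps_const (a * b) = mps_const a * mps_const b"
  by (rule mps_eqI) (auto simp: mps_const.rep_eq)

lemma mps_const_0 [simp]: "mps_const 0 = 0" and mps_const_1 [simp]: "mps_const 1 = 1"
  by (transfer; auto)+

lemma mps_const_of_nat: "mps_const (of_nat k) = of_nat k"
  by (induction k) (auto simp: mps_const_add)

lemma mps_deriv_add: "mps_deriv i (f + g) = mps_deriv i f + mps_deriv i g"
  by transfer (simp add: distrib_left)

lemma mps_deriv_const [simp]: "mps_deriv i (mps_const c) = 0"
  by transfer auto

lemma mps_deriv_var: "mps_deriv i (mps_var j) = (if i = j then 1 else 0)"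
  by transfer (auto simp: fun_eq_iff)

lemma mps_deriv_commute: "mps_deriv i (mps_deriv j f) = mps_deriv j (mps_deriv i f)"
  by transfer (auto simp: fun_eq_iff add_mset_commute)

(* In the sum over \<beta> \<subseteq> \<alpha> + {i} the weight count (\<alpha> + {i}) i splits as count \<beta> i + count (\<alpha> + {i} - \<beta>) i. *)
lemma mps_deriv_mult: "mps_deriv i (f * g) = mps_deriv i f * g + f * mps_deriv i g"
proof (rule mps_eqI)
  fix \<alpha>
  let ?A = "{\<beta>. \<beta> \<subseteq># add_mset i \<alpha>}"
  have "mps_coeff (mps_deriv i (f * g)) \<alpha> =
      (\<Sum>\<beta>\<in>?A. of_nat (count \<beta> i + count (add_mset i \<alpha> - \<beta>) i) * (mps_coeff f \<beta> * mps_coeff g (add_mset i \<alpha> - \<beta>)))"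
    unfolding mps_coeff_deriv mps_coeff_mult sum_distrib_left
  proof (rule sum.cong)
    fix \<beta> assume "\<beta> \<in> ?A"
    then have "count \<beta> i \<le> count (add_mset i \<alpha>) i"
      by (simp only: mem_Collect_eq mset_subset_eq_count)
    then have "count \<alpha> i + 1 = count \<beta> i + count (add_mset i \<alpha> - \<beta>) i"
      by simp
    then show "of_nat (count \<alpha> i + 1) * (mps_coeff f \<beta> * mps_coeff g (add_mset i \<alpha> - \<beta>)) =
        of_nat (count \<beta> i + count (add_mset i \<alpha> - \<beta>) i) * (mps_coeff f \<beta> * mps_coeff g (add_mset i \<alpha> - \<beta>))"
      by (simp only:)
  qed simp
  also have "\<dots> = (\<Sum>\<beta>\<in>?A. of_nat (count \<beta> i) * (mps_coeff f \<beta> * mps_coeff g (add_mset i \<alpha> - \<beta>))) +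
      (\<Sum>\<beta>\<in>?A. of_nat (count (add_mset i \<alpha> - \<beta>) i) * (mps_coeff f \<beta> * mps_coeff g (add_mset i \<alpha> - \<beta>)))"
    by (simp only: of_nat_add distrib_right sum.distrib)
  also have "(\<Sum>\<beta>\<in>?A. of_nat (count \<beta> i) * (mps_coeff f \<beta> * mps_coeff g (add_mset i \<alpha> - \<beta>))) =
      (\<Sum>\<beta>\<in>?A \<inter> {\<beta>. i \<in># \<beta>}. of_nat (count \<beta> i) * (mps_coeff f \<beta> * mps_coeff g (add_mset i \<alpha> - \<beta>)))"
    by (rule sum.mono_neutral_right) (auto simp: not_in_iff)
  also have "\<dots> = mps_coeff (mps_deriv i f * g) \<alpha>"
    unfolding mps_coeff_mult mps_coeff_deriv
    by (rule sum.reindex_bij_witness [where i = "add_mset i" and j = "\<lambda>\<beta>. \<beta> - {#i#}"])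
       (auto simp: mult.assoc insert_subset_eq_iff subset_eq_diff_conv dest!: multi_member_split)
  also have "(\<Sum>\<beta>\<in>?A. of_nat (count (add_mset i \<alpha> - \<beta>) i) * (mps_coeff f \<beta> * mps_coeff g (add_mset i \<alpha> - \<beta>))) =
      (\<Sum>\<beta> | \<beta> \<subseteq># \<alpha>. of_nat (count (add_mset i \<alpha> - \<beta>) i) * (mps_coeff f \<beta> * mps_coeff g (add_mset i \<alpha> - \<beta>)))"
  proof (rule sum.mono_neutral_right)
    show "\<forall>\<beta>\<in>?A - {\<beta>. \<beta> \<subseteq># \<alpha>}.
        of_nat (count (add_mset i \<alpha> - \<beta>) i) * (mps_coeff f \<beta> * mps_coeff g (add_mset i \<alpha> - \<beta>)) = 0"
    proof
      fix \<beta> assume b: "\<beta> \<in> ?A - {\<beta>. \<beta> \<subseteq># \<alpha>}"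
      \<comment> \<open>A submultiset of \<alpha> + {i} that does not fit into \<alpha> must use
        every copy of i, so its weight is 0.\<close>
      have "count (add_mset i \<alpha> - \<beta>) i = 0"
      proof (rule ccontr)
        assume "count (add_mset i \<alpha> - \<beta>) i \<noteq> 0"
        then have lt: "count \<beta> i < count (add_mset i \<alpha>) i" by simp
        have le: "count \<beta> j \<le> count (add_mset i \<alpha>) j" for j
          using b by (simp only: Diff_iff mem_Collect_eq mset_subset_eq_count)
        have "count \<beta> j \<le> count \<alpha> j" for j
          using lt le [of j] by (cases "j = i") auto
        then have "\<beta> \<subseteq># \<alpha>" by (simp add: subseteq_mset_def)
        with b show False by simp
      qed
      then show "of_nat (count (add_mset i \<alpha> - \<beta>) i) *
          (mps_coeff f \<beta> * mps_coeff g (add_mset i \<alpha> - \<beta>)) = 0"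
        by simp
    qed
  qed (auto intro: subset_mset.order_trans)
  also have "\<dots> = mps_coeff (f * mps_deriv i g) \<alpha>"
    unfolding mps_coeff_mult mps_coeff_deriv
  proof (rule sum.cong)
    fix \<beta> assume "\<beta> \<in> {\<beta>. \<beta> \<subseteq># \<alpha>}"
    then have b: "\<beta> \<subseteq># \<alpha>" by simp
    then have "add_mset i \<alpha> - \<beta> = add_mset i (\<alpha> - \<beta>)"
      by (metis add_mset_add_single subset_mset.diff_add_assoc2)
    then show "of_nat (count (add_mset i \<alpha> - \<beta>) i) * (mps_coeff f \<beta> * mps_coeff g (add_mset i \<alpha> - \<beta>)) =
       mps_coeff f \<beta> * (of_nat (count (\<alpha> - \<beta>) i + 1) * mps_coeff g (add_mset i (\<alpha> - \<beta>)))"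
      by (simp add: algebra_simps)
  qed simp
  finally show "mps_coeff (mps_deriv i (f * g)) \<alpha> = mps_coeff (mps_deriv i f * g + f * mps_deriv i g) \<alpha>"
    by simp
qed

section \<open>Moyal products of commuting derivations\<close>

text \<open>Pascal's rule. It drives the induction in \<open>P_assoc\<close>, where f s t nests an
  inner bidifferential operator of order t in an outer one of order s, and raising an order by one
  means one more factor \<Pi>.\<close>

lemma sum_binomial_Suc:
  fixes f :: "nat \<Rightarrow> nat \<Rightarrow> 'a::comm_semiring_1"
  shows "(\<Sum>s\<le>Suc N. of_nat (Suc N choose s) * f s (Suc N - s)) =
    (\<Sum>s\<le>N. of_nat (N choose s) * f (Suc s) (N - s)) + (\<Sum>s\<le>N. of_nat (N choose s) * f s (Suc (N - s)))"
proof -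
  have "(\<Sum>s\<le>Suc N. of_nat (Suc N choose s) * f s (Suc N - s)) =
      f 0 (Suc N) + (\<Sum>s\<le>N. of_nat (Suc N choose Suc s) * f (Suc s) (N - s))"
    by (subst sum.atMost_Suc_shift) simp
  also have "(\<Sum>s\<le>N. of_nat (Suc N choose Suc s) * f (Suc s) (N - s)) =
      (\<Sum>s\<le>N. of_nat (N choose s) * f (Suc s) (N - s)) + (\<Sum>s\<le>N. of_nat (N choose Suc s) * f (Suc s) (N - s))"
    by (simp add: sum.distrib distrib_right)
  also have "f 0 (Suc N) + (\<dots>) = (\<Sum>s\<le>N. of_nat (N choose s) * f (Suc s) (N - s)) +
      (\<Sum>s\<le>Suc N. of_nat (N choose s) * f s (Suc N - s))"
  proof -
    have "(\<Sum>s\<le>Suc N. of_nat (N choose s) * f s (Suc N - s)) =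
        f 0 (Suc N) + (\<Sum>s\<le>N. of_nat (N choose Suc s) * f (Suc s) (N - s))"
      by (subst sum.atMost_Suc_shift) simp
    then show ?thesis by (simp add: ac_simps)
  qed
  \<comment> \<open>The summand s = N + 1 has binomial 0; for the others truncated subtraction is
    harmless.\<close>
  also have "(\<Sum>s\<le>Suc N. of_nat (N choose s) * f s (Suc N - s)) =
      (\<Sum>s\<le>N. of_nat (N choose s) * f s (Suc (N - s)))"
    by (simp add: binomial_eq_0 Suc_diff_le)
  finally show ?thesis .
qed

section \<open>Bidifferential operators of a constant bivector\<close>

locale commuting_derivations =
  fixes m :: nat and d :: "nat \<Rightarrow> 'a::comm_ring_1 \<Rightarrow> 'a" and \<pi> :: "nat \<Rightarrow> nat \<Rightarrow> 'a"
  assumes d_add: "d i (a + b) = d i a + d i b"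
    and d_mult: "d i (a * b) = d i a * b + a * d i b"
    and d_commute: "d i (d j a) = d j (d i a)"
    and d_\<pi> [simp]: "d l (\<pi> i j) = 0"
begin

text \<open>\<open>P s\<close> is multiplication after the s-th power of \<Pi> = \<Sum> \<pi>_ij d_i
  \<otimes> d_j. The recursion lets one factor of \<Pi> act on the arguments at a time, so that no
  tensor product has to be formed.\<close>

primrec P :: "nat \<Rightarrow> 'a \<Rightarrow> 'a \<Rightarrow> 'a" where
  "P 0 a b = a * b"
| "P (Suc s) a b = (\<Sum>i<m. \<Sum>j<m. \<pi> i j * P s (d i a) (d j b))"

lemma d_0 [simp]: "d i 0 = 0"
  using d_add [of i 0 0] by simp

lemma d_sum: "d i (sum f A) = (\<Sum>x\<in>A. d i (f x))"
  by (induction A rule: infinite_finite_induct) (auto simp: d_add)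

lemma P_add_left: "P s (a + a') b = P s a b + P s a' b"
  by (induction s arbitrary: a a' b) (simp_all add: d_add algebra_simps sum.distrib)

lemma P_add_right: "P s a (b + b') = P s a b + P s a b'"
  by (induction s arbitrary: a b b') (simp_all add: d_add algebra_simps sum.distrib)

lemma P_0 [simp]: "P s 0 b = 0" "P s a 0 = 0"
  by (induction s arbitrary: a b) simp_all

lemma P_sum_left: "P s (sum f A) b = (\<Sum>x\<in>A. P s (f x) b)"
  by (induction A rule: infinite_finite_induct) (auto simp: P_add_left)

lemma P_sum_right: "P s a (sum f A) = (\<Sum>x\<in>A. P s a (f x))"
  by (induction A rule: infinite_finite_induct) (auto simp: P_add_right)

lemma P_scale:
  assumes "\<And>l. d l x = 0"
  shows "P s (x * a) b = x * P s a b" "P s a (x * b) = x * P s a b"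
  by (induction s arbitrary: a b) (simp_all add: assms d_mult sum_distrib_left mult.left_commute mult.assoc)

lemma d_P: "d l (P s a b) = P s (d l a) b + P s a (d l b)"
proof (induction s arbitrary: a b)
  case (Suc s)
  show ?case
    by (simp add: d_sum d_mult Suc sum.distrib distrib_left d_commute [of l])
qed (simp add: d_mult)

text \<open>By the Leibniz rule \<open>d_P\<close>, an outer factor \<Pi> hits either the first or
  the second argument of the inner product. In terms of the three slots a, b, c it is \<Pi>_13 +
  \<Pi>_23, while an inner factor is \<Pi>_12.\<close>

lemma P_P_left: "P (Suc s) (P t a b) c =
    (\<Sum>i<m. \<Sum>j<m. \<pi> i j * P s (P t (d i a) b) (d j c)) + (\<Sum>i<m. \<Sum>j<m. \<pi> i j * P s (P t a (d i b)) (d j c))"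
  by (simp add: d_P P_add_left distrib_left sum.distrib)

lemma P_P_left': "P s (P (Suc t) a b) c = (\<Sum>i<m. \<Sum>j<m. \<pi> i j * P s (P t (d i a) (d j b)) c)"
  by (simp add: P_sum_left P_scale)

lemma P_P_right: "P (Suc s) a (P t b c) =
    (\<Sum>i<m. \<Sum>j<m. \<pi> i j * P s (d i a) (P t (d j b) c)) + (\<Sum>i<m. \<Sum>j<m. \<pi> i j * P s (d i a) (P t b (d j c)))"
  by (simp add: d_P P_add_right distrib_left sum.distrib)

lemma P_P_right': "P s a (P (Suc t) b c) = (\<Sum>i<m. \<Sum>j<m. \<pi> i j * P s a (P t (d i b) (d j c)))"
  by (simp add: P_sum_right P_scale)

text \<open>Both sides are \<open>(\<Pi>\<^sub>1\<^sub>2 + \<Pi>\<^sub>1\<^sub>3 + \<Pi>\<^sub>2\<^sub>3)\<^sup>N\<close> applied to \<open>a \<otimes> b \<otimes> c\<close>.\<close>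

lemma P_assoc:
  "(\<Sum>s\<le>N. of_nat (N choose s) * P s (P (N - s) a b) c) =
   (\<Sum>s\<le>N. of_nat (N choose s) * P s a (P (N - s) b c))"
proof (induction N arbitrary: a b c)
  case 0
  show ?case by (simp add: mult.assoc)
next
  case (Suc N)
  let ?W = "\<lambda>a b c. \<Sum>s\<le>N. of_nat (N choose s) * P s (P (N - s) a b) c"
  have pull: "(\<Sum>s\<le>N. of_nat (N choose s) * (\<Sum>i<m. \<Sum>j<m. \<pi> i j * F s i j)) =
      (\<Sum>i<m. \<Sum>j<m. \<pi> i j * (\<Sum>s\<le>N. of_nat (N choose s) * F s i j))" for F
  proof -
    have "(\<Sum>s\<le>N. \<Sum>i<m. \<Sum>j<m. \<pi> i j * (of_nat (N choose s) * F s i j)) =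
        (\<Sum>i<m. \<Sum>s\<le>N. \<Sum>j<m. \<pi> i j * (of_nat (N choose s) * F s i j))"
      by (rule sum.swap)
    also have "\<dots> = (\<Sum>i<m. \<Sum>j<m. \<Sum>s\<le>N. \<pi> i j * (of_nat (N choose s) * F s i j))"
      by (intro sum.cong refl sum.swap)
    finally show ?thesis
      by (simp add: sum_distrib_left mult.left_commute)
  qed
  have "(\<Sum>s\<le>Suc N. of_nat (Suc N choose s) * P s (P (Suc N - s) a b) c) =
     (\<Sum>i<m. \<Sum>j<m. \<pi> i j * ?W (d i a) b (d j c)) + (\<Sum>i<m. \<Sum>j<m. \<pi> i j * ?W a (d i b) (d j c)) +
     (\<Sum>i<m. \<Sum>j<m. \<pi> i j * ?W (d i a) (d j b) c)"
    unfolding sum_binomial_Suc [where f = "\<lambda>s t. P s (P t a b) c"] P_P_left P_P_left' distrib_left sum.distrib pull ..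
  moreover have "(\<Sum>s\<le>Suc N. of_nat (Suc N choose s) * P s a (P (Suc N - s) b c)) =
     (\<Sum>i<m. \<Sum>j<m. \<pi> i j * ?W (d i a) (d j b) c) + (\<Sum>i<m. \<Sum>j<m. \<pi> i j * ?W (d i a) b (d j c)) +
     (\<Sum>i<m. \<Sum>j<m. \<pi> i j * ?W a (d i b) (d j c))"
    unfolding sum_binomial_Suc [where f = "\<lambda>s t. P s a (P t b c)"] P_P_right P_P_right' distrib_left sum.distrib pull Suc ..
  ultimately show ?case by simp
qed

text \<open>\<open>L\<close> need not commute with the derivations. The matrix g records the defect,
  and \<open>inv\<close> says that the Lie derivative of \<Pi> along \<open>L\<close> vanishes,
  which makes the two sums of correction terms cancel.\<close>

lemma P_derivation:
  assumes add: "\<And>a b. L (a + b) = L a + L b"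
    and mult: "\<And>a b. L (a * b) = L a * b + a * L b"
    and L_\<pi>: "\<And>i j. L (\<pi> i j) = 0"
    and comm: "\<And>i a. i < m \<Longrightarrow> L (d i a) = d i (L a) + (\<Sum>p<m. g i p * d p a)"
    and g: "\<And>l i p. d l (g i p) = 0"
    and inv: "\<And>p q. p < m \<Longrightarrow> q < m \<Longrightarrow> (\<Sum>i<m. \<pi> i q * g i p) + (\<Sum>j<m. \<pi> p j * g j q) = 0"
  shows "L (P s a b) = P s (L a) b + P s a (L b)"
proof (induction s arbitrary: a b)
  case (Suc s)
  have "L 0 = 0" using add [of 0 0] by simp
  then have L_sum: "L (sum f A) = (\<Sum>x\<in>A. L (f x))" for f and A :: "nat set"
    by (induction A rule: infinite_finite_induct) (auto simp: add)
  let ?X = "\<lambda>p q. P s (d p a) (d q b)"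
  have "L (P (Suc s) a b) = (\<Sum>i<m. \<Sum>j<m. \<pi> i j * (P s (L (d i a)) (d j b) + P s (d i a) (L (d j b))))"
    by (simp add: L_sum mult L_\<pi> Suc)
  also have "\<dots> = (\<Sum>i<m. \<Sum>j<m. \<pi> i j * (P s (d i (L a)) (d j b) + P s (d i a) (d j (L b))) +
       ((\<Sum>p<m. \<pi> i j * g i p * ?X p j) + (\<Sum>p<m. \<pi> i j * g j p * ?X i p)))"
    by (intro sum.cong refl)
      (simp add: comm P_add_left P_add_right P_sum_left P_sum_right P_scale g,
       simp add: algebra_simps sum_distrib_left)
  also have "\<dots> = P (Suc s) (L a) b + P (Suc s) a (L b) +
      ((\<Sum>i<m. \<Sum>j<m. \<Sum>p<m. \<pi> i j * g i p * ?X p j) + (\<Sum>i<m. \<Sum>j<m. \<Sum>p<m. \<pi> i j * g j p * ?X i p))"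
    by (simp add: sum.distrib distrib_left)
  also have "(\<Sum>i<m. \<Sum>j<m. \<Sum>p<m. \<pi> i j * g i p * ?X p j) = (\<Sum>p<m. \<Sum>q<m. (\<Sum>i<m. \<pi> i q * g i p) * ?X p q)"
  proof -
    have "(\<Sum>i<m. \<Sum>j<m. \<Sum>p<m. \<pi> i j * g i p * ?X p j) = (\<Sum>i<m. \<Sum>p<m. \<Sum>j<m. \<pi> i j * g i p * ?X p j)"
      by (intro sum.cong refl sum.swap)
    also have "\<dots> = (\<Sum>p<m. \<Sum>i<m. \<Sum>j<m. \<pi> i j * g i p * ?X p j)"
      by (rule sum.swap)
    also have "\<dots> = (\<Sum>p<m. \<Sum>j<m. \<Sum>i<m. \<pi> i j * g i p * ?X p j)"
      by (intro sum.cong refl sum.swap)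
    finally show ?thesis by (simp add: sum_distrib_right)
  qed
  also have "(\<Sum>i<m. \<Sum>j<m. \<Sum>p<m. \<pi> i j * g j p * ?X i p) = (\<Sum>p<m. \<Sum>q<m. (\<Sum>j<m. \<pi> p j * g j q) * ?X p q)"
    unfolding sum_distrib_right by (intro sum.cong refl sum.swap)
  also have "(\<Sum>p<m. \<Sum>q<m. (\<Sum>i<m. \<pi> i q * g i p) * ?X p q) + (\<Sum>p<m. \<Sum>q<m. (\<Sum>j<m. \<pi> p j * g j q) * ?X p q) = 0"
  proof -
    have "(\<Sum>p<m. \<Sum>q<m. ((\<Sum>i<m. \<pi> i q * g i p) + (\<Sum>j<m. \<pi> p j * g j q)) * ?X p q) = 0"
      by (intro sum.neutral ballI) (subst inv, auto)
    then show ?thesis by (simp only: sum.distrib distrib_right)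
  qed
  finally show ?case by simp
qed (simp add: mult)

text \<open>The global counterpart of \<open>P_derivation\<close>: \<open>dh\<close> is the chain
  rule for a pullback h with Jacobian A, and \<open>inv\<close> says that A carries \<Pi> to itself.
  The exchanges of sums only bring those over i and j inside.\<close>

lemma P_hom:
  assumes add: "\<And>a b. h (a + b) = h a + h b"
    and mult: "\<And>a b. h (a * b) = h a * h b"
    and h_\<pi>: "\<And>i j. h (\<pi> i j) = \<pi> i j"
    and dh: "\<And>i a. i < m \<Longrightarrow> d i (h a) = (\<Sum>p<m. A p i * h (d p a))"
    and A: "\<And>l p i. d l (A p i) = 0"
    and inv: "\<And>p q. p < m \<Longrightarrow> q < m \<Longrightarrow> (\<Sum>i<m. \<Sum>j<m. \<pi> i j * A p i * A q j) = \<pi> p q"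
  shows "h (P s a b) = P s (h a) (h b)"
proof (induction s arbitrary: a b)
  case (Suc s)
  have "h 0 = 0" using add [of 0 0] by simp
  then have h_sum: "h (sum f A) = (\<Sum>x\<in>A. h (f x))" for f and A :: "nat set"
    by (induction A rule: infinite_finite_induct) (auto simp: add)
  let ?X = "\<lambda>p q. P s (h (d p a)) (h (d q b))"
  have "P (Suc s) (h a) (h b) = (\<Sum>i<m. \<Sum>j<m. \<Sum>q<m. \<Sum>p<m. \<pi> i j * A p i * A q j * ?X p q)"
    by (simp add: dh P_sum_left P_sum_right P_scale A sum_distrib_left ac_simps)
  also have "\<dots> = (\<Sum>i<m. \<Sum>j<m. \<Sum>p<m. \<Sum>q<m. \<pi> i j * A p i * A q j * ?X p q)"
    by (intro sum.cong refl sum.swap)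
  also have "\<dots> = (\<Sum>i<m. \<Sum>p<m. \<Sum>j<m. \<Sum>q<m. \<pi> i j * A p i * A q j * ?X p q)"
    by (intro sum.cong refl sum.swap)
  also have "\<dots> = (\<Sum>p<m. \<Sum>i<m. \<Sum>j<m. \<Sum>q<m. \<pi> i j * A p i * A q j * ?X p q)"
    by (rule sum.swap)
  also have "\<dots> = (\<Sum>p<m. \<Sum>i<m. \<Sum>q<m. \<Sum>j<m. \<pi> i j * A p i * A q j * ?X p q)"
    by (intro sum.cong refl sum.swap)
  also have "\<dots> = (\<Sum>p<m. \<Sum>q<m. \<Sum>i<m. \<Sum>j<m. \<pi> i j * A p i * A q j * ?X p q)"
    by (intro sum.cong refl sum.swap)
  also have "\<dots> = (\<Sum>p<m. \<Sum>q<m. \<pi> p q * ?X p q)"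
    by (intro sum.cong refl) (simp add: inv sum_distrib_right [symmetric])
  also have "\<dots> = h (P (Suc s) a b)"
    by (simp add: h_sum mult h_\<pi> Suc)
  finally show ?case ..
qed (simp add: mult)

end

section \<open>Formal series in \<lambda> and the Moyal product\<close>

lemma sum_triangle_nested:
  fixes f :: "nat \<Rightarrow> nat \<Rightarrow> 'a::comm_monoid_add"
  shows "(\<Sum>i\<le>k. \<Sum>t\<le>i. f t (i - t)) = (\<Sum>t\<le>k. \<Sum>j\<le>k - t. f t j)"
proof -
  have "{(i, j). i + j \<le> k} = (SIGMA t:{..k}. {..k - t})" by auto
  then show ?thesis
    by (subst sum.triangle_reindex_eq [symmetric]) (simp add: sum.Sigma)
qed

text \<open>The formal series \<open>\<Sum>\<^sub>t \<lambda>\<^sup>t x\<^sub>t\<close>, where \<open>x\<^sub>t\<close> may depend on \<open>\<lambda>\<close>.\<close>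

definition fps_series :: "(nat \<Rightarrow> 'a::comm_ring_1 fps) \<Rightarrow> 'a fps" where
  "fps_series x = Abs_fps (\<lambda>k. \<Sum>t\<le>k. fps_nth (x t) (k - t))"

lemma fps_series_nth: "fps_nth (fps_series x) k = (\<Sum>t\<le>k. fps_nth (x t) (k - t))"
  by (simp add: fps_series_def)

lemma fps_series_add: "fps_series (\<lambda>t. x t + y t) = fps_series x + fps_series y"
  by (simp add: fps_eq_iff fps_series_nth sum.distrib)

lemma fps_series_sum: "fps_series (\<lambda>t. \<Sum>a\<in>A. x a t) = (\<Sum>a\<in>A. fps_series (x a))"
  by (induction A rule: infinite_finite_induct)
     (simp_all add: fps_series_add, simp_all add: fps_eq_iff fps_series_nth)

lemma fps_series_mult_right: "fps_series x * c = fps_series (\<lambda>t. x t * c)"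
proof (rule fps_ext)
  fix k
  have "fps_nth (fps_series x * c) k =
      (\<Sum>i\<le>k. \<Sum>t\<le>i. fps_nth (x t) (i - t) * fps_nth c (k - (t + (i - t))))"
    by (simp add: fps_mult_nth fps_series_nth sum_distrib_right atLeast0AtMost)
  also have "\<dots> = (\<Sum>t\<le>k. \<Sum>i\<le>k - t. fps_nth (x t) i * fps_nth c (k - (t + i)))"
    by (rule sum_triangle_nested)
  finally show "fps_nth (fps_series x * c) k = fps_nth (fps_series (\<lambda>t. x t * c)) k"
    by (simp add: fps_mult_nth fps_series_nth atLeast0AtMost)
qed

lemma fps_series_mult_left: "c * fps_series x = fps_series (\<lambda>t. c * x t)"
  using fps_series_mult_right [of x c] by (simp add: mult.commute)

lemma fps_series_fps_series: "fps_series (\<lambda>s. fps_series (y s)) = fps_series (\<lambda>N. \<Sum>s\<le>N. y s (N - s))"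
proof (rule fps_ext)
  fix k
  have "fps_nth (fps_series (\<lambda>N. \<Sum>s\<le>N. y s (N - s))) k =
      (\<Sum>N\<le>k. \<Sum>s\<le>N. fps_nth (y s (N - s)) (k - (s + (N - s))))"
    by (simp add: fps_series_nth fps_sum_nth)
  also have "\<dots> = (\<Sum>s\<le>k. \<Sum>t\<le>k - s. fps_nth (y s t) (k - (s + t)))"
    by (rule sum_triangle_nested)
  finally show "fps_nth (fps_series (\<lambda>s. fps_series (y s))) k =
      fps_nth (fps_series (\<lambda>N. \<Sum>s\<le>N. y s (N - s))) k"
    by (simp add: fps_series_nth)
qed

text \<open>\<open>d_series\<close> is continuity in the \<lambda>-adic sense. \<open>c_mult\<close>
  is the rule of divided powers, as for x^s / s!. It turns the product of two nested Moyal sums into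
  the binomial sums of \<open>P_assoc\<close>, without division by factorials in the ring.\<close>

locale formal_moyal = commuting_derivations m d \<pi>
  for m and d :: "nat \<Rightarrow> 'a::comm_ring_1 fps \<Rightarrow> 'a fps" and \<pi> +
  fixes c :: "nat \<Rightarrow> 'a fps"
  assumes d_series: "d i (fps_series x) = fps_series (\<lambda>t. d i (x t))"
    and d_c: "d i (c s) = 0"
    and d_X: "d i fps_X = 0"
    and c_mult: "c s * c t = of_nat ((s + t) choose s) * c (s + t)"
    and c_0: "c 0 = 1"
begin

definition star :: "'a fps \<Rightarrow> 'a fps \<Rightarrow> 'a fps" where
  "star a b = fps_series (\<lambda>s. c s * P s a b)"

lemma P_series_left: "P s (fps_series x) b = fps_series (\<lambda>t. P s (x t) b)"
  by (induction s arbitrary: x b)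
     (simp_all add: fps_series_mult_right d_series fps_series_mult_left fps_series_sum)

lemma P_series_right: "P s a (fps_series x) = fps_series (\<lambda>t. P s a (x t))"
  by (induction s arbitrary: x a) (simp_all add: d_series fps_series_mult_left fps_series_sum)

lemma star_add_left: "star (a + a') b = star a b + star a' b"
  by (simp add: star_def P_add_left distrib_left fps_series_add)

lemma star_add_right: "star a (b + b') = star a b + star a b'"
  by (simp add: star_def P_add_right distrib_left fps_series_add)

lemma star_assoc: "star (star a b) e = star a (star b e)"
proof -
  have 1: "star (star a b) e = fps_series (\<lambda>N. \<Sum>s\<le>N. c s * c (N - s) * P s (P (N - s) a b) e)"
    unfolding star_def P_series_left fps_series_mult_left fps_series_fps_series
    by (simp add: P_scale d_c mult.assoc)
  have 2: "star a (star b e) = fps_series (\<lambda>N. \<Sum>s\<le>N. c s * c (N - s) * P s a (P (N - s) b e))"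
    unfolding star_def P_series_right fps_series_mult_left fps_series_fps_series
    by (simp add: P_scale d_c mult.assoc)
  have 3: "(\<Sum>s\<le>N. c s * c (N - s) * F s) = c N * (\<Sum>s\<le>N. of_nat (N choose s) * F s)" for N F
    by (simp add: c_mult sum_distrib_left ac_simps)
  show ?thesis
    unfolding 1 2 3 P_assoc ..
qed

lemma star_scale:
  assumes "\<And>l. d l x = 0"
  shows "star (x * a) b = x * star a b" "star a (x * b) = x * star a b"
  by (simp_all add: star_def P_scale assms fps_series_mult_left mult.left_commute)

lemma star_X: "star (fps_X * a) b = fps_X * star a b" "star a (fps_X * b) = fps_X * star a b"
  by (simp_all add: star_scale d_X)

lemma d_star: "d l (star a b) = star (d l a) b + star a (d l b)"
  by (simp add: star_def d_series d_mult d_c d_P distrib_left fps_series_add)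

lemma star_diff_left: "star (a - a') b = star a b - star a' b"
  using star_add_left [of "a - a'" a' b] by (simp add: algebra_simps)

lemma star_diff_right: "star a (b - b') = star a b - star a b'"
  using star_add_right [of a "b - b'" b'] by (simp add: algebra_simps)

lemma star_0 [simp]: "star 0 b = 0" "star a 0 = 0"
  using star_diff_left [of a a b] star_diff_right [of a b b] star_diff_left [of b b b] by simp_all

lemma star_derivation:
  assumes "\<And>a b. L (a + b) = L a + L b"
    and "\<And>a b. L (a * b) = L a * b + a * L b"
    and "\<And>x. L (fps_series x) = fps_series (\<lambda>t. L (x t))"
    and "\<And>i j. L (\<pi> i j) = 0" and "\<And>s. L (c s) = 0"
    and "\<And>i a. i < m \<Longrightarrow> L (d i a) = d i (L a) + (\<Sum>p<m. g i p * d p a)"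
    and "\<And>l i p. d l (g i p) = 0"
    and "\<And>p q. p < m \<Longrightarrow> q < m \<Longrightarrow> (\<Sum>i<m. \<pi> i q * g i p) + (\<Sum>j<m. \<pi> p j * g j q) = 0"
  shows "L (star a b) = star (L a) b + star a (L b)"
  unfolding star_def
  by (simp add: assms(2,3,5) P_derivation [of L g, OF assms(1,2,4,6,7,8)] distrib_left fps_series_add)

lemma star_hom:
  assumes "\<And>a b. h (a + b) = h a + h b"
    and "\<And>a b. h (a * b) = h a * h b"
    and "\<And>x. h (fps_series x) = fps_series (\<lambda>t. h (x t))"
    and "\<And>i j. h (\<pi> i j) = \<pi> i j" and "\<And>s. h (c s) = c s"
    and "\<And>i a. i < m \<Longrightarrow> d i (h a) = (\<Sum>p<m. A p i * h (d p a))"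
    and "\<And>l p i. d l (A p i) = 0"
    and "\<And>p q. p < m \<Longrightarrow> q < m \<Longrightarrow> (\<Sum>i<m. \<Sum>j<m. \<pi> i j * A p i * A q j) = \<pi> p q"
  shows "h (star a b) = star (h a) (h b)"
  unfolding star_def
  by (simp add: assms(2,3,5) P_hom [of h A, OF assms(1,2,4,6,7,8)])

lemma star_nth_0: "fps_nth (star a b) 0 = fps_nth a 0 * fps_nth b 0"
  by (simp add: star_def fps_series_nth c_0)

lemma d_1: "d i 1 = 0"
  using d_c [of i 0] by (simp add: c_0)

lemma P_Suc_1: "P (Suc s) 1 b = 0" "P (Suc s) a 1 = 0"
  by (simp_all add: d_1)

lemma star_1: "star 1 b = b" "star a 1 = a"
proof -
  have "fps_series (\<lambda>s. c s * P s 1 b) = fps_series (\<lambda>s. if s = 0 then b else 0)"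
    by (rule arg_cong [of _ _ fps_series]) (auto simp: c_0 P_Suc_1 fun_eq_iff gr0_conv_Suc simp del: P.simps(2))
  also have "\<dots> = b"
    by (simp add: fps_eq_iff fps_series_nth if_distrib [of "\<lambda>x. fps_nth x _"] sum.delta' cong: if_cong)
  finally show "star 1 b = b" by (simp add: star_def)
  have "fps_series (\<lambda>s. c s * P s a 1) = fps_series (\<lambda>s. if s = 0 then a else 0)"
    by (rule arg_cong [of _ _ fps_series]) (auto simp: c_0 P_Suc_1 fun_eq_iff gr0_conv_Suc simp del: P.simps(2))
  also have "\<dots> = a"
    by (simp add: fps_eq_iff fps_series_nth if_distrib [of "\<lambda>x. fps_nth x _"] sum.delta' cong: if_cong)
  finally show "star a 1 = a" by (simp add: star_def)
qed

text \<open>The commutator divided by \<lambda>. The shift discards only the coefficient of order 0,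
  which is 0 because the ring is commutative (\<open>X_ad\<close>). The factor i of the Fedosov
  connection is added separately.\<close>

definition ad :: "'a fps \<Rightarrow> 'a fps \<Rightarrow> 'a fps" where
  "ad r a = fps_shift 1 (star r a - star a r)"

lemma X_ad: "fps_X * ad r a = star r a - star a r"
proof -
  have "fps_nth (star r a - star a r) 0 = 0" by (simp add: star_nth_0)
  then show ?thesis
    by (intro fps_ext) (auto simp: ad_def fps_X_mult_nth)
qed

text \<open>Multiplied by \<open>fps_X\<close> this is the Leibniz rule for a commutator in an
  associative algebra. Multiplication by \<open>fps_X\<close> only shifts coefficients, so it can be
  cancelled over any coefficient ring.\<close>

lemma ad_derivation: "ad r (star a b) = star (ad r a) b + star a (ad r b)"
proof -
  have "fps_X * (star (ad r a) b + star a (ad r b)) =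
     star (star r a - star a r) b + star a (star r b - star b r)"
    unfolding distrib_left
    by (subst star_X(1) [symmetric], subst star_X(2) [symmetric]) (simp only: X_ad)
  also have "\<dots> = fps_X * ad r (star a b)"
    by (simp add: X_ad star_diff_left star_diff_right star_assoc)
  finally have "fps_X * ad r (star a b) = fps_X * (star (ad r a) b + star a (ad r b))" ..
  then have "fps_nth (fps_X * ad r (star a b)) (Suc k) =
      fps_nth (fps_X * (star (ad r a) b + star a (ad r b))) (Suc k)" for k
    by simp
  then show ?thesis
    by (intro fps_ext) simp
qed

lemma ad_add: "ad r (a + b) = ad r a + ad r b"
  by (rule fps_ext) (simp add: ad_def star_add_left star_add_right)

lemma ad_X: "ad r (fps_X * a) = fps_X * ad r a"
proof -
  have "fps_X * ad r (fps_X * a) = fps_X * (fps_X * ad r a)"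
    by (simp add: X_ad star_X right_diff_distrib)
  then have "fps_nth (fps_X * ad r (fps_X * a)) (Suc k) = fps_nth (fps_X * (fps_X * ad r a)) (Suc k)" for k
    by simp
  then show ?thesis by (intro fps_ext) simp
qed

lemma ad_1: "ad r 1 = 0"
  by (simp add: ad_def star_1)

end

section \<open>The Weyl algebra as an algebra of formal power series\<close>

definition fps_map :: "('a::comm_ring_1 \<Rightarrow> 'b::comm_ring_1) \<Rightarrow> 'a fps \<Rightarrow> 'b fps" where
  "fps_map h F = Abs_fps (\<lambda>k. h (fps_nth F k))"

lemma fps_map_nth [simp]: "fps_nth (fps_map h F) k = h (fps_nth F k)"
  by (simp add: fps_map_def)

lemma additive_sum:
  fixes h :: "'a::ab_group_add \<Rightarrow> 'b::ab_group_add"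
  assumes "\<And>x y. h (x + y) = h x + h y"
  shows "h 0 = 0" "h (sum f A) = (\<Sum>a\<in>A. h (f a))"
proof -
  show 0: "h 0 = 0" using assms [of 0 0] by simp
  show "h (sum f A) = (\<Sum>a\<in>A. h (f a))"
    by (induction A rule: infinite_finite_induct) (auto simp: 0 assms)
qed

lemma fps_map_add:
  assumes "\<And>x y. h (x + y) = h x + h y"
  shows "fps_map h (F + G) = fps_map h F + fps_map h G"
  by (rule fps_ext) (simp add: assms)

lemma fps_map_series:
  assumes "\<And>x y. h (x + y) = h x + h y"
  shows "fps_map h (fps_series x) = fps_series (\<lambda>t. fps_map h (x t))"
  by (rule fps_ext) (simp add: fps_series_nth additive_sum [of h, OF assms])

lemma fps_map_mult:
  assumes "\<And>x y. h (x + y) = h x + h y" "\<And>x y. h (x * y) = h x * h y"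
  shows "fps_map h (F * G) = fps_map h F * fps_map h G"
  by (rule fps_ext) (simp add: fps_mult_nth additive_sum(2) [of h, OF assms(1)] assms(2))

lemma fps_map_const:
  assumes "h 0 = 0"
  shows "fps_map h (fps_const x) = fps_const (h x)"
  by (rule fps_ext) (simp add: assms)

section \<open>Coefficient families as power series in y and \<lambda>\<close>

type_synonym wfps = "(nat, complex) mps fps"

definition body :: "nat set \<Rightarrow> welem \<Rightarrow> wfps" where
  "body J a = Abs_fps (\<lambda>k. Mps (\<lambda>\<alpha>. a k \<alpha> J))"

definition wconst :: "complex \<Rightarrow> wfps" where
  "wconst c = fps_const (mps_const c)"

definition wvar :: "nat \<Rightarrow> wfps" where
  "wvar i = fps_const (mps_var i)"

abbreviation wderiv :: "nat \<Rightarrow> wfps \<Rightarrow> wfps" where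
  "wderiv i \<equiv> fps_map (mps_deriv i)"

definition wcoeff :: "wfps \<Rightarrow> nat \<Rightarrow> nat multiset \<Rightarrow> complex" where
  "wcoeff F k \<alpha> = mps_coeff (fps_nth F k) \<alpha>"

lemma wcoeff_body [simp]: "wcoeff (body J a) k \<alpha> = a k \<alpha> J"
  by (simp add: wcoeff_def body_def)

lemma wfps_eqI: "(\<And>k \<alpha>. wcoeff F k \<alpha> = wcoeff G k \<alpha>) \<Longrightarrow> F = G"
  by (auto simp: wcoeff_def intro: fps_ext mps_eqI)

lemma body_eq_iff: "body J a = body K b \<longleftrightarrow> (\<forall>k \<alpha>. a k \<alpha> J = b k \<alpha> K)"
  by (metis wcoeff_body wfps_eqI)

lemma wcoeff_simps [simp]:
  "wcoeff (F + G) k \<alpha> = wcoeff F k \<alpha> + wcoeff G k \<alpha>"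
  "wcoeff (F - G) k \<alpha> = wcoeff F k \<alpha> - wcoeff G k \<alpha>"
  "wcoeff (- F) k \<alpha> = - wcoeff F k \<alpha>"
  "wcoeff 0 k \<alpha> = 0"
  "wcoeff (wconst c * F) k \<alpha> = c * wcoeff F k \<alpha>"
  "wcoeff (wderiv i F) k \<alpha> = of_nat (count \<alpha> i + 1) * wcoeff F k (add_mset i \<alpha>)"
  "wcoeff (fps_shift (Suc 0) F) k \<alpha> = wcoeff F (Suc k) \<alpha>"
  by (simp_all add: wcoeff_def wconst_def mps_coeff_deriv)

lemma wcoeff_sum: "wcoeff (sum F A) k \<alpha> = (\<Sum>a\<in>A. wcoeff (F a) k \<alpha>)"
  by (simp add: wcoeff_def fps_sum_nth mps_coeff_sum)

lemma wcoeff_mult: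
  "wcoeff (F * G) k \<alpha> = (\<Sum>p\<le>k. \<Sum>\<beta> | \<beta> \<subseteq># \<alpha>. wcoeff F p \<beta> * wcoeff G (k - p) (\<alpha> - \<beta>))"
  by (simp add: wcoeff_def fps_mult_nth mps_coeff_sum mps_coeff_mult atLeast0AtMost)

lemma wcoeff_series: "wcoeff (fps_series x) k \<alpha> = (\<Sum>t\<le>k. wcoeff (x t) (k - t) \<alpha>)"
  by (simp add: wcoeff_def fps_series_nth mps_coeff_sum)

lemma wcoeff_wvar_mult:
  "wcoeff (wvar i * F) k \<alpha> = (if i \<in># \<alpha> then wcoeff F k (\<alpha> - {#i#}) else 0)"
  by (simp add: wcoeff_def wvar_def mps_coeff_var_mult)

lemma wcoeff_1: "wcoeff 1 k \<alpha> = (if k = 0 \<and> \<alpha> = {#} then 1 else 0)"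
  by (simp add: wcoeff_def mps_coeff_1)

lemma wderiv_wconst [simp]: "wderiv i (wconst c) = 0"
  by (rule fps_ext) (simp add: wconst_def, metis mps_const_0 mps_deriv_const)

lemma wderiv_wvar: "wderiv i (wvar j) = (if i = j then 1 else 0)"
  by (rule fps_ext) (simp add: wvar_def mps_deriv_var, metis mps_const_0 mps_deriv_const)

lemma wderiv_add: "wderiv i (F + G) = wderiv i F + wderiv i G"
  by (simp add: fps_map_add mps_deriv_add)

lemma mps_deriv_sum: "mps_deriv i (sum f A) = (\<Sum>a\<in>A. mps_deriv i (f a))"
  by (rule additive_sum(2)) (rule mps_deriv_add)

lemma wderiv_mult: "wderiv i (F * G) = wderiv i F * G + F * wderiv i G"
  by (rule fps_ext) (simp add: fps_mult_nth mps_deriv_sum mps_deriv_mult sum.distrib)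

definition moyal_coeff :: "nat \<Rightarrow> wfps" where
  "moyal_coeff s = wconst ((- \<i>) ^ s / fact s)"

definition wbivec :: "nat \<Rightarrow> nat \<Rightarrow> nat \<Rightarrow> wfps" where
  "wbivec n i j = wconst (of_real (bivec n i j))"

text \<open>The coefficients of the bivector and the factors (-i)^s / s! are complex numbers, hence
  killed by all fibre derivatives. The dimension n stays a parameter, because different charts may
  have different dimensions.\<close>

interpretation weyl: formal_moyal "2 * n" wderiv "wbivec n" moyal_coeff for n
proof
  fix i j l s t :: nat and a b :: wfps and x :: "nat \<Rightarrow> wfps"
  show "wderiv i (wderiv j a) = wderiv j (wderiv i a)"
    by (rule fps_ext) (simp add: mps_deriv_commute)
  show "wderiv i (fps_series x) = fps_series (\<lambda>t. wderiv i (x t))"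
    by (rule fps_map_series) (rule mps_deriv_add)
  show "wderiv i fps_X = 0"
    by (rule fps_ext) (simp add: fps_X_def, metis mps_const_0 mps_const_1 mps_deriv_const)
  have "(- \<i>) ^ s / fact s * ((- \<i>) ^ t / fact t) =
      of_nat ((s + t) choose s) * ((- \<i>) ^ (s + t) / fact (s + t))"
    by (simp add: binomial_fact power_add)
  then show "moyal_coeff s * moyal_coeff t = of_nat ((s + t) choose s) * moyal_coeff (s + t)"
    by (simp add: moyal_coeff_def wconst_def mps_const_mult [symmetric] mps_const_of_nat [symmetric]
        fps_of_nat [symmetric])
qed (auto simp: wderiv_add wderiv_mult wbivec_def moyal_coeff_def wconst_def [of 1])

lemma body_simps [simp]:
  "body J (a + b) = body J a + body J b"
  "body J (a - b) = body J a - body J b"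
  "body J (wscale c a) = wconst c * body J a"
  "body J (ydiff i a) = wderiv i (body J a)"
  "body J (ymul i a) = wvar i * body J a"
  "body J 0 = 0"
  "body {} wone = 1"
  "body J (i_over_lambda a) = wconst \<i> * fps_shift 1 (body J a)"
  by (rule wfps_eqI; auto simp: wscale_def ydiff_def ymul_def wone_def i_over_lambda_def
      wcoeff_wvar_mult wcoeff_1)+

lemma body_sum: "body J (sum f A) = (\<Sum>a\<in>A. body J (f a))"
  by (rule additive_sum(2) [of "body J"]) simp

section \<open>Forms of degree 0 and 1, and products with a factor of degree 0\<close>

definition zero_form :: "welem \<Rightarrow> bool" where
  "zero_form a \<longleftrightarrow> (\<forall>k \<alpha> J. J \<noteq> {} \<longrightarrow> a k \<alpha> J = 0)"

definition one_form :: "nat \<Rightarrow> welem \<Rightarrow> bool" where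
  "one_form n a \<longleftrightarrow> (\<forall>k \<alpha> J. (\<forall>j<2*n. J \<noteq> {j}) \<longrightarrow> a k \<alpha> J = 0)"

lemma zero_formD: "zero_form a \<Longrightarrow> J \<noteq> {} \<Longrightarrow> a k \<alpha> J = 0"
  by (simp add: zero_form_def)

lemma zero_form_eqI: "zero_form a \<Longrightarrow> zero_form b \<Longrightarrow> body {} a = body {} b \<Longrightarrow> a = b"
  by (auto simp: zero_form_def fun_eq_iff body_eq_iff) metis

lemma zero_form_ydiff: "zero_form a \<Longrightarrow> zero_form (ydiff i a)"
  by (simp add: zero_form_def ydiff_def)

lemma one_form_ydiff: "one_form n a \<Longrightarrow> one_form n (ydiff i a)"
  by (simp add: one_form_def ydiff_def)

text \<open>Only K = J survives, and its sign counts pairs with an index in the empty set J - K, so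
  it is 1. For infinite J the sum over \<open>Pow J\<close> would be 0 by convention.\<close>

lemma body_wmult_right:
  assumes "zero_form b" "finite J"
  shows "body J (wmult a b) = body J a * body {} b"
proof (rule wfps_eqI)
  fix k \<alpha>
  have "(\<Sum>K\<in>Pow J. (-1) ^ card {(i, j). i \<in> K \<and> j \<in> J - K \<and> j < i} * a p \<beta> K * b q \<gamma> (J - K)) =
     (\<Sum>K\<in>{J}. (-1) ^ card {(i, j). i \<in> K \<and> j \<in> J - K \<and> j < i} * a p \<beta> K * b q \<gamma> (J - K))" for p \<beta> q \<gamma>
    by (rule sum.mono_neutral_right) (use assms zero_formD [of b "J - _"] in auto)
  then show "wcoeff (body J (wmult a b)) k \<alpha> = wcoeff (body J a * body {} b) k \<alpha>"
    by (simp add: wcoeff_mult wmult_def)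
qed

lemma body_wmult_left:
  assumes "zero_form a" "finite J"
  shows "body J (wmult a b) = body {} a * body J b"
proof (rule wfps_eqI)
  fix k \<alpha>
  have "(\<Sum>K\<in>Pow J. (-1) ^ card {(i, j). i \<in> K \<and> j \<in> J - K \<and> j < i} * a p \<beta> K * b q \<gamma> (J - K)) =
     (\<Sum>K\<in>{{}}. (-1) ^ card {(i, j). i \<in> K \<and> j \<in> J - K \<and> j < i} * a p \<beta> K * b q \<gamma> (J - K))" for p \<beta> q \<gamma>
    by (rule sum.mono_neutral_right) (use assms in \<open>auto simp: zero_form_def\<close>)
  then show "wcoeff (body J (wmult a b)) k \<alpha> = wcoeff (body {} a * body J b) k \<alpha>"
    by (simp add: wcoeff_mult wmult_def)
qed

lemma body_moyal_term_right:
  assumes "zero_form b" "finite J"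
  shows "body J (moyal_term n s a b) = weyl.P n s (body J a) (body {} b)"
  using assms
  by (induction s arbitrary: a b)
     (simp_all add: body_wmult_right body_sum zero_form_ydiff wbivec_def)

lemma body_moyal_term_left:
  assumes "zero_form a" "finite J"
  shows "body J (moyal_term n s a b) = weyl.P n s (body {} a) (body J b)"
  using assms
  by (induction s arbitrary: a b)
     (simp_all add: body_wmult_left body_sum zero_form_ydiff wbivec_def)

lemma body_moyal: "body J (moyal n a b) = fps_series (\<lambda>s. moyal_coeff s * body J (moyal_term n s a b))"
  by (rule wfps_eqI) (simp add: wcoeff_series moyal_def moyal_coeff_def)

lemma body_moyal_right:
  "zero_form b \<Longrightarrow> finite J \<Longrightarrow> body J (moyal n a b) = weyl.star n (body J a) (body {} b)"
  by (simp add: body_moyal body_moyal_term_right weyl.star_def)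

lemma body_moyal_left:
  "zero_form a \<Longrightarrow> finite J \<Longrightarrow> body J (moyal n a b) = weyl.star n (body {} a) (body J b)"
  by (simp add: body_moyal body_moyal_term_left weyl.star_def)

lemma wmult_eq_0:
  assumes "\<And>K k p \<beta> \<gamma>. K \<subseteq> J \<Longrightarrow> a k \<beta> K * b p \<gamma> (J - K) = 0"
  shows "wmult a b k \<alpha> J = 0"
  unfolding wmult_def using assms by (intro sum.neutral ballI) (auto simp: mult.assoc)

lemma moyal_eq_0:
  assumes "\<And>s k \<alpha>. moyal_term n s a b k \<alpha> J = 0"
  shows "moyal n a b k \<alpha> J = 0"
  unfolding moyal_def using assms by (intro sum.neutral ballI) simp

lemma zero_form_moyal:
  assumes "zero_form a" "zero_form b"
  shows "zero_form (moyal n a b)"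
proof -
  have "moyal_term n s a b k \<alpha> J = 0" if "J \<noteq> {}" for s k \<alpha> J
    using assms
  proof (induction s arbitrary: a b k \<alpha>)
    case 0
    have "a k \<beta> K * b p \<gamma> (J - K) = 0" for K k p \<beta> \<gamma>
      using that zero_formD [OF 0(1), of K] zero_formD [OF 0(2), of "J - K"] by (cases "K = {}") auto
    then show ?case by (simp add: wmult_eq_0)
  qed (simp add: sum_fun_apply wscale_def zero_form_ydiff)
  then show ?thesis by (simp add: zero_form_def moyal_eq_0)
qed

text \<open>In a nonzero summand of \<open>wmult\<close> all indices of J belong to the factor of
  degree 1. Both orders are proved together, as the commutator contains both.\<close>

lemma one_form_moyal:
  assumes "one_form n a" "zero_form b"
  shows "one_form n (moyal n a b)" "one_form n (moyal n b a)"
proof -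
  have "moyal_term n s a b k \<alpha> J = 0 \<and> moyal_term n s b a k \<alpha> J = 0" if "\<forall>j<2*n. J \<noteq> {j}" for s k \<alpha> J
    using assms
  proof (induction s arbitrary: a b k \<alpha>)
    case 0
    have "a k \<beta> K * b p \<gamma> (J - K) = 0" if K: "K \<subseteq> J" for K k p \<beta> \<gamma>
    proof (cases "J - K = {}")
      case True
      then have "J = K" using K by auto
      then show ?thesis using 0(1) that \<open>\<forall>j<2*n. J \<noteq> {j}\<close> by (auto simp: one_form_def)
    qed (use 0 in \<open>simp add: zero_form_def\<close>)
    moreover have "b k \<beta> K * a p \<gamma> (J - K) = 0" if K: "K \<subseteq> J" for K k p \<beta> \<gamma>
    proof (cases "K = {}")
      case True
      then show ?thesis using 0(1) \<open>\<forall>j<2*n. J \<noteq> {j}\<close> by (auto simp: one_form_def)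
    qed (use 0 in \<open>simp add: zero_form_def\<close>)
    ultimately show ?case by (auto intro!: wmult_eq_0)
  qed (simp add: sum_fun_apply wscale_def zero_form_ydiff one_form_ydiff)
  then show "one_form n (moyal n a b)" "one_form n (moyal n b a)"
    by (simp_all add: one_form_def moyal_eq_0)
qed

lemma moyal_0 [simp]: "moyal n 0 b = 0" "moyal n a 0 = 0"
proof -
  have y: "ydiff i 0 = 0" for i by (simp add: ydiff_def fun_eq_iff)
  have "moyal_term n s 0 b = 0" "moyal_term n s a 0 = 0" for s
    by (induction s arbitrary: a b) (auto simp: y wmult_def wscale_def fun_eq_iff sum_fun_apply)
  then show "moyal n 0 b = 0" "moyal n a 0 = 0"
    by (simp_all add: moyal_def fun_eq_iff)
qed

lemma gcomm_one_zero:
  assumes r: "one_form n r" and a: "zero_form a"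
  shows "gcomm n r a = moyal n r a - moyal n a r"
proof -
  have "a k \<alpha> J = 0" if "card J \<noteq> 0" for k \<alpha> J
    using that zero_formD [OF a] by (cases "J = {}") auto
  then have fa: "form_part q a = (if q = 0 then a else 0)" for q
    by (auto simp: form_part_def fun_eq_iff)
  have "r k \<alpha> J = 0" if "card J \<noteq> 1" for k \<alpha> J
  proof -
    have "\<forall>j<2*n. J \<noteq> {j}" using that by auto
    then show ?thesis using r by (simp add: one_form_def)
  qed
  then have fr: "form_part p r = (if p = 1 then r else 0)" for p
    by (auto simp: form_part_def fun_eq_iff)
  show ?thesis
  \<comment> \<open>For n = 0 the sum over p in \<open>gcomm\<close> does not reach 1, but then
    there are no nonzero one-forms either. Otherwise only p = 1, q = 0 contributes, with sign
    1.\<close>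
  proof (cases "n = 0")
    case True
    then have r0: "r = 0" using r by (simp add: one_form_def fun_eq_iff)
    have "form_part p (0 :: welem) = 0" "wscale c 0 = 0" for p c
      by (simp_all add: form_part_def wscale_def fun_eq_iff)
    then show ?thesis by (simp add: gcomm_def r0)
  next
    case False
    have "gcomm n r a = (\<Sum>p\<le>2*n. \<Sum>q\<le>2*n. if q = 0 then (if p = 1 then moyal n r a - moyal n a r else 0) else 0)"
      unfolding gcomm_def fa fr by (intro sum.cong refl) (auto simp: wscale_def fun_eq_iff)
    also have "\<dots> = moyal n r a - moyal n a r"
      using False by (simp add: sum.delta)
    finally show ?thesis .
  qed
qed

lemma one_form_gcomm: "one_form n r \<Longrightarrow> zero_form a \<Longrightarrow> one_form n (gcomm n r a)"
  using one_form_moyal [of n r a] by (simp add: gcomm_one_zero one_form_def)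

lemma body_i_over_lambda_gcomm:
  assumes "one_form n r" "zero_form a"
  shows "body {j} (i_over_lambda (gcomm n r a)) = wconst \<i> * weyl.ad n (body {j} r) (body {} a)"
  using assms by (simp add: gcomm_one_zero body_moyal_left body_moyal_right weyl.ad_def)

section \<open>Pullback along symplectic linear maps\<close>

definition mps_lin :: "nat \<Rightarrow> (nat \<Rightarrow> nat \<Rightarrow> real) \<Rightarrow> nat \<Rightarrow> (nat, complex) mps" where
  "mps_lin m A j = (\<Sum>k<m. mps_const (of_real (A j k)) * mps_var k)"

definition mps_monom :: "nat \<Rightarrow> (nat \<Rightarrow> nat \<Rightarrow> real) \<Rightarrow> nat multiset \<Rightarrow> (nat, complex) mps" where
  "mps_monom m A \<alpha> = (\<Prod>j\<in>#\<alpha>. mps_lin m A j)"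

definition monomials_of_degree :: "nat \<Rightarrow> nat \<Rightarrow> nat multiset set" where
  "monomials_of_degree m s = {\<alpha>. set_mset \<alpha> \<subseteq> {..<m} \<and> size \<alpha> = s}"

text \<open>Linear forms preserve the degree, so only the finitely many monomials of the same degree
  as \<beta> contribute to its coefficient. This makes substitution into an infinite series a
  coefficientwise finite operation.\<close>

definition mps_subst :: "nat \<Rightarrow> nat \<Rightarrow> (nat \<Rightarrow> nat \<Rightarrow> real) \<Rightarrow> (nat, complex) mps \<Rightarrow> (nat, complex) mps" where
  "mps_subst m m' A f = Mps (\<lambda>\<beta>.
     \<Sum>\<alpha>\<in>monomials_of_degree m' (size \<beta>). mps_coeff f \<alpha> * mps_coeff (mps_monom m A \<alpha>) \<beta>)"

lemma mps_coeff_subst: "mps_coeff (mps_subst m m' A f) \<beta> =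
    (\<Sum>\<alpha>\<in>monomials_of_degree m' (size \<beta>). mps_coeff f \<alpha> * mps_coeff (mps_monom m A \<alpha>) \<beta>)"
  by (simp add: mps_subst_def)

lemma finite_monomials_of_degree [simp]: "finite (monomials_of_degree m s)"
proof -
  have "monomials_of_degree m s \<subseteq> mset ` {xs. set xs \<subseteq> {..<m} \<and> length xs = s}"
  proof
    fix \<alpha> assume "\<alpha> \<in> monomials_of_degree m s"
    moreover obtain xs where "mset xs = \<alpha>" using ex_mset by auto
    ultimately show "\<alpha> \<in> mset ` {xs. set xs \<subseteq> {..<m} \<and> length xs = s}"
      by (auto simp: monomials_of_degree_def)
  qed
  then show ?thesis by (rule finite_subset) (simp add: finite_lists_length_eq)
qed

lemma mps_coeff_lin_mult: "mps_coeff (mps_lin m A j * f) \<beta> =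
    (\<Sum>k<m. of_real (A j k) * (if k \<in># \<beta> then mps_coeff f (\<beta> - {#k#}) else 0))"
  by (simp add: mps_lin_def sum_distrib_right mps_coeff_sum mult.assoc mps_coeff_var_mult)

lemma mps_monom_homogeneous: "size \<beta> \<noteq> size \<alpha> \<Longrightarrow> mps_coeff (mps_monom m A \<alpha>) \<beta> = 0"
proof (induction \<alpha> arbitrary: \<beta>)
  case (add j \<alpha>)
  have "mps_coeff (mps_lin m A j * mps_monom m A \<alpha>) \<beta> = 0"
    unfolding mps_coeff_lin_mult
  proof (intro sum.neutral ballI)
    fix k
    have "size (\<beta> - {#k#}) \<noteq> size \<alpha>" if "k \<in># \<beta>"
      using add.prems that by (auto dest!: multi_member_split)
    then show "of_real (A j k) * (if k \<in># \<beta> then mps_coeff (mps_monom m A \<alpha>) (\<beta> - {#k#}) else 0) = 0"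
      using add.IH by simp
  qed
  then show ?case by (simp add: mps_monom_def)
qed (auto simp: mps_monom_def mps_coeff_1)

lemma mps_monom_add: "mps_monom m A (\<alpha> + \<beta>) = mps_monom m A \<alpha> * mps_monom m A \<beta>"
  by (simp add: mps_monom_def)

lemma mps_subst_add: "mps_subst m m' A (f + g) = mps_subst m m' A f + mps_subst m m' A g"
  by (rule mps_eqI) (simp add: mps_coeff_subst distrib_right sum.distrib)

lemma mps_subst_const: "mps_subst m m' A (mps_const c) = mps_const c"
proof (rule mps_eqI)
  fix \<beta>
  show "mps_coeff (mps_subst m m' A (mps_const c)) \<beta> = mps_coeff (mps_const c) \<beta>"
  proof (cases "\<beta> = {#}")
    case True
    have "monomials_of_degree m' 0 = {{#}}" by (auto simp: monomials_of_degree_def)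
    with True show ?thesis
      by (simp add: mps_coeff_subst mps_const.rep_eq mps_monom_def mps_coeff_1)
  next
    case False
    have "mps_coeff (mps_const c) \<alpha> = 0" if "\<alpha> \<in> monomials_of_degree m' (size \<beta>)" for \<alpha> :: "nat multiset"
      using that False by (auto simp: monomials_of_degree_def mps_const.rep_eq)
    then show ?thesis using False by (simp add: mps_coeff_subst mps_const.rep_eq)
  qed
qed

lemma sum_monomials_of_degree_split:
  "(\<Sum>\<alpha>\<in>monomials_of_degree m N. \<Sum>\<beta> | \<beta> \<subseteq># \<alpha>. F \<beta> (\<alpha> - \<beta>)) =
   (\<Sum>\<beta>\<in>(\<Union>s\<le>N. monomials_of_degree m s). \<Sum>\<gamma>\<in>monomials_of_degree m (N - size \<beta>). F \<beta> \<gamma>)"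
proof -
  have "(\<Sum>\<alpha>\<in>monomials_of_degree m N. \<Sum>\<beta> | \<beta> \<subseteq># \<alpha>. F \<beta> (\<alpha> - \<beta>)) =
      (\<Sum>(\<alpha>, \<beta>)\<in>(SIGMA \<alpha>:monomials_of_degree m N. {\<beta>. \<beta> \<subseteq># \<alpha>}). F \<beta> (\<alpha> - \<beta>))"
    by (simp add: sum.Sigma)
  also have "\<dots> = (\<Sum>(\<beta>, \<gamma>)\<in>(SIGMA \<beta>:(\<Union>s\<le>N. monomials_of_degree m s). monomials_of_degree m (N - size \<beta>)). F \<beta> \<gamma>)"
  proof (rule sum.reindex_bij_witness [where i = "\<lambda>(\<beta>, \<gamma>). (\<beta> + \<gamma>, \<beta>)" and j = "\<lambda>(\<alpha>, \<beta>). (\<beta>, \<alpha> - \<beta>)"])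
    fix x assume "x \<in> (SIGMA \<alpha>:monomials_of_degree m N. {\<beta>. \<beta> \<subseteq># \<alpha>})"
    then obtain \<alpha> \<beta> where x: "x = (\<alpha>, \<beta>)" "set_mset \<alpha> \<subseteq> {..<m}" "size \<alpha> = N" "\<beta> \<subseteq># \<alpha>"
      by (auto simp: monomials_of_degree_def)
    have "size \<beta> \<le> N" using x by (metis size_mset_mono)
    moreover have "size (\<alpha> - \<beta>) = N - size \<beta>" using x by (simp add: size_Diff_submset)
    moreover have "set_mset \<beta> \<subseteq> {..<m}"
      using x(2) set_mset_mono [OF x(4)] by (rule subset_trans [rotated])
    moreover have "set_mset (\<alpha> - \<beta>) \<subseteq> {..<m}"
      using x(2) by (auto dest: in_diffD)
    ultimately show "(case x of (\<alpha>, \<beta>) \<Rightarrow> (\<beta>, \<alpha> - \<beta>)) \<in>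
        (SIGMA \<beta>:(\<Union>s\<le>N. monomials_of_degree m s). monomials_of_degree m (N - size \<beta>))"
      using x by (auto simp: monomials_of_degree_def)
  qed (auto simp: monomials_of_degree_def)
  also have "\<dots> = (\<Sum>\<beta>\<in>(\<Union>s\<le>N. monomials_of_degree m s). \<Sum>\<gamma>\<in>monomials_of_degree m (N - size \<beta>). F \<beta> \<gamma>)"
    by (rule sum.Sigma [symmetric]) auto
  finally show ?thesis .
qed

text \<open>On monomials this is \<open>mps_monom_add\<close>. The splitting of \<alpha> lets
  \<beta> have any degree up to that of \<gamma>, but by \<open>mps_monom_homogeneous\<close> only
  \<beta> of the same degree as \<delta> contribute, which leaves the sums in the
  definition.\<close>

lemma mps_subst_mult: "mps_subst m m' A (f * g) = mps_subst m m' A f * mps_subst m m' A g"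
proof (rule mps_eqI)
  fix \<gamma> :: "nat multiset"
  let ?N = "size \<gamma>"
  let ?B = "\<Union>s\<le>?N. monomials_of_degree m' s"
  let ?M = "\<lambda>\<alpha> \<beta>. mps_coeff (mps_monom m A \<alpha>) \<beta>"
  have "mps_coeff (mps_subst m m' A (f * g)) \<gamma> =
      (\<Sum>\<alpha>\<in>monomials_of_degree m' ?N. \<Sum>\<beta> | \<beta> \<subseteq># \<alpha>.
         mps_coeff f \<beta> * mps_coeff g (\<alpha> - \<beta>) * ?M (\<beta> + (\<alpha> - \<beta>)) \<gamma>)"
    by (simp add: mps_coeff_subst mps_coeff_mult sum_distrib_right)
  also have "\<dots> = (\<Sum>\<beta>\<in>?B. \<Sum>\<epsilon>\<in>monomials_of_degree m' (?N - size \<beta>).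
      mps_coeff f \<beta> * mps_coeff g \<epsilon> * ?M (\<beta> + \<epsilon>) \<gamma>)"
    by (rule sum_monomials_of_degree_split)
  also have "\<dots> = (\<Sum>\<beta>\<in>?B. \<Sum>\<delta> | \<delta> \<subseteq># \<gamma>. \<Sum>\<epsilon>\<in>monomials_of_degree m' (?N - size \<beta>).
      mps_coeff f \<beta> * ?M \<beta> \<delta> * (mps_coeff g \<epsilon> * ?M \<epsilon> (\<gamma> - \<delta>)))"
    unfolding mps_monom_add mps_coeff_mult sum_distrib_left
    by (rule sum.cong [OF refl], subst sum.swap) (simp add: ac_simps)
  also have "\<dots> = (\<Sum>\<delta> | \<delta> \<subseteq># \<gamma>. \<Sum>\<beta>\<in>?B. \<Sum>\<epsilon>\<in>monomials_of_degree m' (?N - size \<beta>).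
      mps_coeff f \<beta> * ?M \<beta> \<delta> * (mps_coeff g \<epsilon> * ?M \<epsilon> (\<gamma> - \<delta>)))"
    by (rule sum.swap)
  also have "\<dots> = (\<Sum>\<delta> | \<delta> \<subseteq># \<gamma>. \<Sum>\<beta>\<in>monomials_of_degree m' (size \<delta>).
      \<Sum>\<epsilon>\<in>monomials_of_degree m' (size (\<gamma> - \<delta>)). mps_coeff f \<beta> * ?M \<beta> \<delta> * (mps_coeff g \<epsilon> * ?M \<epsilon> (\<gamma> - \<delta>)))"
  proof (rule sum.cong)
    fix \<delta> assume "\<delta> \<in> {\<delta>. \<delta> \<subseteq># \<gamma>}"
    then have \<delta>: "size \<delta> \<le> ?N" "size (\<gamma> - \<delta>) = ?N - size \<delta>"
      by (auto simp: size_Diff_submset size_mset_mono)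
    have "(\<Sum>\<beta>\<in>?B. \<Sum>\<epsilon>\<in>monomials_of_degree m' (?N - size \<beta>).
          mps_coeff f \<beta> * ?M \<beta> \<delta> * (mps_coeff g \<epsilon> * ?M \<epsilon> (\<gamma> - \<delta>))) =
        (\<Sum>\<beta>\<in>monomials_of_degree m' (size \<delta>). \<Sum>\<epsilon>\<in>monomials_of_degree m' (?N - size \<beta>).
          mps_coeff f \<beta> * ?M \<beta> \<delta> * (mps_coeff g \<epsilon> * ?M \<epsilon> (\<gamma> - \<delta>)))"
    proof (rule sum.mono_neutral_right)
      show "\<forall>\<beta>\<in>?B - monomials_of_degree m' (size \<delta>). (\<Sum>\<epsilon>\<in>monomials_of_degree m' (?N - size \<beta>).
          mps_coeff f \<beta> * ?M \<beta> \<delta> * (mps_coeff g \<epsilon> * ?M \<epsilon> (\<gamma> - \<delta>))) = 0"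
      proof
        fix \<beta> assume "\<beta> \<in> ?B - monomials_of_degree m' (size \<delta>)"
        then have "size \<delta> \<noteq> size \<beta>" by (auto simp: monomials_of_degree_def)
        then show "(\<Sum>\<epsilon>\<in>monomials_of_degree m' (?N - size \<beta>).
            mps_coeff f \<beta> * ?M \<beta> \<delta> * (mps_coeff g \<epsilon> * ?M \<epsilon> (\<gamma> - \<delta>))) = 0"
          by (simp add: mps_monom_homogeneous)
      qed
    qed (use \<delta> in auto)
    also have "\<dots> = (\<Sum>\<beta>\<in>monomials_of_degree m' (size \<delta>). \<Sum>\<epsilon>\<in>monomials_of_degree m' (size (\<gamma> - \<delta>)).
          mps_coeff f \<beta> * ?M \<beta> \<delta> * (mps_coeff g \<epsilon> * ?M \<epsilon> (\<gamma> - \<delta>)))"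
      by (rule sum.cong) (auto simp: \<delta>(2) monomials_of_degree_def)
    finally show "(\<Sum>\<beta>\<in>?B. \<Sum>\<epsilon>\<in>monomials_of_degree m' (?N - size \<beta>).
          mps_coeff f \<beta> * ?M \<beta> \<delta> * (mps_coeff g \<epsilon> * ?M \<epsilon> (\<gamma> - \<delta>))) = \<dots>" .
  qed simp
  also have "\<dots> = mps_coeff (mps_subst m m' A f * mps_subst m m' A g) \<gamma>"
    by (simp add: mps_coeff_mult mps_coeff_subst sum_product)
  finally show "mps_coeff (mps_subst m m' A (f * g)) \<gamma> =
      mps_coeff (mps_subst m m' A f * mps_subst m m' A g) \<gamma>" .
qed

lemma mps_deriv_lin: "i < m \<Longrightarrow> mps_deriv i (mps_lin m A j) = mps_const (of_real (A j i))"
proof -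
  assume i: "i < m"
  have "mps_deriv i (mps_lin m A j) = (\<Sum>k<m. mps_const (of_real (A j k)) * (if i = k then 1 else 0))"
    unfolding mps_lin_def mps_deriv_sum mps_deriv_mult mps_deriv_const mps_deriv_var by simp
  also have "\<dots> = (\<Sum>k<m. if k = i then mps_const (of_real (A j i)) else 0)"
    by (intro sum.cong) auto
  finally show ?thesis using i by simp
qed

lemma mps_deriv_monom:
  assumes "i < m" "set_mset \<alpha> \<subseteq> {..<m'}"
  shows "mps_deriv i (mps_monom m A \<alpha>) =
    (\<Sum>p<m'. mps_const (of_real (A p i)) * (of_nat (count \<alpha> p) * mps_monom m A (\<alpha> - {#p#})))"
  using assms(2)
proof (induction \<alpha>)
  case empty
  show ?case using mps_deriv_const [of i 1] by (simp add: mps_monom_def)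
next
  case (add x \<alpha>)
  have "mps_deriv i (mps_monom m A (add_mset x \<alpha>)) =
      mps_const (of_real (A x i)) * mps_monom m A \<alpha> +
      (\<Sum>p<m'. mps_const (of_real (A p i)) * (of_nat (count \<alpha> p) * (mps_lin m A x * mps_monom m A (\<alpha> - {#p#}))))"
    using add assms(1)
    by (simp add: mps_monom_def mps_deriv_mult mps_deriv_lin sum_distrib_left ac_simps)
  \<comment> \<open>The derivative of the new factor becomes the summand p = x, where it raises the
    multiplicity of x by one.\<close>
  also have "mps_const (of_real (A x i)) * mps_monom m A \<alpha> =
      (\<Sum>p<m'. if p = x then mps_const (of_real (A x i)) * mps_monom m A \<alpha> else 0)"
    using add.prems by simp
  also have "\<dots> + (\<Sum>p<m'. mps_const (of_real (A p i)) *
        (of_nat (count \<alpha> p) * (mps_lin m A x * mps_monom m A (\<alpha> - {#p#})))) =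
      (\<Sum>p<m'. mps_const (of_real (A p i)) *
        (of_nat (count (add_mset x \<alpha>) p) * mps_monom m A (add_mset x \<alpha> - {#p#})))"
    unfolding sum.distrib [symmetric]
  proof (rule sum.cong)
    fix p
    \<comment> \<open>If p does not occur in \<alpha>, the two monomials may differ (for p = x), but
      then the multiplicity in front is 0.\<close>
    have "of_nat (count \<alpha> p) * (mps_lin m A x * mps_monom m A (\<alpha> - {#p#})) =
        of_nat (count \<alpha> p) * mps_monom m A (add_mset x \<alpha> - {#p#})"
    proof (cases "p \<in># \<alpha>")
      case True
      then have "add_mset x \<alpha> - {#p#} = add_mset x (\<alpha> - {#p#})" by simp
      then show ?thesis by (simp add: mps_monom_def)
    qed (simp add: not_in_iff)
    then show "(if p = x then mps_const (of_real (A x i)) * mps_monom m A \<alpha> else 0) +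
        mps_const (of_real (A p i)) * (of_nat (count \<alpha> p) * (mps_lin m A x * mps_monom m A (\<alpha> - {#p#}))) =
        mps_const (of_real (A p i)) * (of_nat (count (add_mset x \<alpha>) p) * mps_monom m A (add_mset x \<alpha> - {#p#}))"
      by (simp add: algebra_simps)
  qed simp
  finally show ?case .
qed

text \<open>The chain rule for y_p \<mapsto> \<Sum> A_pi y_i, in the form of the hypothesis
  \<open>dh\<close> of \<open>P_hom\<close>. Removing one copy of p from a monomial matches degree N
  + 1 on the left with degree N on the right.\<close>

lemma mps_deriv_subst:
  assumes "i < m"
  shows "mps_deriv i (mps_subst m m' A f) =
    (\<Sum>p<m'. mps_const (of_real (A p i)) * mps_subst m m' A (mps_deriv p f))"
proof (rule mps_eqI)
  fix \<beta> :: "nat multiset"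
  let ?N = "size \<beta>"
  let ?M = "\<lambda>\<alpha>. mps_coeff (mps_monom m A \<alpha>) \<beta>"
  have "mps_coeff (mps_deriv i (mps_subst m m' A f)) \<beta> =
      (\<Sum>\<alpha>\<in>monomials_of_degree m' (Suc ?N). mps_coeff f \<alpha> * mps_coeff (mps_deriv i (mps_monom m A \<alpha>)) \<beta>)"
    by (simp add: mps_coeff_deriv mps_coeff_subst sum_distrib_left mult.left_commute)
  also have "\<dots> = (\<Sum>\<alpha>\<in>monomials_of_degree m' (Suc ?N). \<Sum>p<m'.
      mps_coeff f \<alpha> * (of_real (A p i) * (of_nat (count \<alpha> p) * ?M (\<alpha> - {#p#}))))"
    by (intro sum.cong refl) (simp add: monomials_of_degree_def mps_deriv_monom [OF assms, where m' = m']
        mps_coeff_sum sum_distrib_left mps_const_of_nat [symmetric])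
  also have "\<dots> = (\<Sum>p<m'. \<Sum>\<alpha>\<in>monomials_of_degree m' (Suc ?N).
      mps_coeff f \<alpha> * (of_real (A p i) * (of_nat (count \<alpha> p) * ?M (\<alpha> - {#p#}))))"
    by (rule sum.swap)
  also have "\<dots> = (\<Sum>p<m'. \<Sum>\<alpha>\<in>monomials_of_degree m' ?N.
      of_real (A p i) * (mps_coeff (mps_deriv p f) \<alpha> * ?M \<alpha>))"
  proof (rule sum.cong)
    fix p assume p: "p \<in> {..<m'}"
    have "(\<Sum>\<alpha>\<in>monomials_of_degree m' (Suc ?N).
        mps_coeff f \<alpha> * (of_real (A p i) * (of_nat (count \<alpha> p) * ?M (\<alpha> - {#p#})))) =
      (\<Sum>\<alpha>\<in>monomials_of_degree m' (Suc ?N) \<inter> {\<alpha>. p \<in># \<alpha>}.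
        mps_coeff f \<alpha> * (of_real (A p i) * (of_nat (count \<alpha> p) * ?M (\<alpha> - {#p#}))))"
      by (rule sum.mono_neutral_right) (auto simp: not_in_iff)
    also have "\<dots> = (\<Sum>\<alpha>\<in>monomials_of_degree m' ?N.
        of_real (A p i) * (mps_coeff (mps_deriv p f) \<alpha> * ?M \<alpha>))"
      by (rule sum.reindex_bij_witness [where i = "add_mset p" and j = "\<lambda>\<alpha>. \<alpha> - {#p#}"])
         (use p in \<open>auto simp: monomials_of_degree_def mps_coeff_deriv dest!: multi_member_split\<close>)
    finally show "(\<Sum>\<alpha>\<in>monomials_of_degree m' (Suc ?N).
        mps_coeff f \<alpha> * (of_real (A p i) * (of_nat (count \<alpha> p) * ?M (\<alpha> - {#p#})))) = \<dots>" .
  qed simp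
  also have "\<dots> = mps_coeff (\<Sum>p<m'. mps_const (of_real (A p i)) * mps_subst m m' A (mps_deriv p f)) \<beta>"
    by (simp add: mps_coeff_sum mps_coeff_subst sum_distrib_left)
  finally show "mps_coeff (mps_deriv i (mps_subst m m' A f)) \<beta> =
      mps_coeff (\<Sum>p<m'. mps_const (of_real (A p i)) * mps_subst m m' A (mps_deriv p f)) \<beta>" .
qed

lemma subst_monomial_zero_form: "subst_monomial m A \<alpha> {} 0 \<beta> {} = mps_coeff (mps_monom m A \<alpha>) \<beta>"
  and subst_monomial_eq_0: "K \<noteq> {} \<Longrightarrow> subst_monomial m A \<alpha> {} k \<beta> K = 0"
proof -
  define g :: "nat \<Rightarrow> welem \<Rightarrow> welem" where
    "g = (\<lambda>j a. \<Sum>k<m. wscale (of_real (A j k)) (ymul k a))"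
  have g: "g j a l \<beta> K = (\<Sum>k<m. of_real (A j k) * (if k \<in># \<beta> then a l (\<beta> - {#k#}) K else 0))" for j a l \<beta> K
    by (simp add: g_def sum_fun_apply wscale_def ymul_def)
  have "foldr g xs wone 0 \<beta> {} = mps_coeff (mps_monom m A (mset xs)) \<beta>" for xs
    by (induction xs arbitrary: \<beta>)
       (auto simp: mps_monom_def wone_def mps_coeff_1 mps_coeff_lin_mult g cong: if_cong)
  from this [of "sorted_list_of_multiset \<alpha>"]
  show "subst_monomial m A \<alpha> {} 0 \<beta> {} = mps_coeff (mps_monom m A \<alpha>) \<beta>"
    by (simp add: subst_monomial_def g_def)
  have "foldr g xs wone k \<beta> K = 0" if "K \<noteq> {}" for xs
    using that by (induction xs arbitrary: \<beta>) (simp_all add: wone_def g cong: if_cong)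
  then show "K \<noteq> {} \<Longrightarrow> subst_monomial m A \<alpha> {} k \<beta> K = 0"
    by (simp add: subst_monomial_def g_def)
qed

lemma wpull_zero_form:
  assumes "zero_form b"
  shows "zero_form (wpull m m' A b)" "body {} (wpull m m' A b) = fps_map (mps_subst m m' A) (body {} b)"
proof -
  have *: "wpull m m' A b k \<beta> K =
      (\<Sum>\<alpha>\<in>monomials_of_degree m' (size \<beta>). b k \<alpha> {} * subst_monomial m A \<alpha> {} 0 \<beta> K)" for k \<beta> K
  proof -
    have "(\<Sum>J\<in>Pow {..<m'}. b k \<alpha> J * subst_monomial m A \<alpha> J 0 \<beta> K) =
        (\<Sum>J\<in>{{}}. b k \<alpha> J * subst_monomial m A \<alpha> J 0 \<beta> K)" for \<alpha>
      by (rule sum.mono_neutral_right) (use zero_formD [OF assms] in auto)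
    then show ?thesis by (simp add: wpull_def monomials_of_degree_def)
  qed
  show "zero_form (wpull m m' A b)"
    by (simp add: zero_form_def * subst_monomial_eq_0)
  show "body {} (wpull m m' A b) = fps_map (mps_subst m m' A) (body {} b)"
    by (rule wfps_eqI) (simp add: * subst_monomial_zero_form, simp add: wcoeff_def mps_coeff_subst body_def)
qed

section \<open>Symplectic matrices and the Poisson bivector\<close>

lemma omega_omega:
  assumes "i < 2 * n" "k < 2 * n"
  shows "(\<Sum>j<2*n. omega n i j * omega n j k) = (if i = k then -1 else 0)"
proof -
  \<comment> \<open>The conjugate index, the only column in which row i of \<omega> is
    nonzero.\<close>
  define i' where "i' = (if i < n then n + i else i - n)"
  have "(\<Sum>j<2*n. omega n i j * omega n j k) = (\<Sum>j\<in>{i'}. omega n i j * omega n j k)"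
    by (rule sum.mono_neutral_right) (use assms in \<open>auto simp: omega_def i'_def\<close>)
  then show ?thesis
    using assms by (auto simp: omega_def i'_def)
qed

text \<open>A^T \<omega> A = \<omega> says that - \<omega> A^T \<omega> is a left inverse of A,
  hence also a right inverse, as the matrices are square. Multiplying A (- \<omega> A^T \<omega>) =
  1 by - \<omega> from the right gives A \<omega> A^T = \<omega>.\<close>

lemma symplectic_matrix_transpose:
  assumes "\<And>k l. k < 2*n \<Longrightarrow> l < 2*n \<Longrightarrow> omega_form n (\<lambda>i. A i k) (\<lambda>i. A i l) = omega n k l"
    and p: "p < 2*n" and q: "q < 2*n"
  shows "(\<Sum>i<2*n. \<Sum>j<2*n. omega n i j * A p i * A q j) = omega n p q"
proof -
  let ?N = "2 * n"
  define W where "W = Matrix.mat ?N ?N (\<lambda>(i, j). omega n i j)"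
  define W' where "W' = Matrix.mat ?N ?N (\<lambda>(i, j). - omega n i j)"
  define M where "M = Matrix.mat ?N ?N (\<lambda>(i, j). A i j)"
  define T where "T = Matrix.mat ?N ?N (\<lambda>(i, j). A j i)"
  have c [simp]: "W \<in> carrier_mat ?N ?N" "W' \<in> carrier_mat ?N ?N" "M \<in> carrier_mat ?N ?N"
      "T \<in> carrier_mat ?N ?N"
    by (simp_all add: W_def W'_def M_def T_def)
  have [simp]: "X * Y \<in> carrier_mat ?N ?N"
    if "X \<in> carrier_mat ?N ?N" "Y \<in> carrier_mat ?N ?N" for X Y :: "real mat"
    using that by (rule mult_carrier_mat)
  note assoc = assoc_mult_mat [of _ ?N ?N _ ?N _ ?N]
  have TWM: "T * (W * M) = W"
  proof (rule eq_matI)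
    fix k l assume "k < dim_row W" "l < dim_col W"
    then show "(T * (W * M)) $$ (k, l) = W $$ (k, l)"
      using assms(1) [of k l]
      by (simp add: W_def M_def T_def scalar_prod_def omega_form_def atLeast0LessThan sum_distrib_left ac_simps)
  qed (simp_all add: W_def M_def T_def)
  have WW: "W * W' = 1\<^sub>m ?N" "W' * W = 1\<^sub>m ?N"
    by (rule eq_matI; simp add: W_def W'_def scalar_prod_def atLeast0LessThan sum_negf omega_omega)+
  have "(W' * (T * W)) * M = 1\<^sub>m ?N"
    by (simp add: assoc TWM WW)
  then have "M * (W' * (T * W)) = 1\<^sub>m ?N"
    by (rule mat_mult_left_right_inverse [where n = ?N, rotated 2]) auto
  then have "M * (W' * (T * W)) * W' = W'"
    by (simp add: left_mult_one_mat [of _ ?N ?N])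
  then have "M * (W' * T) = W'"
    by (simp add: assoc WW right_mult_one_mat [of _ ?N ?N])
  then have "(M * (W' * T)) $$ (p, q) = W' $$ (p, q)" by simp
  then show ?thesis
    using p q by (simp add: W'_def M_def T_def scalar_prod_def atLeast0LessThan sum_distrib_left sum_negf ac_simps)
qed

lemma wconst_mult: "wconst (a * b) = wconst a * wconst b"
  by (simp add: wconst_def mps_const_mult)

lemma wconst_add: "wconst (a + b) = wconst a + wconst b"
  by (simp add: wconst_def mps_const_add)

lemma wconst_0 [simp]: "wconst 0 = 0" and wconst_1 [simp]: "wconst 1 = 1"
  by (simp_all add: wconst_def)

lemma wconst_sum: "wconst (sum f A) = (\<Sum>a\<in>A. wconst (f a))"
  by (induction A rule: infinite_finite_induct) (auto simp: wconst_add)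

definition symplectic_matrix :: "nat \<Rightarrow> (nat \<Rightarrow> nat \<Rightarrow> real) \<Rightarrow> bool" where
  "symplectic_matrix n A \<longleftrightarrow>
     (\<forall>k<2*n. \<forall>l<2*n. omega_form n (\<lambda>i. A i k) (\<lambda>i. A i l) = omega n k l)"

lemma wpull_moyal:
  assumes a: "zero_form a" and b: "zero_form b" and A: "symplectic_matrix n A"
  shows "wpull (2*n) (2*n) A (moyal n a b) = moyal n (wpull (2*n) (2*n) A a) (wpull (2*n) (2*n) A b)"
proof (rule zero_form_eqI)
  let ?h = "fps_map (mps_subst (2*n) (2*n) A)"
  have const: "?h (wconst x) = wconst x" for x
    using mps_subst_const [of "2*n" "2*n" A 0]
    unfolding wconst_def by (subst fps_map_const) (auto simp: mps_subst_const)
  have "?h (weyl.star n x y) = weyl.star n (?h x) (?h y)" for x y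
  proof (rule weyl.star_hom [where A = "\<lambda>p i. wconst (of_real (A p i))"])
    fix i :: nat and x :: wfps assume "i < 2 * n"
    then show "wderiv i (?h x) = (\<Sum>p<2*n. wconst (of_real (A p i)) * ?h (wderiv p x))"
      by (intro fps_ext) (simp add: mps_deriv_subst fps_sum_nth wconst_def)
  next
    fix p q assume pq: "p < 2 * n" "q < 2 * n"
    have "(\<Sum>i<2*n. \<Sum>j<2*n. bivec n i j * A p i * A q j) = bivec n p q"
      using symplectic_matrix_transpose [of n A p q] A pq
      by (simp add: symplectic_matrix_def bivec_def sum_negf flip: sum_divide_distrib)
    then have "wconst (of_real (\<Sum>i<2*n. \<Sum>j<2*n. bivec n i j * A p i * A q j)) = wbivec n p q"
      by (simp add: wbivec_def)
    then show "(\<Sum>i<2*n. \<Sum>j<2*n. wbivec n i j * wconst (of_real (A p i)) * wconst (of_real (A q j))) =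
        wbivec n p q"
      by (simp add: wconst_sum wconst_mult wbivec_def)
  qed (simp_all add: fps_map_add fps_map_mult fps_map_series mps_subst_add mps_subst_mult
      wbivec_def moyal_coeff_def const)
  then show "body {} (wpull (2*n) (2*n) A (moyal n a b)) =
      body {} (moyal n (wpull (2*n) (2*n) A a) (wpull (2*n) (2*n) A b))"
    by (simp add: wpull_zero_form zero_form_moyal a b body_moyal_right)
qed (simp_all add: wpull_zero_form zero_form_moyal a b)

lemma wpull_wone: "wpull m m' A wone = wone"
proof -
  have "zero_form wone" by (simp add: zero_form_def wone_def)
  moreover have "fps_map (mps_subst m m' A) 1 = 1"
    using mps_subst_const [of m m' A 0] mps_subst_const [of m m' A 1]
    by (intro fps_ext) simp
  ultimately show ?thesis
    by (intro zero_form_eqI) (simp_all add: wpull_zero_form)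
qed

text \<open>The linear vector field \<Sum> N_qp y_q \<partial>/\<partial>y_p, the fibre part of a
  covariant derivative (see \<open>body_cov_deriv\<close>).\<close>

definition wlinear :: "nat \<Rightarrow> (nat \<Rightarrow> nat \<Rightarrow> real) \<Rightarrow> wfps \<Rightarrow> wfps" where
  "wlinear n N F = (\<Sum>p<2*n. \<Sum>q<2*n. wconst (of_real (N q p)) * (wvar q * wderiv p F))"

text \<open>The assumption says that \<open>N\<close> is in the symplectic Lie algebra, i.e. that the vector field is Hamiltonian.\<close>

lemma wlinear_star:
  assumes N: "\<And>q r. q < 2*n \<Longrightarrow> r < 2*n \<Longrightarrow>
    (\<Sum>k<2*n. N q k * omega n k r) + (\<Sum>l<2*n. omega n q l * N r l) = 0"
  shows "wlinear n N (weyl.star n a b) = weyl.star n (wlinear n N a) b + weyl.star n a (wlinear n N b)"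
proof (rule weyl.star_derivation [where g = "\<lambda>i p. wconst (- of_real (N i p))"])
  fix a b :: wfps and x :: "nat \<Rightarrow> wfps" and i :: nat
  show "wlinear n N (a + b) = wlinear n N a + wlinear n N b"
    by (simp add: wlinear_def wderiv_add distrib_left sum.distrib)
  show "wlinear n N (a * b) = wlinear n N a * b + a * wlinear n N b"
    by (simp add: wlinear_def wderiv_mult distrib_left sum.distrib sum_distrib_left sum_distrib_right ac_simps)
  show "wlinear n N (fps_series x) = fps_series (\<lambda>t. wlinear n N (x t))"
    by (simp add: wlinear_def weyl.d_series fps_series_mult_left fps_series_sum)
next
  fix i and a :: wfps assume i: "i < 2*n"
  have "wderiv i (wlinear n N a) = wlinear n N (wderiv i a) +
      (\<Sum>p<2*n. \<Sum>q<2*n. wconst (of_real (N q p)) * ((if i = q then 1 else 0) * wderiv p a))"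
    by (simp add: wlinear_def weyl.d_sum wderiv_mult wderiv_wvar weyl.d_commute [of i]
        distrib_left sum.distrib add.commute)
  also have "(\<Sum>p<2*n. \<Sum>q<2*n. wconst (of_real (N q p)) * ((if i = q then 1 else 0) * wderiv p a)) =
      (\<Sum>p<2*n. wconst (of_real (N i p)) * wderiv p a)"
  proof (rule sum.cong)
    fix p
    have "(\<Sum>q<2*n. wconst (of_real (N q p)) * ((if i = q then 1 else 0) * wderiv p a)) =
        (\<Sum>q\<in>{i}. wconst (of_real (N q p)) * ((if i = q then 1 else 0) * wderiv p a))"
      by (rule sum.mono_neutral_right) (use i in auto)
    then show "(\<Sum>q<2*n. wconst (of_real (N q p)) * ((if i = q then 1 else 0) * wderiv p a)) =
        wconst (of_real (N i p)) * wderiv p a"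
      by simp
  qed simp
  finally show "wlinear n N (wderiv i a) =
      wderiv i (wlinear n N a) + (\<Sum>p<2*n. wconst (- of_real (N i p)) * wderiv p a)"
    by (simp add: sum.distrib [symmetric] distrib_right [symmetric] wconst_add [symmetric])
next
  fix p q assume pq: "p < 2*n" "q < 2*n"
  let ?w = "omega n"
  \<comment> \<open>Sandwiching N \<omega> + \<omega> N^T = 0 between two copies of \<omega> and
    using \<omega>^2 = -1 gives \<omega> N + N^T \<omega> = 0, the invariance of the bivector that
    the derivation rule requires.\<close>
  have 1: "(\<Sum>q'<2*n. \<Sum>r<2*n. ?w p q' * (\<Sum>k<2*n. N q' k * ?w k r) * ?w r q) = - (\<Sum>i<2*n. ?w p i * N i q)"
  proof -
    have "(\<Sum>r<2*n. (\<Sum>k<2*n. N q' k * ?w k r) * ?w r q) = - N q' q" for q'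
    proof -
      have "(\<Sum>r<2*n. (\<Sum>k<2*n. N q' k * ?w k r) * ?w r q) = (\<Sum>k<2*n. N q' k * (\<Sum>r<2*n. ?w k r * ?w r q))"
        by (simp add: sum_distrib_left sum_distrib_right mult.assoc) (rule sum.swap)
      also have "\<dots> = (\<Sum>k<2*n. N q' k * (if k = q then -1 else 0))"
        by (intro sum.cong refl) (simp add: omega_omega pq)
      also have "\<dots> = (\<Sum>k<2*n. if k = q then - N q' k else 0)"
        by (intro sum.cong refl) auto
      finally show ?thesis using pq by simp
    qed
    then show ?thesis
      by (simp add: mult.assoc sum_distrib_left [symmetric] sum_negf)
  qed
  have 2: "(\<Sum>q'<2*n. \<Sum>r<2*n. ?w p q' * (\<Sum>l<2*n. ?w q' l * N r l) * ?w r q) = - (\<Sum>r<2*n. ?w r q * N r p)"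
  proof -
    have "(\<Sum>q'<2*n. ?w p q' * (\<Sum>l<2*n. ?w q' l * N r l)) = - N r p" for r
    proof -
      have "(\<Sum>q'<2*n. ?w p q' * (\<Sum>l<2*n. ?w q' l * N r l)) = (\<Sum>l<2*n. (\<Sum>q'<2*n. ?w p q' * ?w q' l) * N r l)"
        by (simp add: sum_distrib_left sum_distrib_right mult.assoc) (rule sum.swap)
      also have "\<dots> = (\<Sum>l<2*n. (if p = l then -1 else 0) * N r l)"
        by (intro sum.cong refl) (simp add: omega_omega pq)
      also have "\<dots> = (\<Sum>l<2*n. if l = p then - N r l else 0)"
        by (intro sum.cong refl) auto
      finally show ?thesis using pq by simp
    qed
    then show ?thesis
      by (subst sum.swap) (simp add: sum_distrib_right [symmetric] sum_negf, simp add: mult.commute)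
  qed
  have "(\<Sum>q'<2*n. \<Sum>r<2*n. ?w p q' * (\<Sum>k<2*n. N q' k * ?w k r) * ?w r q) +
      (\<Sum>q'<2*n. \<Sum>r<2*n. ?w p q' * (\<Sum>l<2*n. ?w q' l * N r l) * ?w r q) = 0"
    unfolding sum.distrib [symmetric] distrib_left [symmetric] distrib_right [symmetric]
    by (intro sum.neutral ballI) (simp add: N [unfolded sum.distrib [symmetric]])
  then have "(\<Sum>i<2*n. bivec n i q * - N i p) + (\<Sum>j<2*n. bivec n p j * - N j q) = 0"
    unfolding 1 2 by (simp add: bivec_def sum_divide_distrib [symmetric])
  then have "wconst (of_real ((\<Sum>i<2*n. bivec n i q * - N i p) + (\<Sum>j<2*n. bivec n p j * - N j q))) = 0"
    by simp
  then show "(\<Sum>i<2*n. wbivec n i q * wconst (- of_real (N i p))) +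
      (\<Sum>j<2*n. wbivec n p j * wconst (- of_real (N j q))) = 0"
    by (simp add: wbivec_def wconst_sum wconst_add wconst_mult [symmetric] flip: wconst_sum)
qed (simp_all add: wlinear_def wbivec_def moyal_coeff_def)

section \<open>Smooth functions on open subsets of Euclidean space\<close>

text \<open>Differentiability of a fixed order. Closure under products is then an induction on N
  with the first order Leibniz rule, whereas \<open>smooth_fun\<close> would demand a formula for
  iterated derivatives of a product.\<close>

primrec diff_fun :: "nat \<Rightarrow> nat \<Rightarrow> Defs.vec set \<Rightarrow> (Defs.vec \<Rightarrow> 'b::real_normed_vector) \<Rightarrow> bool" where
  "diff_fun 0 m U f \<longleftrightarrow> continuous_map (subtopology (Euclidean_space m) U) euclidean f"
| "diff_fun (Suc N) m U f \<longleftrightarrow> continuous_map (subtopology (Euclidean_space m) U) euclidean f \<and>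
     (\<forall>i<m. (\<forall>x\<in>U. (\<lambda>t. f (x(i := t))) differentiable (at (x i))) \<and> diff_fun N m U (pd i f))"

lemma iter_pd_append: "iter_pd (is @ js) f = iter_pd is (iter_pd js f)"
  by (induction "is") auto

lemma smooth_fun_pd: "smooth_fun m U f \<Longrightarrow> i < m \<Longrightarrow> smooth_fun m U (pd i f)"
  unfolding smooth_fun_def
proof (intro allI impI)
  fix is' :: "nat list"
  assume f: "\<forall>is. set is \<subseteq> {..<m} \<longrightarrow>
        continuous_map (subtopology (Euclidean_space m) U) euclidean (iter_pd is f) \<and>
        (\<forall>i<m. \<forall>x\<in>U. (\<lambda>t. iter_pd is f (x(i := t))) differentiable (at (x i)))"
    and i: "i < m" "set is' \<subseteq> {..<m}"
  have "set (is' @ [i]) \<subseteq> {..<m}" using i by simp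
  from f [rule_format, OF this]
  show "continuous_map (subtopology (Euclidean_space m) U) euclidean (iter_pd is' (pd i f)) \<and>
     (\<forall>ia<m. \<forall>x\<in>U. (\<lambda>t. iter_pd is' (pd i f) (x(ia := t))) differentiable (at (x ia)))"
    by (simp add: iter_pd_append)
qed

lemma smooth_fun_imp:
  assumes "smooth_fun m U f"
  shows "continuous_map (subtopology (Euclidean_space m) U) euclidean f"
    and "i < m \<Longrightarrow> x \<in> U \<Longrightarrow> (\<lambda>t. f (x(i := t))) differentiable (at (x i))"
  using assms [unfolded smooth_fun_def, rule_format, of "[]"] by auto

lemma smooth_fun_iff_diff_fun: "smooth_fun m U f \<longleftrightarrow> (\<forall>N. diff_fun N m U f)"
proof
  show "\<forall>N. diff_fun N m U f" if "smooth_fun m U f"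
  proof
    fix N show "diff_fun N m U f"
      using that by (induction N arbitrary: f) (auto simp: smooth_fun_imp smooth_fun_pd)
  qed
  assume f: "\<forall>N. diff_fun N m U f"
  show "smooth_fun m U f"
    unfolding smooth_fun_def
  proof (intro allI impI)
    fix "is" assume "set is \<subseteq> {..<m}"
    with f show "continuous_map (subtopology (Euclidean_space m) U) euclidean (iter_pd is f) \<and>
        (\<forall>i<m. \<forall>x\<in>U. (\<lambda>t. iter_pd is f (x(i := t))) differentiable (at (x i)))"
    \<comment> \<open>\<open>iter_pd\<close> applies the last index of the list first, hence the
      induction from the right.\<close>
    proof (induction "is" arbitrary: f rule: rev_induct)
      case Nil
      show ?case using Nil.prems(1) [rule_format, of "Suc 0"] by (simp add: fun_upd_def)
    next
      case (snoc i "is")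
      have "diff_fun N m U (pd i f)" for N
        using snoc.prems(1) [rule_format, of "Suc N"] snoc.prems(2) by simp
      with snoc show ?case by (simp add: iter_pd_append)
    qed
  qed
qed

text \<open>\<open>pd\<close> has a value even where the derivative does not exist; the relation
  carries existence along with the value, so that sum and product rules can be chained.\<close>

definition has_pd :: "nat \<Rightarrow> (Defs.vec \<Rightarrow> 'b::real_normed_vector) \<Rightarrow> 'b \<Rightarrow> Defs.vec \<Rightarrow> bool" where
  "has_pd i f D x \<longleftrightarrow> ((\<lambda>t. f (x(i := t))) has_vector_derivative D) (at (x i))"

lemma has_pd_imp_pd: "has_pd i f D x \<Longrightarrow> pd i f x = D"
  by (simp add: has_pd_def pd_def vector_derivative_at)

lemma has_pd_differentiable: "has_pd i f D x \<Longrightarrow> (\<lambda>t. f (x(i := t))) differentiable (at (x i))"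
  unfolding has_pd_def by (rule differentiableI_vector)

lemma smooth_fun_has_pd:
  "smooth_fun m U f \<Longrightarrow> i < m \<Longrightarrow> x \<in> U \<Longrightarrow> has_pd i f (pd i f x) x"
  using smooth_fun_imp(2) [of m U f i x] by (simp add: has_pd_def pd_def vector_derivative_works)

lemma has_pd_const: "has_pd i (\<lambda>_. c) 0 x"
  by (simp add: has_pd_def)

lemma has_pd_add: "has_pd i f D x \<Longrightarrow> has_pd i g E x \<Longrightarrow> has_pd i (\<lambda>z. f z + g z) (D + E) x"
  unfolding has_pd_def by (rule has_vector_derivative_add)

lemma has_pd_mult:
  fixes f g :: "Defs.vec \<Rightarrow> 'b::real_normed_algebra"
  shows "has_pd i f D x \<Longrightarrow> has_pd i g E x \<Longrightarrow> has_pd i (\<lambda>z. f z * g z) (f x * E + D * g x) x"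
  unfolding has_pd_def using has_vector_derivative_mult [of "\<lambda>t. f (x(i := t))" D "x i" UNIV "\<lambda>t. g (x(i := t))" E] by simp

lemma has_pd_sum: "(\<And>a. a \<in> A \<Longrightarrow> has_pd i (f a) (D a) x) \<Longrightarrow> has_pd i (\<lambda>z. \<Sum>a\<in>A. f a z) (sum D A) x"
  by (induction A rule: infinite_finite_induct) (auto intro: has_pd_const has_pd_add)

text \<open>U is open only inside \<real>^m. As i < m, the coordinate line through x stays in
  \<real>^m and meets U in an open set of parameters. Partial derivatives on U therefore depend only
  on the values on U.\<close>

lemma update_in_open:
  assumes U: "openin (Euclidean_space m) U" and x: "x \<in> U" and i: "i < m"
  shows "\<exists>S. open S \<and> x i \<in> S \<and> (\<forall>t\<in>S. x(i := t) \<in> U)"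
proof -
  have x0: "x k = 0" if "k \<ge> m" for k
    using openin_subset [OF U] x that by (auto simp: topspace_Euclidean_space)
  have "continuous_map euclideanreal (Euclidean_space m) (\<lambda>t. x(i := t))"
    unfolding Euclidean_space_def continuous_map_in_subtopology continuous_map_componentwise_UNIV
    using i x0 by (auto simp: fun_upd_def)
  then have "openin euclideanreal {t \<in> topspace euclideanreal. x(i := t) \<in> U}"
    using U by (rule openin_continuous_map_preimage)
  then have "open {t. x(i := t) \<in> U}" by simp
  moreover have "x i \<in> {t. x(i := t) \<in> U}" using x by simp
  ultimately show ?thesis by blast
qed

lemma has_pd_cong:
  assumes "openin (Euclidean_space m) U" "x \<in> U" "i < m" "\<And>z. z \<in> U \<Longrightarrow> f z = g z"
  shows "has_pd i f D x \<longleftrightarrow> has_pd i g D x"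
proof -
  obtain S where S: "open S" "x i \<in> S" "\<And>t. t \<in> S \<Longrightarrow> x(i := t) \<in> U"
    using update_in_open [OF assms(1-3)] by blast
  show ?thesis
    unfolding has_pd_def
    using has_vector_derivative_transform_within_open [OF _ S(1,2), of "\<lambda>t. f (x(i := t))" D "\<lambda>t. g (x(i := t))"]
      has_vector_derivative_transform_within_open [OF _ S(1,2), of "\<lambda>t. g (x(i := t))" D "\<lambda>t. f (x(i := t))"]
      assms(4) S(3) by auto
qed

lemma pd_cong:
  assumes "openin (Euclidean_space m) U" "x \<in> U" "i < m" "\<And>z. z \<in> U \<Longrightarrow> f z = g z"
  shows "pd i f x = pd i g x"
  using has_pd_cong [of m U x i f g, OF assms] by (simp add: pd_def has_pd_def vector_derivative_def)

lemma diff_fun_cong: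
  assumes U: "openin (Euclidean_space m) U" and "\<And>z. z \<in> U \<Longrightarrow> f z = g z" and "diff_fun N m U f"
  shows "diff_fun N m U g"
  using assms(2,3)
proof (induction N arbitrary: f g)
  case 0
  then show ?case
    by (auto intro: continuous_map_eq)
next
  case (Suc N)
  have "continuous_map (subtopology (Euclidean_space m) U) euclidean g"
    using Suc.prems by (auto intro: continuous_map_eq)
  moreover have "(\<lambda>t. g (x(i := t))) differentiable (at (x i))" if "i < m" "x \<in> U" for i x
  proof -
    have "has_pd i f (pd i f x) x"
      using Suc.prems that by (simp add: has_pd_def pd_def vector_derivative_works)
    then have "has_pd i g (pd i f x) x"
      using has_pd_cong [of m U x i f g, OF U that(2,1)] Suc.prems(1) by auto
    then show ?thesis by (rule has_pd_differentiable)
  qed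
  moreover have "diff_fun N m U (pd i g)" if "i < m" for i
    using Suc.IH [of "pd i f" "pd i g"] Suc.prems that pd_cong [of m U _ i f g, OF U] by auto
  ultimately show ?case by simp
qed

lemma diff_fun_Suc_imp: "diff_fun (Suc N) m U f \<Longrightarrow> diff_fun N m U f"
  by (induction N arbitrary: f) auto

lemma diff_fun_SucI:
  assumes U: "openin (Euclidean_space m) U"
    and "continuous_map (subtopology (Euclidean_space m) U) euclidean f"
    and "\<And>i x. i < m \<Longrightarrow> x \<in> U \<Longrightarrow> has_pd i f (D i x) x"
    and "\<And>i. i < m \<Longrightarrow> diff_fun N m U (D i)"
  shows "diff_fun (Suc N) m U f"
proof -
  have "(\<lambda>t. f (x(i := t))) differentiable (at (x i))" if "i < m" "x \<in> U" for i x
    using assms(3) [OF that] by (rule has_pd_differentiable)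
  moreover have "diff_fun N m U (pd i f)" if "i < m" for i
    using has_pd_imp_pd [OF assms(3)] that by (intro diff_fun_cong [OF U _ assms(4)]) auto
  ultimately show ?thesis using assms(2) by simp
qed

lemma diff_fun_has_pd:
  "diff_fun (Suc N) m U f \<Longrightarrow> i < m \<Longrightarrow> x \<in> U \<Longrightarrow> has_pd i f (pd i f x) x"
  by (simp add: has_pd_def pd_def vector_derivative_works)

lemma diff_fun_const: "openin (Euclidean_space m) U \<Longrightarrow> diff_fun N m U (\<lambda>_. c)"
  by (induction N arbitrary: c)
     (auto intro!: diff_fun_SucI [where D = "\<lambda>_ _. 0"] simp: has_pd_const simp del: diff_fun.simps(2))

lemma continuous_map_Euclidean_subtopology:
  assumes "openin (Euclidean_space m) U"
  shows "continuous_map (subtopology (Euclidean_space m) U) euclidean f \<longleftrightarrow> continuous_on U f"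
proof -
  have "U \<subseteq> {x. \<forall>i\<ge>m. x i = 0}"
    using openin_subset [OF assms] by (simp add: topspace_Euclidean_space)
  then have "subtopology (Euclidean_space m) U = top_of_set U"
    by (simp add: Euclidean_space_def euclidean_product_topology [symmetric] subtopology_subtopology Int_absorb1)
  then show ?thesis by simp
qed

lemma diff_fun_add:
  assumes U: "openin (Euclidean_space m) U"
  shows "diff_fun N m U f \<Longrightarrow> diff_fun N m U g \<Longrightarrow> diff_fun N m U (\<lambda>z. f z + g z)"
proof (induction N arbitrary: f g)
  case (Suc N)
  show ?case
  proof (rule diff_fun_SucI [OF U])
    show "has_pd i (\<lambda>z. f z + g z) (pd i f x + pd i g x) x" if "i < m" "x \<in> U" for i x
      using that Suc.prems by (intro has_pd_add diff_fun_has_pd)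
    show "diff_fun N m U (\<lambda>x. pd i f x + pd i g x)" if "i < m" for i
      using that Suc by auto
  qed (use Suc.prems in \<open>auto simp: continuous_map_Euclidean_subtopology [OF U] intro: continuous_on_add\<close>)
qed (auto simp: continuous_map_Euclidean_subtopology [OF U] intro: continuous_on_add)

lemma diff_fun_mult:
  fixes f g :: "Defs.vec \<Rightarrow> 'b::real_normed_algebra"
  assumes U: "openin (Euclidean_space m) U"
  shows "diff_fun N m U f \<Longrightarrow> diff_fun N m U g \<Longrightarrow> diff_fun N m U (\<lambda>z. f z * g z)"
proof (induction N arbitrary: f g)
  case (Suc N)
  show ?case
  proof (rule diff_fun_SucI [OF U])
    show "has_pd i (\<lambda>z. f z * g z) (f x * pd i g x + pd i f x * g x) x" if "i < m" "x \<in> U" for i x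
      using that Suc.prems by (intro has_pd_mult diff_fun_has_pd)
    show "diff_fun N m U (\<lambda>x. f x * pd i g x + pd i f x * g x)" if "i < m" for i
    proof (intro diff_fun_add [OF U] Suc.IH)
      show "diff_fun N m U f" "diff_fun N m U g"
        using Suc.prems by (blast intro: diff_fun_Suc_imp)+
    qed (use Suc.prems that in auto)
  qed (use Suc.prems in \<open>auto simp: continuous_map_Euclidean_subtopology [OF U] intro: continuous_on_mult\<close>)
qed (auto simp: continuous_map_Euclidean_subtopology [OF U] intro: continuous_on_mult)

lemma smooth_fun_const: "openin (Euclidean_space m) U \<Longrightarrow> smooth_fun m U (\<lambda>_. c)"
  by (simp add: smooth_fun_iff_diff_fun diff_fun_const)

lemma smooth_fun_add:
  "openin (Euclidean_space m) U \<Longrightarrow> smooth_fun m U f \<Longrightarrow> smooth_fun m U g \<Longrightarrow> smooth_fun m U (\<lambda>z. f z + g z)"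
  by (simp add: smooth_fun_iff_diff_fun diff_fun_add)

lemma smooth_fun_mult:
  fixes f g :: "Defs.vec \<Rightarrow> 'b::real_normed_algebra"
  shows "openin (Euclidean_space m) U \<Longrightarrow> smooth_fun m U f \<Longrightarrow> smooth_fun m U g \<Longrightarrow> smooth_fun m U (\<lambda>z. f z * g z)"
  by (simp add: smooth_fun_iff_diff_fun diff_fun_mult)

lemma smooth_fun_cong:
  "openin (Euclidean_space m) U \<Longrightarrow> (\<And>z. z \<in> U \<Longrightarrow> f z = g z) \<Longrightarrow> smooth_fun m U f \<Longrightarrow> smooth_fun m U g"
  unfolding smooth_fun_iff_diff_fun using diff_fun_cong by blast

lemma smooth_fun_sum:
  "openin (Euclidean_space m) U \<Longrightarrow> (\<And>a. a \<in> A \<Longrightarrow> smooth_fun m U (f a)) \<Longrightarrow> smooth_fun m U (\<lambda>z. \<Sum>a\<in>A. f a z)"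
  by (induction A rule: infinite_finite_induct) (auto intro: smooth_fun_const smooth_fun_add)

subsection \<open>Families of elements of the Weyl algebra\<close>

definition wsmooth :: "nat \<Rightarrow> Defs.vec set \<Rightarrow> (Defs.vec \<Rightarrow> wfps) \<Rightarrow> bool" where
  "wsmooth m U F \<longleftrightarrow> (\<forall>k \<alpha>. smooth_fun m U (\<lambda>z. wcoeff (F z) k \<alpha>))"

definition has_wpd :: "nat \<Rightarrow> (Defs.vec \<Rightarrow> wfps) \<Rightarrow> wfps \<Rightarrow> Defs.vec \<Rightarrow> bool" where
  "has_wpd i F D x \<longleftrightarrow> (\<forall>k \<alpha>. has_pd i (\<lambda>z. wcoeff (F z) k \<alpha>) (wcoeff D k \<alpha>) x)"

lemma wcoeff_wconst_mult_sum:
  "wcoeff (\<Sum>i\<in>A. \<Sum>j\<in>B. wconst (c i j) * F i j) k \<alpha> = (\<Sum>i\<in>A. \<Sum>j\<in>B. c i j * wcoeff (F i j) k \<alpha>)"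
  by (simp add: wcoeff_sum)

text \<open>Every coefficient of the product is a finite sum of products of coefficients of the
  factors, so no limit is involved. The same observation gives the Leibniz rule in
  \<open>has_wpd_star\<close> for derivatives in the base point, as opposed to the fibre derivatives
  \<open>wderiv\<close>.\<close>

lemma wsmooth_star:
  assumes U: "openin (Euclidean_space m) U" and "wsmooth m U F" "wsmooth m U G"
  shows "wsmooth m U (\<lambda>z. weyl.star n (F z) (G z))"
proof -
  have "wsmooth m U (\<lambda>z. weyl.P n s (F z) (G z))" for s
    using assms(2,3)
  proof (induction s arbitrary: F G)
    case 0
    then show ?case
      unfolding wsmooth_def by (auto simp: wcoeff_mult intro!: smooth_fun_sum smooth_fun_mult U)
  next
    case (Suc s)
    have "wsmooth m U (\<lambda>z. wderiv i (F z))" if "wsmooth m U F" for i F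
      using that unfolding wsmooth_def by (auto intro!: smooth_fun_mult smooth_fun_const U)
    then have "wsmooth m U (\<lambda>z. weyl.P n s (wderiv i (F z)) (wderiv j (G z)))" for i j
      using Suc by blast
    then show ?case
      unfolding wsmooth_def
      by (auto simp: wbivec_def wcoeff_wconst_mult_sum intro!: smooth_fun_sum smooth_fun_mult smooth_fun_const U)
  qed
  then have "smooth_fun m U (\<lambda>z. \<Sum>s\<le>k. c s * wcoeff (weyl.P n s (F z) (G z)) (k - s) \<alpha>)" for c k \<alpha>
    unfolding wsmooth_def by (intro smooth_fun_sum smooth_fun_mult smooth_fun_const U) auto
  from this [where c = "\<lambda>s. (- \<i>) ^ s / fact s"] show ?thesis
    by (simp add: wsmooth_def weyl.star_def wcoeff_series moyal_coeff_def)
qed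

lemma has_wpd_star:
  assumes "has_wpd i F D x" "has_wpd i G E x"
  shows "has_wpd i (\<lambda>z. weyl.star n (F z) (G z)) (weyl.star n D (G x) + weyl.star n (F x) E) x"
proof -
  have P: "has_wpd i (\<lambda>z. weyl.P n s (F z) (G z)) (weyl.P n s D (G x) + weyl.P n s (F x) E) x" for s
    using assms
  proof (induction s arbitrary: F G D E)
    case 0
    show ?case
      unfolding has_wpd_def
    proof (intro allI)
      fix k \<alpha>
      have "has_pd i (\<lambda>z. \<Sum>p\<le>k. \<Sum>\<beta> | \<beta> \<subseteq># \<alpha>. wcoeff (F z) p \<beta> * wcoeff (G z) (k - p) (\<alpha> - \<beta>))
        (\<Sum>p\<le>k. \<Sum>\<beta> | \<beta> \<subseteq># \<alpha>. wcoeff (F x) p \<beta> * wcoeff E (k - p) (\<alpha> - \<beta>) +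
           wcoeff D p \<beta> * wcoeff (G x) (k - p) (\<alpha> - \<beta>)) x"
        using 0 by (intro has_pd_sum has_pd_mult) (auto simp: has_wpd_def)
      then show "has_pd i (\<lambda>z. wcoeff (weyl.P n 0 (F z) (G z)) k \<alpha>)
          (wcoeff (weyl.P n 0 D (G x) + weyl.P n 0 (F x) E) k \<alpha>) x"
        by (simp add: wcoeff_mult sum.distrib add.commute)
    qed
  next
    case (Suc s)
    have d: "has_wpd i (\<lambda>z. wderiv j (F z)) (wderiv j D) x" if "has_wpd i F D x" for j F D
      unfolding has_wpd_def wcoeff_simps
    proof (intro allI)
      fix k \<alpha>
      show "has_pd i (\<lambda>z. of_nat (count \<alpha> j + 1) * wcoeff (F z) k (add_mset j \<alpha>))
          (of_nat (count \<alpha> j + 1) * wcoeff D k (add_mset j \<alpha>)) x"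
        using has_pd_mult [OF has_pd_const, of i _ _ x] that by (fastforce simp: has_wpd_def)
    qed
    have IH: "has_wpd i (\<lambda>z. weyl.P n s (wderiv p (F z)) (wderiv q (G z)))
        (weyl.P n s (wderiv p D) (wderiv q (G x)) + weyl.P n s (wderiv p (F x)) (wderiv q E)) x" for p q
      by (intro Suc.IH d Suc.prems)
    show ?case
      unfolding has_wpd_def
    proof (intro allI)
      fix k \<alpha>
      \<comment> \<open>The terms with factor 0 are the derivatives of the constant coefficients, in
        the shape in which \<open>has_pd_mult\<close> produces them.\<close>
      have "has_pd i (\<lambda>z. \<Sum>p<2*n. \<Sum>q<2*n. of_real (bivec n p q) * wcoeff (weyl.P n s (wderiv p (F z)) (wderiv q (G z))) k \<alpha>)
         (\<Sum>p<2*n. \<Sum>q<2*n. of_real (bivec n p q) * wcoeff (weyl.P n s (wderiv p D) (wderiv q (G x)) +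
            weyl.P n s (wderiv p (F x)) (wderiv q E)) k \<alpha> + 0 * wcoeff (weyl.P n s (wderiv p (F x)) (wderiv q (G x))) k \<alpha>) x"
        using IH by (intro has_pd_sum has_pd_mult has_pd_const) (auto simp: has_wpd_def)
      then show "has_pd i (\<lambda>z. wcoeff (weyl.P n (Suc s) (F z) (G z)) k \<alpha>)
          (wcoeff (weyl.P n (Suc s) D (G x) + weyl.P n (Suc s) (F x) E) k \<alpha>) x"
        by (simp add: wbivec_def wcoeff_sum sum.distrib distrib_left)
    qed
  qed
  show ?thesis
    unfolding has_wpd_def
  proof (intro allI)
    fix k \<alpha>
    have "has_pd i (\<lambda>z. \<Sum>s\<le>k. (- \<i>) ^ s / fact s * wcoeff (weyl.P n s (F z) (G z)) (k - s) \<alpha>)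
       (\<Sum>s\<le>k. (- \<i>) ^ s / fact s * wcoeff (weyl.P n s D (G x) + weyl.P n s (F x) E) (k - s) \<alpha> +
          0 * wcoeff (weyl.P n s (F x) (G x)) (k - s) \<alpha>) x"
      using P by (intro has_pd_sum has_pd_mult has_pd_const) (auto simp: has_wpd_def)
    then show "has_pd i (\<lambda>z. wcoeff (weyl.star n (F z) (G z)) k \<alpha>)
        (wcoeff (weyl.star n D (G x) + weyl.star n (F x) E) k \<alpha>) x"
      by (simp add: weyl.star_def wcoeff_series moyal_coeff_def sum.distrib distrib_left)
  qed
qed

definition wsupp :: "nat \<Rightarrow> wfps \<Rightarrow> bool" where
  "wsupp m F \<longleftrightarrow> (\<forall>k \<alpha>. \<not> set_mset \<alpha> \<subseteq> {..<m} \<longrightarrow> wcoeff F k \<alpha> = 0)"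

lemma wsupp_mult: "wsupp m F \<Longrightarrow> wsupp m G \<Longrightarrow> wsupp m (F * G)"
  unfolding wsupp_def
proof (intro allI impI)
  fix k and \<alpha> :: "nat multiset"
  assume FG: "\<forall>k \<alpha>. \<not> set_mset \<alpha> \<subseteq> {..<m} \<longrightarrow> wcoeff F k \<alpha> = 0"
      "\<forall>k \<alpha>. \<not> set_mset \<alpha> \<subseteq> {..<m} \<longrightarrow> wcoeff G k \<alpha> = 0"
    and \<alpha>: "\<not> set_mset \<alpha> \<subseteq> {..<m}"
  show "wcoeff (F * G) k \<alpha> = 0"
    unfolding wcoeff_mult
  proof (intro sum.neutral ballI)
    fix p \<beta> assume "\<beta> \<in> {\<beta>. \<beta> \<subseteq># \<alpha>}"
    then have "set_mset \<alpha> = set_mset \<beta> \<union> set_mset (\<alpha> - \<beta>)"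
      by (metis mem_Collect_eq set_mset_union subset_mset.add_diff_inverse)
    with \<alpha> have "\<not> set_mset \<beta> \<subseteq> {..<m} \<or> \<not> set_mset (\<alpha> - \<beta>) \<subseteq> {..<m}" by simp
    then have "wcoeff F p \<beta> = 0 \<or> wcoeff G (k - p) (\<alpha> - \<beta>) = 0" using FG by blast
    then show "wcoeff F p \<beta> * wcoeff G (k - p) (\<alpha> - \<beta>) = 0" by auto
  qed
qed

lemma wsupp_star:
  assumes "wsupp m F" "wsupp m G"
  shows "wsupp m (weyl.star n F G)"
proof -
  have "wsupp m (weyl.P n s F G)" for s
    using assms
  proof (induction s arbitrary: F G)
    case (Suc s)
    have "wsupp m (wderiv i F)" if "wsupp m F" for i F
      using that by (auto simp: wsupp_def)
    then have "wsupp m (weyl.P n s (wderiv i F) (wderiv j G))" for i j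
      using Suc by blast
    then show ?case unfolding weyl.P.simps by (simp add: wsupp_def wbivec_def wcoeff_sum)
  qed (simp add: wsupp_mult)
  then show ?thesis
    by (simp add: wsupp_def weyl.star_def wcoeff_series moyal_coeff_def)
qed

section \<open>Functions and sections on an orbispace\<close>

lemma objs_cover:
  assumes "is_orbispace X" "x \<in> topspace (otop X)"
  obtains U where "U \<in> objs X" "x \<in> U"
proof -
  obtain V where V: "V \<in> ocover X" "x \<in> V"
  proof -
    have "x \<in> \<Union> (ocover X)" using assms by (simp add: is_orbispace_def)
    then show ?thesis using that by blast
  qed
  let ?U = "connected_component_of_set (subtopology (otop X) (\<Inter>{V})) x"
  have x: "x \<in> topspace (subtopology (otop X) (\<Inter>{V}))" using assms V by simp
  then have "?U \<in> connected_components_of (subtopology (otop X) (\<Inter>{V}))"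
    by (auto simp: connected_components_of_def)
  then have "?U \<in> objs X"
    unfolding objs_def using V by (intro UN_I [of "{V}"]) auto
  moreover have "x \<in> ?U" using x by (simp add: connected_component_of_refl)
  ultimately show thesis by (rule that)
qed

text \<open>The component of x in the intersection of all covering sets behind U and V is connected
  and meets both U and V; by maximality of components it lies in both.\<close>

lemma objs_refine:
  assumes U: "U \<in> objs X" and V: "V \<in> objs X" and x: "x \<in> U" "x \<in> V"
  obtains W where "W \<in> objs X" "x \<in> W" "W \<subseteq> U" "W \<subseteq> V"
proof -
  obtain F where F: "finite F" "F \<noteq> {}" "F \<subseteq> ocover X"
      "U \<in> connected_components_of (subtopology (otop X) (\<Inter>F))"
    using U by (auto simp: objs_def)
  obtain G where G: "finite G" "G \<noteq> {}" "G \<subseteq> ocover X"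
      "V \<in> connected_components_of (subtopology (otop X) (\<Inter>G))"
    using V by (auto simp: objs_def)
  let ?T = "subtopology (otop X) (\<Inter>(F \<union> G))"
  let ?W = "connected_component_of_set ?T x"
  have "U \<subseteq> topspace (subtopology (otop X) (\<Inter>F))" "V \<subseteq> topspace (subtopology (otop X) (\<Inter>G))"
    using F(4) G(4) connected_components_of_subset by blast+
  then have xT: "x \<in> topspace ?T" using x by auto
  have "?W \<in> connected_components_of ?T"
    using xT by (auto simp: connected_components_of_def)
  then have "?W \<in> objs X"
    unfolding objs_def using F G by (intro UN_I [of "F \<union> G"]) auto
  moreover have xW: "x \<in> ?W" using xT by (simp add: connected_component_of_refl)
  moreover have W: "connectedin (otop X) ?W" "?W \<subseteq> \<Inter>(F \<union> G)"
    using connectedin_connected_component_of [of ?T x] by (auto simp: connectedin_subtopology)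
  have "?W \<subseteq> U"
    by (rule connected_components_of_maximal [OF F(4)]) (use W xW x in \<open>auto simp: connectedin_subtopology disjnt_iff\<close>)
  moreover have "?W \<subseteq> V"
    by (rule connected_components_of_maximal [OF G(4)]) (use W xW x in \<open>auto simp: connectedin_subtopology disjnt_iff\<close>)
  ultimately show thesis by (rule that)
qed

text \<open>The chart map factors through an injective map on the orbit space, so each of its fibres
  is a single orbit.\<close>

lemma crho_eq_imp_orbit:
  assumes c: "orbispace_chart T c" and u: "u \<in> cdom c" and v: "v \<in> cdom c" and eq: "crho c u = crho c v"
  shows "\<exists>g\<in>carrier (cgrp c). v = cact c g u"
proof -
  obtain h where h: "homeomorphic_map (orbit_space c) (subtopology T (crho c ` cdom c)) h"
      "\<forall>x\<in>cdom c. h (orbit c x) = crho c x"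
    using c unfolding orbispace_chart_def by blast
  \<comment> \<open>Injectivity of h is known only on the underlying set of the quotient topology.
    That every orbit belongs to it is seen from the set of all orbits being open.\<close>
  have "openin (orbit_space c) (orbit c ` cdom c)"
  proof -
    have "{x \<in> cdom c. orbit c x \<in> orbit c ` cdom c} = cdom c" by auto
    then show ?thesis
      using c unfolding orbit_space_def topology_inverse' [OF istopology_orbit_space]
      by (simp add: orbispace_chart_def)
  qed
  then have "orbit c ` cdom c \<subseteq> topspace (orbit_space c)" by (rule openin_subset)
  moreover have "inj_on h (topspace (orbit_space c))"
    using h(1) by (simp add: homeomorphic_eq_everything_map)
  moreover have "h (orbit c u) = h (orbit c v)"
    using u v eq h(2) by simp
  ultimately have "orbit c u = orbit c v"
    using u v by (auto dest: inj_onD)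
  moreover have "v \<in> orbit c v"
  proof -
    have "\<one>\<^bsub>cgrp c\<^esub> \<in> carrier (cgrp c)"
      using c by (auto simp: orbispace_chart_def compact_lie_group_def lie_group_def intro: group.is_monoid monoid.one_closed)
    moreover have "cact c \<one>\<^bsub>cgrp c\<^esub> v = v"
      using c v by (simp add: orbispace_chart_def smooth_action_def)
    ultimately show ?thesis unfolding orbit_def by (metis image_eqI)
  qed
  ultimately show ?thesis by (auto simp: orbit_def)
qed

section \<open>Charts and embeddings of a symplectic orbispace\<close>

locale symplectic_orbi =
  fixes X :: "('g, 'x) orbispace"
  assumes symplectic: "symplectic_orbispace X"
begin

lemma orbispace: "is_orbispace X"
  using symplectic by (simp add: symplectic_orbispace_def)

abbreviation dm :: "'x set \<Rightarrow> nat" where "dm U \<equiv> 2 * hdim X U"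
abbreviation dom :: "'x set \<Rightarrow> Defs.vec set" where "dom U \<equiv> cdom (ochart X U)"
abbreviation rho :: "'x set \<Rightarrow> Defs.vec \<Rightarrow> 'x" where "rho U \<equiv> crho (ochart X U)"
abbreviation grp :: "'x set \<Rightarrow> 'g set" where "grp U \<equiv> carrier (cgrp (ochart X U))"
abbreviation act :: "'x set \<Rightarrow> 'g \<Rightarrow> Defs.vec \<Rightarrow> Defs.vec" where "act U \<equiv> cact (ochart X U)"

lemma cdim_eq: "U \<in> objs X \<Longrightarrow> cdim (ochart X U) = dm U"
  using symplectic by (simp add: symplectic_orbispace_def)

lemma chart: "U \<in> objs X \<Longrightarrow> orbispace_chart (otop X) (ochart X U)"
  using orbispace by (simp add: is_orbispace_def)

lemma open_dom: "U \<in> objs X \<Longrightarrow> openin (Euclidean_space (dm U)) (dom U)"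
  using chart [of U] cdim_eq [of U] by (simp add: orbispace_chart_def)

lemma rho_image: "U \<in> objs X \<Longrightarrow> rho U ` dom U = U"
  using orbispace by (simp add: is_orbispace_def)

lemma rho_in_topspace: "U \<in> objs X \<Longrightarrow> u \<in> dom U \<Longrightarrow> rho U u \<in> topspace (otop X)"
  using chart [of U] openin_subset unfolding orbispace_chart_def by blast

lemma act_dom: "U \<in> objs X \<Longrightarrow> g \<in> grp U \<Longrightarrow> u \<in> dom U \<Longrightarrow> act U g u \<in> dom U"
  using chart [of U] by (simp add: orbispace_chart_def smooth_action_def)

lemma embedding:
  "U \<in> objs X \<Longrightarrow> V \<in> objs X \<Longrightarrow> V \<subseteq> U \<Longrightarrow>
    chart_embedding (ochart X V) (ochart X U) (ophi X V U) (oiota X V U)"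
  using orbispace by (simp add: is_orbispace_def)

lemma hdim_embedding: "U \<in> objs X \<Longrightarrow> V \<in> objs X \<Longrightarrow> V \<subseteq> U \<Longrightarrow> hdim X V = hdim X U"
  using embedding [of U V] by (simp add: chart_embedding_def hdim_def)

lemma ophi_dom: "U \<in> objs X \<Longrightarrow> V \<in> objs X \<Longrightarrow> V \<subseteq> U \<Longrightarrow> v \<in> dom V \<Longrightarrow> ophi X V U v \<in> dom U"
  using embedding [of U V] by (auto simp: chart_embedding_def)

lemma rho_ophi: "U \<in> objs X \<Longrightarrow> V \<in> objs X \<Longrightarrow> V \<subseteq> U \<Longrightarrow> v \<in> dom V \<Longrightarrow> rho U (ophi X V U v) = rho V v"
  using embedding [of U V] by (simp add: chart_embedding_def)

lemma point_in_chart: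
  assumes "x \<in> topspace (otop X)"
  obtains U u where "U \<in> objs X" "u \<in> dom U" "x = rho U u"
  using objs_cover [OF orbispace assms] rho_image by (metis imageE)

lemma function_eqI:
  assumes "\<And>x. x \<notin> topspace (otop X) \<Longrightarrow> f x = g x"
    and "\<And>U u. U \<in> objs X \<Longrightarrow> u \<in> dom U \<Longrightarrow> f (rho U u) = g (rho U u)"
  shows "f = g"
  using assms point_in_chart by (metis ext)

lemma symplectic_jac_ophi:
  "U \<in> objs X \<Longrightarrow> V \<in> objs X \<Longrightarrow> V \<subseteq> U \<Longrightarrow> v \<in> dom V \<Longrightarrow>
    symplectic_matrix (hdim X U) (jac (ophi X V U) v)"
  using symplectic hdim_embedding [of U V]
  by (simp add: symplectic_orbispace_def symplectic_matrix_def)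

text \<open>The action is known to be linear only on the domain. As the domain is open, its Jacobian
  there is still the symplectic matrix A, as far as indices below the dimension are
  concerned.\<close>

lemma symplectic_jac_act:
  assumes U: "U \<in> objs X" and g: "g \<in> grp U" and u: "u \<in> dom U"
  shows "symplectic_matrix (hdim X U) (jac (act U g) u)"
proof -
  obtain A :: "nat \<Rightarrow> nat \<Rightarrow> real" where
    A: "\<And>x i. x \<in> dom U \<Longrightarrow> i < dm U \<Longrightarrow> act U g x i = (\<Sum>j<dm U. A i j * x j)" and
    sA: "symplectic_matrix (hdim X U) A"
  proof -
    have "\<exists>A :: nat \<Rightarrow> nat \<Rightarrow> real. (\<forall>x\<in>dom U. \<forall>i<dm U. act U g x i = (\<Sum>j<dm U. A i j * x j)) \<and>
        symplectic_matrix (hdim X U) A"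
      using symplectic U g by (simp add: symplectic_orbispace_def symplectic_matrix_def)
    then show ?thesis using that by blast
  qed
  have "jac (act U g) u i j = A i j" if i: "i < dm U" and j: "j < dm U" for i j
  proof -
    have "has_pd j (\<lambda>z. z k) (if k = j then 1 else 0) u" for k
      by (auto simp: has_pd_def)
    then have "has_pd j (\<lambda>z. \<Sum>k<dm U. A i k * z k) (\<Sum>k<dm U. A i k * (if k = j then 1 else 0) + 0 * u k) u"
      by (intro has_pd_sum has_pd_mult has_pd_const)
    also have "(\<Sum>k<dm U. A i k * (if k = j then 1 else 0) + 0 * u k) = A i j"
    proof -
      have "(\<Sum>k<dm U. A i k * (if k = j then 1 else 0) + 0 * u k) = (\<Sum>k<dm U. if k = j then A i j else 0)"
        by (intro sum.cong) auto
      then show ?thesis using j by simp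
    qed
    finally have "pd j (\<lambda>z. \<Sum>k<dm U. A i k * z k) u = A i j"
      by (rule has_pd_imp_pd)
    then show ?thesis
      unfolding jac_def using pd_cong [OF open_dom [OF U] u j, of "\<lambda>z. act U g z i"] A i by auto
  qed
  then show ?thesis
    using sA by (simp add: symplectic_matrix_def omega_form_def)
qed

section \<open>Functions on the orbispace from their lifts to the charts\<close>

definition chartwise_consistent :: "('x set \<Rightarrow> Defs.vec \<Rightarrow> complex) \<Rightarrow> bool" where
  "chartwise_consistent F \<longleftrightarrow> (\<forall>U\<in>objs X. \<forall>V\<in>objs X. \<forall>u\<in>dom U. \<forall>v\<in>dom V. rho U u = rho V v \<longrightarrow> F U u = F V v)"

text \<open>Two preimages of a point are compared through a third chart W below both. The embeddings
  carry a preimage in W into U and V, where it differs from the given points only by group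
  elements.\<close>

lemma chartwise_consistentI:
  assumes act: "\<And>U g u. U \<in> objs X \<Longrightarrow> g \<in> grp U \<Longrightarrow> u \<in> dom U \<Longrightarrow> F U (act U g u) = F U u"
    and phi: "\<And>U V v. U \<in> objs X \<Longrightarrow> V \<in> objs X \<Longrightarrow> V \<subseteq> U \<Longrightarrow> v \<in> dom V \<Longrightarrow> F U (ophi X V U v) = F V v"
  shows "chartwise_consistent F"
  unfolding chartwise_consistent_def
proof (intro ballI impI)
  fix U V u v
  assume U: "U \<in> objs X" and V: "V \<in> objs X" and u: "u \<in> dom U" and v: "v \<in> dom V" and eq: "rho U u = rho V v"
  have x: "rho U u \<in> U" "rho U u \<in> V" using rho_image U V u v eq by force+
  obtain W where W: "W \<in> objs X" "rho U u \<in> W" "W \<subseteq> U" "W \<subseteq> V"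
    by (rule objs_refine [OF U V x])
  obtain w where w: "w \<in> dom W" "rho U u = rho W w" using W rho_image by (metis imageE)
  have same: "F U' (ophi X W U' w) = F U' u'"
    if "U' \<in> objs X" "u' \<in> dom U'" "rho U' u' = rho W w" "W \<subseteq> U'" for U' u'
  proof -
    note orbit = crho_eq_imp_orbit [OF chart [OF that(1)] that(2) ophi_dom [OF that(1) W(1) that(4) w(1)]]
    have "rho U' u' = rho U' (ophi X W U' w)"
      using rho_ophi [OF that(1) W(1) that(4) w(1)] that(3) by simp
    then obtain g where "g \<in> grp U'" "ophi X W U' w = act U' g u'"
      using orbit by blast
    then show ?thesis using act [OF that(1) _ that(2)] by simp
  qed
  have eq': "rho V v = rho W w" using eq w(2) by simp
  show "F U u = F V v"
    using same [OF U u w(2) W(3)] same [OF V v eq' W(4)] phi [OF U W(1) W(3) w(1)] phi [OF V W(1) W(4) w(1)]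
    by simp
qed

lemma descend_eq:
  assumes F: "chartwise_consistent F" and U: "U \<in> objs X" and u: "u \<in> dom U"
  shows "descend X F (rho U u) = F U u"
proof -
  have "(THE z. \<exists>V\<in>objs X. \<exists>v\<in>dom V. rho V v = rho U u \<and> z = F V v) = F U u"
  proof (rule the_equality)
    show "\<exists>V\<in>objs X. \<exists>v\<in>dom V. rho V v = rho U u \<and> F U u = F V v"
      using U u by blast
    show "z = F U u" if "\<exists>V\<in>objs X. \<exists>v\<in>dom V. rho V v = rho U u \<and> z = F V v" for z
      using that F U u unfolding chartwise_consistent_def by metis
  qed
  then show ?thesis using rho_in_topspace [OF U u] by (simp add: descend_def)
qed

lemma descend_outside: "x \<notin> topspace (otop X) \<Longrightarrow> descend X F x = 0"
  by (simp add: descend_def)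

section \<open>Stratified sections of form degree 0 and 1\<close>

lemma str_forms_outside:
  assumes "b \<in> str_forms X l" "\<not> (U \<in> objs X \<and> z \<in> dom U)"
  shows "b U z = 0"
proof -
  have "b \<in> str_sections X" using assms(1) by (simp add: str_forms_def)
  then have "\<forall>U z. \<not> (U \<in> objs X \<and> z \<in> dom U) \<longrightarrow> b U z = 0"
    unfolding str_sections_def mem_Collect_eq by (rule conjunct1)
  then show ?thesis using assms(2) by (elim allE impE)
qed

lemma str_forms_zero_form:
  assumes "b \<in> str_forms X 0"
  shows "zero_form (b U z)"
  unfolding zero_form_def
proof (intro allI impI)
  fix k \<alpha> and J :: "nat set" assume J: "J \<noteq> {}"
  show "b U z k \<alpha> J = 0"
  proof (rule ccontr)
    assume b: "b U z k \<alpha> J \<noteq> 0"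
    have Uz: "U \<in> objs X \<and> z \<in> dom U"
    proof (rule ccontr)
      assume "\<not> (U \<in> objs X \<and> z \<in> dom U)"
      then have "b U z = 0" by (rule str_forms_outside [OF assms])
      with b show False by simp
    qed
    \<comment> \<open>The bound on J is needed because \<open>card\<close> of an infinite set is 0
      as well.\<close>
    then have "b U z \<in> welems (hdim X U)"
      using assms by (simp add: str_forms_def str_sections_def)
    then have "J \<subseteq> {..<dm U}" using b by (simp add: welems_def)
    then have "finite J" by (rule finite_subset) simp
    moreover have "card J = 0" using b assms by (simp add: str_forms_def)
    ultimately show False using J by simp
  qed
qed

lemma str_forms_one_form:
  assumes "b \<in> str_forms X 1"
  shows "one_form (hdim X U) (b U z)"
  unfolding one_form_def
proof (intro allI impI)
  fix k \<alpha> and J :: "nat set" assume J: "\<forall>j<dm U. J \<noteq> {j}"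
  show "b U z k \<alpha> J = 0"
  proof (rule ccontr)
    assume b: "b U z k \<alpha> J \<noteq> 0"
    have Uz: "U \<in> objs X \<and> z \<in> dom U"
    proof (rule ccontr)
      assume "\<not> (U \<in> objs X \<and> z \<in> dom U)"
      then have "b U z = 0" by (rule str_forms_outside [OF assms])
      with b show False by simp
    qed
    then have "b U z \<in> welems (hdim X U)"
      using assms by (simp add: str_forms_def str_sections_def)
    then have "J \<subseteq> {..<dm U}" using b by (simp add: welems_def)
    moreover have "card J = 1" using b assms by (simp add: str_forms_def)
    ultimately show False using J by (auto simp: card_1_singleton_iff)
  qed
qed

definition vanishes_outside :: "'x wsection \<Rightarrow> bool" where
  "vanishes_outside b \<longleftrightarrow> (\<forall>U z. \<not> (U \<in> objs X \<and> z \<in> dom U) \<longrightarrow> b U z = 0)"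

text \<open>Rephrases membership in terms of the power series \<open>body {}\<close>, for which
  smoothness, support and pullback of Moyal products have been established.\<close>

lemma str_forms_0_iff:
  "b \<in> str_forms X 0 \<longleftrightarrow> vanishes_outside b \<and> (\<forall>U z. zero_form (b U z)) \<and>
     (\<forall>U\<in>objs X. (\<forall>z\<in>dom U. wsupp (dm U) (body {} (b U z))) \<and> wsmooth (dm U) (dom U) (\<lambda>z. body {} (b U z)) \<and>
        (\<forall>g\<in>grp U. \<forall>z\<in>dom U. wpull (dm U) (dm U) (jac (act U g) z) (b U (act U g z)) = b U z)) \<and>
     (\<forall>U\<in>objs X. \<forall>V\<in>objs X. V \<subseteq> U \<longrightarrow>
        (\<forall>y\<in>dom V. wpull (dm V) (dm U) (jac (ophi X V U) y) (b U (ophi X V U y)) = b V y))"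
proof
  assume b: "b \<in> str_forms X 0"
  show "vanishes_outside b \<and> (\<forall>U z. zero_form (b U z)) \<and>
     (\<forall>U\<in>objs X. (\<forall>z\<in>dom U. wsupp (dm U) (body {} (b U z))) \<and> wsmooth (dm U) (dom U) (\<lambda>z. body {} (b U z)) \<and>
        (\<forall>g\<in>grp U. \<forall>z\<in>dom U. wpull (dm U) (dm U) (jac (act U g) z) (b U (act U g z)) = b U z)) \<and>
     (\<forall>U\<in>objs X. \<forall>V\<in>objs X. V \<subseteq> U \<longrightarrow>
        (\<forall>y\<in>dom V. wpull (dm V) (dm U) (jac (ophi X V U) y) (b U (ophi X V U y)) = b V y))"
  proof (intro conjI)
    have b': "b \<in> str_sections X" using b by (simp add: str_forms_def)
    show "\<forall>U z. zero_form (b U z)"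
      using str_forms_zero_form [OF b] by blast
    show "vanishes_outside b"
      using b' by (simp add: str_sections_def vanishes_outside_def)
    have "wsupp (dm U) (body {} (b U z))" if "U \<in> objs X" "z \<in> dom U" for U z
    proof -
      have "b U z \<in> welems (hdim X U)" using b' that by (simp add: str_sections_def)
      then show ?thesis unfolding welems_def wsupp_def wcoeff_body by blast
    qed
    then show "\<forall>U\<in>objs X. (\<forall>z\<in>dom U. wsupp (dm U) (body {} (b U z))) \<and>
        wsmooth (dm U) (dom U) (\<lambda>z. body {} (b U z)) \<and>
        (\<forall>g\<in>grp U. \<forall>z\<in>dom U. wpull (dm U) (dm U) (jac (act U g) z) (b U (act U g z)) = b U z)"
      using b' by (simp add: str_sections_def wsmooth_def)
    show "\<forall>U\<in>objs X. \<forall>V\<in>objs X. V \<subseteq> U \<longrightarrow>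
        (\<forall>y\<in>dom V. wpull (dm V) (dm U) (jac (ophi X V U) y) (b U (ophi X V U y)) = b V y)"
      using b' by (simp add: str_sections_def)
  qed
next
  assume b: "vanishes_outside b \<and> (\<forall>U z. zero_form (b U z)) \<and>
     (\<forall>U\<in>objs X. (\<forall>z\<in>dom U. wsupp (dm U) (body {} (b U z))) \<and> wsmooth (dm U) (dom U) (\<lambda>z. body {} (b U z)) \<and>
        (\<forall>g\<in>grp U. \<forall>z\<in>dom U. wpull (dm U) (dm U) (jac (act U g) z) (b U (act U g z)) = b U z)) \<and>
     (\<forall>U\<in>objs X. \<forall>V\<in>objs X. V \<subseteq> U \<longrightarrow>
        (\<forall>y\<in>dom V. wpull (dm V) (dm U) (jac (ophi X V U) y) (b U (ophi X V U y)) = b V y))"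
  note zf = b [THEN conjunct2, THEN conjunct1, rule_format]
    and loc = b [THEN conjunct2, THEN conjunct2, THEN conjunct1, rule_format]
  have J: "b U z k \<alpha> J \<noteq> 0 \<Longrightarrow> J = {}" for U z k \<alpha> J
    using zero_formD [OF zf] by metis
  have "b U z \<in> welems (hdim X U)" if "U \<in> objs X" "z \<in> dom U" for U z
    unfolding welems_def
  proof (intro CollectI allI impI)
    fix k \<alpha> J assume nz: "b U z k \<alpha> J \<noteq> 0"
    then have "J = {}" by (rule J)
    moreover have "wsupp (dm U) (body {} (b U z))" using loc [OF that(1)] that(2) by simp
    ultimately show "set_mset \<alpha> \<subseteq> {..<dm U} \<and> J \<subseteq> {..<dm U}"
      using nz unfolding wsupp_def by (metis empty_subsetI wcoeff_body)
  qed
  moreover have "smooth_fun (dm U) (dom U) (\<lambda>z. b U z k \<alpha> J)" if "U \<in> objs X" for U k \<alpha> J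
  proof (cases "J = {}")
    case True
    have "wsmooth (dm U) (dom U) (\<lambda>z. body {} (b U z))" using loc [OF that] by simp
    with True show ?thesis by (simp add: wsmooth_def)
  next
    case False
    then have "b U z k \<alpha> J = 0" for z using zero_formD [OF zf] by simp
    then show ?thesis by (simp add: smooth_fun_const open_dom that)
  qed
  moreover have "\<forall>U z k \<alpha> J. b U z k \<alpha> J \<noteq> 0 \<longrightarrow> card J = 0"
    using J by (metis card.empty)
  ultimately show "b \<in> str_forms X 0"
    using b unfolding str_forms_def str_sections_def vanishes_outside_def by simp
qed

end

section \<open>The Fedosov connection on sections of form degree zero\<close>

definition wshift :: "welem \<Rightarrow> welem" where
  "wshift a = (\<lambda>k \<alpha> J. if k = 0 then 0 else a (k - 1) \<alpha> J)"

lemma wcoeff_X_mult: "wcoeff (fps_X * F) k \<alpha> = (if k = 0 then 0 else wcoeff F (k - 1) \<alpha>)"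
  by (simp add: wcoeff_def fps_X_mult_nth)

lemma body_wshift: "body J (wshift a) = fps_X * body J a"
  by (rule wfps_eqI) (simp add: wcoeff_X_mult wshift_def)

lemma wpull_add: "wpull m m' A (a + b) = wpull m m' A a + wpull m m' A b"
  by (simp add: wpull_def fun_eq_iff distrib_right sum.distrib)

lemma wpull_wshift: "wpull m m' A (wshift a) = wshift (wpull m m' A a)"
  by (auto simp: wpull_def wshift_def fun_eq_iff)

text \<open>A linear substitution preserves degrees and fixes constants. Hence the symbol of a
  section takes the same value in all charts and descends to X.\<close>

lemma wpull_coeff_0:
  assumes "zero_form b"
  shows "wpull m m' A b k {#} {} = b k {#} {}"
proof -
  have "monomials_of_degree m' 0 = {{#}}" by (auto simp: monomials_of_degree_def)
  then have "wcoeff (fps_map (mps_subst m m' A) (body {} b)) k {#} = wcoeff (body {} b) k {#}"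
    by (simp add: wcoeff_def mps_coeff_subst mps_monom_def mps_coeff_1)
  then show ?thesis
    by (simp add: wpull_zero_form(2) [OF assms, symmetric])
qed

lemma zero_form_add: "zero_form a \<Longrightarrow> zero_form b \<Longrightarrow> zero_form (a + b)"
  by (simp add: zero_form_def)

lemma zero_form_wshift: "zero_form a \<Longrightarrow> zero_form (wshift a)"
  by (simp add: zero_form_def wshift_def)

lemma zero_form_wone: "zero_form wone"
  by (simp add: zero_form_def wone_def)

lemma zero_form_0 [simp]: "zero_form 0"
  by (simp add: zero_form_def)

lemma pd_const [simp]: "pd i (\<lambda>_. c) x = 0"
  by (rule has_pd_imp_pd [OF has_pd_const])

lemma zero_form_wpd: "(\<And>z. zero_form (b z)) \<Longrightarrow> zero_form (wpd j b z)"
  by (simp add: zero_form_def wpd_def)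

lemma zero_form_cov_deriv:
  assumes "\<And>z. zero_form (b z)"
  shows "zero_form (cov_deriv n nab j b z)"
  unfolding zero_form_def
proof (intro allI impI)
  fix k \<alpha> and J :: "nat set" assume "J \<noteq> {}"
  then have "wpd j b z k \<alpha> J = 0" "b z k \<beta> J = 0" for \<beta>
    using zero_formD [OF zero_form_wpd [of b, OF assms]] zero_formD [OF assms] by simp_all
  then show "cov_deriv n nab j b z k \<alpha> J = 0"
    by (simp add: cov_deriv_def sum_fun_apply wscale_def ymul_def ydiff_def cong: if_cong)
qed

lemma body_dxwedge_sum:
  assumes "\<And>i. zero_form (c i)" "j < m"
  shows "body {j} (\<Sum>i<m. dxwedge i (c i)) = body {} (c j)"
proof (rule wfps_eqI)
  fix k \<alpha>
  have "(\<Sum>i<m. dxwedge i (c i) k \<alpha> {j}) = (\<Sum>i<m. if i = j then c j k \<alpha> {} else 0)"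
  proof (intro sum.cong refl)
    fix i
    have empty: "{l. l = j \<and> l < j} = {}" by auto
    show "dxwedge i (c i) k \<alpha> {j} = (if i = j then c j k \<alpha> {} else 0)"
      by (simp add: dxwedge_def empty)
  qed
  then show "wcoeff (body {j} (\<Sum>i<m. dxwedge i (c i))) k \<alpha> = wcoeff (body {} (c j)) k \<alpha>"
    using assms(2) by (simp add: sum_fun_apply)
qed

lemma one_form_dxwedge_sum:
  assumes "\<And>i. zero_form (c i)"
  shows "one_form n (\<Sum>i<2*n. dxwedge i (c i))"
  unfolding one_form_def
proof (intro allI impI)
  fix k \<alpha> and J :: "nat set" assume J: "\<forall>j<2*n. J \<noteq> {j}"
  have "dxwedge i (c i) k \<alpha> J = 0" if "i < 2 * n" for i
  proof (cases "i \<in> J")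
    case True
    then have "J - {i} \<noteq> {}" using J that by blast
    then show ?thesis using zero_formD [OF assms] by (simp add: dxwedge_def)
  qed (simp add: dxwedge_def)
  then show "(\<Sum>i<2*n. dxwedge i (c i)) k \<alpha> J = 0"
    by (simp add: sum_fun_apply)
qed

lemma one_form_eq_0_iff: "one_form n a \<Longrightarrow> a = 0 \<longleftrightarrow> (\<forall>j<2*n. body {j} a = 0)"
proof
  assume a: "one_form n a" "\<forall>j<2*n. body {j} a = 0"
  have "a k \<alpha> J = 0" for k \<alpha> J
  proof (cases "\<exists>j<2*n. J = {j}")
    case True
    then obtain j where j: "j < 2 * n" "J = {j}" by blast
    then have "wcoeff (body {j} a) k \<alpha> = 0" using a(2) by simp
    then show ?thesis using j by simp
  next
    case False
    then show ?thesis using a(1) unfolding one_form_def by blast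
  qed
  then show "a = 0" by (simp add: fun_eq_iff)
qed simp

lemma body_cov_deriv:
  "body {} (cov_deriv n nab j b z) =
    body {} (wpd j b z) - wlinear n (\<lambda>q p. nab (coord_field j) (coord_field q) z p) (body {} (b z))"
  by (simp add: cov_deriv_def wlinear_def body_sum)

lemma wlinear_X: "wlinear n N (fps_X * F) = fps_X * wlinear n N F"
  by (simp add: wlinear_def wderiv_mult weyl.d_X sum_distrib_left ac_simps)

lemma wlinear_add: "wlinear n N (F + G) = wlinear n N F + wlinear n N G"
  by (simp add: wlinear_def wderiv_add distrib_left sum.distrib)

lemma wlinear_1: "wlinear n N 1 = 0"
  using wderiv_wconst [of _ 1] by (simp add: wlinear_def)

lemma moyal_add:
  assumes "zero_form a" "zero_form a'" "zero_form b"
  shows "moyal n (a + a') b = moyal n a b + moyal n a' b" "moyal n b (a + a') = moyal n b a + moyal n b a'"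
  using assms
  by (auto intro!: zero_form_eqI simp: zero_form_moyal zero_form_add body_moyal_right
      weyl.star_add_left weyl.star_add_right)

lemma moyal_wshift:
  assumes "zero_form a" "zero_form b"
  shows "moyal n (wshift a) b = wshift (moyal n a b)" "moyal n a (wshift b) = wshift (moyal n a b)"
  using assms
  by (auto intro!: zero_form_eqI simp: zero_form_moyal zero_form_wshift body_moyal_right body_wshift weyl.star_X)

lemma moyal_assoc:
  assumes "zero_form a" "zero_form b" "zero_form c"
  shows "moyal n (moyal n a b) c = moyal n a (moyal n b c)"
  using assms by (auto intro!: zero_form_eqI simp: zero_form_moyal body_moyal_right weyl.star_assoc)

lemma moyal_wone:
  assumes "zero_form a"
  shows "moyal n a wone = a" "moyal n wone a = a"
  using assms by (auto intro!: zero_form_eqI simp: zero_form_moyal zero_form_wone body_moyal_right weyl.star_1)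

lemma section_eqI: "(\<And>U z. a U z = b U z) \<Longrightarrow> a = (b :: 'x wsection)"
  by (rule ext, rule ext)

definition section_shift :: "'x wsection \<Rightarrow> 'x wsection" where
  "section_shift b = (\<lambda>U z. wshift (b U z))"

lemma series_scale_X: "series_scale fps_X F = (\<lambda>k. if k = 0 then 0 else F (k - 1))"
proof (intro ext)
  fix k x
  have "(\<Sum>i\<le>k. fps_nth fps_X i * F (k - i) x) = (\<Sum>i\<le>k. if i = 1 then F (k - 1) x else 0)"
    by (intro sum.cong) (auto simp: fps_X_def)
  then show "series_scale fps_X F k x = (if k = 0 then 0 else F (k - 1)) x"
    by (simp add: series_scale_def)
qed

lemma has_wpd_body:
  assumes "wsmooth m U (\<lambda>z. body J (b z))" "i < m" "x \<in> U"
  shows "has_wpd i (\<lambda>z. body J (b z)) (body J (wpd i b x)) x"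
  using assms by (simp add: wsmooth_def has_wpd_def wpd_def smooth_fun_has_pd [of m U])

lemma body_wpd_eqI:
  assumes "has_wpd i (\<lambda>z. body J (b z)) D x"
  shows "body J (wpd i b x) = D"
  using assms by (intro wfps_eqI) (simp add: has_wpd_def wpd_def has_pd_imp_pd)

lemma has_wpd_add: "has_wpd i F D x \<Longrightarrow> has_wpd i G E x \<Longrightarrow> has_wpd i (\<lambda>z. F z + G z) (D + E) x"
  by (simp add: has_wpd_def has_pd_add)

lemma has_wpd_X: "has_wpd i F D x \<Longrightarrow> has_wpd i (\<lambda>z. fps_X * F z) (fps_X * D) x"
  by (simp add: has_wpd_def wcoeff_X_mult has_pd_const)

section \<open>The algebra of stratified sections of form degree 0\<close>

context symplectic_orbi
begin

definition section_one :: "'x wsection" where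
  "section_one = (\<lambda>U z. if U \<in> objs X \<and> z \<in> dom U then wone else 0)"

lemma str_forms_0D:
  assumes "b \<in> str_forms X 0"
  shows "vanishes_outside b" "zero_form (b U z)"
    "U \<in> objs X \<Longrightarrow> z \<in> dom U \<Longrightarrow> wsupp (dm U) (body {} (b U z))"
    "U \<in> objs X \<Longrightarrow> wsmooth (dm U) (dom U) (\<lambda>z. body {} (b U z))"
    "U \<in> objs X \<Longrightarrow> z \<in> dom U \<Longrightarrow> g \<in> grp U \<Longrightarrow> wpull (dm U) (dm U) (jac (act U g) z) (b U (act U g z)) = b U z"
    "U \<in> objs X \<Longrightarrow> V \<in> objs X \<Longrightarrow> V \<subseteq> U \<Longrightarrow> y \<in> dom V \<Longrightarrow>
      wpull (dm V) (dm U) (jac (ophi X V U) y) (b U (ophi X V U y)) = b V y"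
  using assms [unfolded str_forms_0_iff] by simp_all

lemma str_forms_0I:
  assumes "vanishes_outside b" "\<And>U z. zero_form (b U z)"
    "\<And>U z. U \<in> objs X \<Longrightarrow> z \<in> dom U \<Longrightarrow> wsupp (dm U) (body {} (b U z))"
    "\<And>U. U \<in> objs X \<Longrightarrow> wsmooth (dm U) (dom U) (\<lambda>z. body {} (b U z))"
    "\<And>U z g. U \<in> objs X \<Longrightarrow> z \<in> dom U \<Longrightarrow> g \<in> grp U \<Longrightarrow> wpull (dm U) (dm U) (jac (act U g) z) (b U (act U g z)) = b U z"
    "\<And>U V y. U \<in> objs X \<Longrightarrow> V \<in> objs X \<Longrightarrow> V \<subseteq> U \<Longrightarrow> y \<in> dom V \<Longrightarrow>
      wpull (dm V) (dm U) (jac (ophi X V U) y) (b U (ophi X V U y)) = b V y"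
  shows "b \<in> str_forms X 0"
  unfolding str_forms_0_iff using assms by blast

text \<open>Equivariance under the groups and compatibility with the embeddings are both instances
  of \<open>wpull_moyal\<close>, because the Jacobians are symplectic in either case and embedded
  charts have the same dimension.\<close>

lemma section_moyal_closed:
  assumes a: "a \<in> str_forms X 0" and b: "b \<in> str_forms X 0"
  shows "section_moyal X a b \<in> str_forms X 0"
proof (rule str_forms_0I)
  note A = str_forms_0D [OF a] and B = str_forms_0D [OF b]
  show "vanishes_outside (section_moyal X a b)"
    using A(1) by (simp add: vanishes_outside_def section_moyal_def)
  show "zero_form (section_moyal X a b U z)" for U z
    by (simp add: section_moyal_def zero_form_moyal A B)
  show "wsupp (dm U) (body {} (section_moyal X a b U z))" if "U \<in> objs X" "z \<in> dom U" for U z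
    using that by (simp add: section_moyal_def body_moyal_right A B wsupp_star)
  show "wsmooth (dm U) (dom U) (\<lambda>z. body {} (section_moyal X a b U z))" if "U \<in> objs X" for U
    using that by (simp add: section_moyal_def body_moyal_right A B wsmooth_star open_dom)
  show "wpull (dm U) (dm U) (jac (act U g) z) (section_moyal X a b U (act U g z)) = section_moyal X a b U z"
    if "U \<in> objs X" "z \<in> dom U" "g \<in> grp U" for U z g
    using that by (simp add: section_moyal_def wpull_moyal A B symplectic_jac_act)
  show "wpull (dm V) (dm U) (jac (ophi X V U) y) (section_moyal X a b U (ophi X V U y)) = section_moyal X a b V y"
    if "U \<in> objs X" "V \<in> objs X" "V \<subseteq> U" "y \<in> dom V" for U V y
    using that A(6) [OF that] B(6) [OF that]
    by (simp add: section_moyal_def hdim_embedding [OF that(1-3)] wpull_moyal A(2) B(2) symplectic_jac_ophi)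
qed

lemma section_add_closed:
  assumes a: "a \<in> str_forms X 0" and b: "b \<in> str_forms X 0"
  shows "a + b \<in> str_forms X 0"
proof (rule str_forms_0I)
  note A = str_forms_0D [OF a] and B = str_forms_0D [OF b]
  show "vanishes_outside (a + b)"
    using A(1) B(1) by (simp add: vanishes_outside_def)
  show "wsupp (dm U) (body {} ((a + b) U z))" if "U \<in> objs X" "z \<in> dom U" for U z
    using A(3) [OF that] B(3) [OF that] by (simp add: wsupp_def)
  show "wsmooth (dm U) (dom U) (\<lambda>z. body {} ((a + b) U z))" if "U \<in> objs X" for U
    using A(4) [OF that] B(4) [OF that] open_dom [OF that] by (simp add: wsmooth_def smooth_fun_add)
qed (simp_all add: wpull_add str_forms_0D [OF a] str_forms_0D [OF b] zero_form_add)

lemma section_shift_closed: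
  assumes a: "a \<in> str_forms X 0"
  shows "section_shift a \<in> str_forms X 0"
proof (rule str_forms_0I)
  note A = str_forms_0D [OF a]
  show "vanishes_outside (section_shift a)"
    using A(1) by (simp add: vanishes_outside_def section_shift_def wshift_def fun_eq_iff)
  show "wsupp (dm U) (body {} (section_shift a U z))" if "U \<in> objs X" "z \<in> dom U" for U z
    using A(3) [OF that] by (simp add: section_shift_def body_wshift wcoeff_X_mult wsupp_def)
  show "wsmooth (dm U) (dom U) (\<lambda>z. body {} (section_shift a U z))" if "U \<in> objs X" for U
    unfolding wsmooth_def
  proof (intro allI)
    fix k \<alpha>
    show "smooth_fun (dm U) (dom U) (\<lambda>z. wcoeff (body {} (section_shift a U z)) k \<alpha>)"
      using A(4) [OF that] smooth_fun_const [OF open_dom [OF that], of 0]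
      by (cases "k = 0") (simp_all add: wsmooth_def section_shift_def body_wshift wcoeff_X_mult del: wcoeff_body)
  qed
qed (simp_all add: section_shift_def wpull_wshift str_forms_0D [OF a] zero_form_wshift)

lemma section_one_closed: "section_one \<in> str_forms X 0"
proof (rule str_forms_0I)
  show "wsupp (dm U) (body {} (section_one U z))" if "U \<in> objs X" "z \<in> dom U" for U z
    using that by (simp add: section_one_def wsupp_def wcoeff_1)
  show "wsmooth (dm U) (dom U) (\<lambda>z. body {} (section_one U z))" if "U \<in> objs X" for U
    unfolding wsmooth_def
  proof (intro allI)
    fix k \<alpha>
    show "smooth_fun (dm U) (dom U) (\<lambda>z. wcoeff (body {} (section_one U z)) k \<alpha>)"
      \<comment> \<open>The section is constant on the open domain but 0 off it, so smoothness is
        transferred from the constant.\<close>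
      by (rule smooth_fun_cong [OF open_dom [OF that] _ smooth_fun_const [OF open_dom [OF that], of "wone k \<alpha> {}"]])
         (use that in \<open>simp add: section_one_def del: body_simps\<close>)
  qed
qed (simp_all add: section_one_def vanishes_outside_def wpull_wone zero_form_wone act_dom ophi_dom)

lemma symbol_consistent:
  assumes "b \<in> str_forms X 0"
  shows "chartwise_consistent (\<lambda>U z. b U z k {#} {})"
proof (rule chartwise_consistentI)
  note B = str_forms_0D [OF assms]
  show "b U (act U g u) k {#} {} = b U u k {#} {}" if "U \<in> objs X" "g \<in> grp U" "u \<in> dom U" for U g u
    by (subst B(5) [OF that(1,3,2), symmetric]) (simp add: wpull_coeff_0 B(2))
  show "b U (ophi X V U v) k {#} {} = b V v k {#} {}"
    if "U \<in> objs X" "V \<in> objs X" "V \<subseteq> U" "v \<in> dom V" for U V v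
    by (subst B(6) [OF that, symmetric]) (simp add: wpull_coeff_0 B(2))
qed

lemma symbol_map_eq:
  "b \<in> str_forms X 0 \<Longrightarrow> U \<in> objs X \<Longrightarrow> u \<in> dom U \<Longrightarrow> symbol_map X b k (rho U u) = b U u k {#} {}"
  unfolding symbol_map_def by (rule descend_eq [OF symbol_consistent])

lemma symbol_map_outside: "x \<notin> topspace (otop X) \<Longrightarrow> symbol_map X b k x = 0"
  by (simp add: symbol_map_def descend_outside)

lemma symbol_map_eqI:
  assumes "b \<in> str_forms X 0" "\<And>k x. x \<notin> topspace (otop X) \<Longrightarrow> F k x = 0"
    and "\<And>k U u. U \<in> objs X \<Longrightarrow> u \<in> dom U \<Longrightarrow> b U u k {#} {} = F k (rho U u)"
  shows "symbol_map X b = F"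
  by (rule ext, rule function_eqI) (simp_all add: assms symbol_map_outside symbol_map_eq)

lemma symbol_map_add:
  assumes "a \<in> str_forms X 0" "b \<in> str_forms X 0"
  shows "symbol_map X (a + b) = symbol_map X a + symbol_map X b"
  using assms by (intro symbol_map_eqI section_add_closed) (simp_all add: symbol_map_outside symbol_map_eq)

lemma symbol_map_shift:
  assumes "a \<in> str_forms X 0"
  shows "symbol_map X (section_shift a) = series_scale fps_X (symbol_map X a)"
  using assms
  by (intro symbol_map_eqI section_shift_closed)
     (simp_all add: symbol_map_outside symbol_map_eq series_scale_X section_shift_def wshift_def)

lemma symbol_map_one: "symbol_map X section_one = const_series (one_fun X)"
  by (intro symbol_map_eqI section_one_closed)
     (simp_all add: const_series_def one_fun_def section_one_def wone_def rho_in_topspace)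

lemma section_moyal_add:
  assumes "a \<in> str_forms X 0" "a' \<in> str_forms X 0" "b \<in> str_forms X 0"
  shows "section_moyal X (a + a') b = section_moyal X a b + section_moyal X a' b"
    "section_moyal X b (a + a') = section_moyal X b a + section_moyal X b a'"
  by (rule section_eqI, simp add: section_moyal_def moyal_add assms [THEN str_forms_0D(2)])+

lemma section_moyal_shift:
  assumes "a \<in> str_forms X 0" "b \<in> str_forms X 0"
  shows "section_moyal X (section_shift a) b = section_shift (section_moyal X a b)"
    "section_moyal X a (section_shift b) = section_shift (section_moyal X a b)"
  by (rule section_eqI,
      simp add: section_moyal_def section_shift_def moyal_wshift assms [THEN str_forms_0D(2)])+

lemma section_moyal_assoc:
  assumes "a \<in> str_forms X 0" "b \<in> str_forms X 0" "c \<in> str_forms X 0"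
  shows "section_moyal X (section_moyal X a b) c = section_moyal X a (section_moyal X b c)"
  by (rule section_eqI) (simp add: section_moyal_def moyal_assoc assms [THEN str_forms_0D(2)])

lemma section_moyal_one:
  assumes a: "a \<in> str_forms X 0"
  shows "section_moyal X a section_one = a" "section_moyal X section_one a = a"
proof -
  \<comment> \<open>Off the chart domains \<open>section_one\<close> is 0 rather than the unit; the
    identity persists there because a vanishes too.\<close>
  have "moyal (hdim X U) (a U z) (section_one U z) = a U z \<and> moyal (hdim X U) (section_one U z) (a U z) = a U z" for U z
  proof (cases "U \<in> objs X \<and> z \<in> dom U")
    case True
    then show ?thesis
      by (simp add: section_one_def moyal_wone str_forms_0D(2) [OF a])
  next
    case False
    then have "a U z = 0" by (rule str_forms_outside [OF a])
    then show ?thesis by simp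
  qed
  then show "section_moyal X a section_one = a" "section_moyal X section_one a = a"
    by (simp_all add: section_moyal_def fun_eq_iff)
qed

end

section \<open>The operator D in components, and its flat sections\<close>

locale fedosov = symplectic_orbi X
  for X :: "('g, 'x) orbispace" +
  fixes nab :: "'x set \<Rightarrow> vfield \<Rightarrow> vfield \<Rightarrow> vfield" and r :: "'x wsection" and eps :: complex
  assumes connection: "symplectic_connection X nab" and r_form: "r \<in> str_forms X 1"
begin

abbreviation D :: "'x wsection \<Rightarrow> 'x wsection" where
  "D \<equiv> fedosov_D X nab eps r"

abbreviation christ :: "'x set \<Rightarrow> Defs.vec \<Rightarrow> nat \<Rightarrow> nat \<Rightarrow> nat \<Rightarrow> real" where
  "christ U z j \<equiv> \<lambda>q p. nab U (coord_field j) (coord_field q) z p"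

text \<open>The coefficient of dx_j in D a for a of form degree 0, as an operator on power series:
  derivative in the base point, linear fibre field, fibre translation and inner derivation. Each of
  the four obeys the Leibniz rule for the Moyal product.\<close>

definition D_comp :: "nat \<Rightarrow> 'x wsection \<Rightarrow> 'x set \<Rightarrow> Defs.vec \<Rightarrow> wfps" where
  "D_comp j a U z = body {} (wpd j (a U) z) - wlinear (hdim X U) (christ U z j) (body {} (a U z)) +
     wconst eps * wderiv j (body {} (a U z)) +
     wconst \<i> * weyl.ad (hdim X U) (body {j} (r U z)) (body {} (a U z))"

lemma fedosov_D_apply:
  assumes "U \<in> objs X" "z \<in> dom U"
  shows "D a U z = (\<Sum>j<dm U. dxwedge j (cov_deriv (hdim X U) (nab U) j (a U) z)) +
    wscale eps (\<Sum>j<dm U. dxwedge j (ydiff j (a U z))) + i_over_lambda (gcomm (hdim X U) (r U z) (a U z))"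
  using assms
  by (simp add: fedosov_D_def nabla_def on_domains_def section_scale_def section_delta_def delta_def
      section_i_over_lambda_def section_gcomm_def)

lemma body_fedosov_D:
  assumes a: "a \<in> str_forms X 0" and "U \<in> objs X" "z \<in> dom U" "j < dm U"
  shows "body {j} (D a U z) = D_comp j a U z"
proof -
  note zf = str_forms_0D(2) [OF a]
  show ?thesis
    using assms(2-4)
    by (simp add: fedosov_D_apply D_comp_def body_dxwedge_sum zf zero_form_cov_deriv zero_form_ydiff
        body_cov_deriv body_i_over_lambda_gcomm [OF str_forms_one_form [OF r_form] zf] del: body_simps(8))
qed

text \<open>D a is a one-form, hence determined by its components. Off the chart domains
  \<open>nabla\<close> is 0 by construction, and the other two terms vanish together with a.\<close>

lemma fedosov_D_eq_0_iff:
  assumes a: "a \<in> str_forms X 0"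
  shows "D a = 0 \<longleftrightarrow> (\<forall>U\<in>objs X. \<forall>z\<in>dom U. \<forall>j<dm U. D_comp j a U z = 0)"
proof -
  note zf = str_forms_0D(2) [OF a]
  have out: "D a U z = 0" if "\<not> (U \<in> objs X \<and> z \<in> dom U)" for U z
  proof -
    have a0: "a U z = 0" using that by (rule str_forms_outside [OF a])
    have "gcomm (hdim X U) (r U z) 0 = 0"
      by (simp add: gcomm_one_zero [OF str_forms_one_form [OF r_form]])
    moreover have "dxwedge j (ydiff j 0) = 0" "wscale eps 0 = 0" "i_over_lambda 0 = 0" for j
      by (simp_all add: dxwedge_def ydiff_def wscale_def i_over_lambda_def fun_eq_iff)
    moreover have "nabla X nab a U z = 0"
      using that unfolding nabla_def on_domains_def by (rule if_not_P)
    ultimately show ?thesis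
      by (simp add: fedosov_D_def section_scale_def section_delta_def delta_def
          section_i_over_lambda_def section_gcomm_def a0)
  qed
  have one: "one_form (hdim X U) (D a U z)" if "U \<in> objs X" "z \<in> dom U" for U z
    using one_form_dxwedge_sum [of "\<lambda>j. cov_deriv (hdim X U) (nab U) j (a U) z" "hdim X U"]
      one_form_dxwedge_sum [of "\<lambda>j. ydiff j (a U z)" "hdim X U"]
      one_form_gcomm [OF str_forms_one_form [OF r_form] zf, of U z]
    by (simp add: fedosov_D_apply that zf zero_form_cov_deriv zero_form_ydiff one_form_def wscale_def i_over_lambda_def)
  have "D a = 0 \<longleftrightarrow> (\<forall>U\<in>objs X. \<forall>z\<in>dom U. D a U z = 0)"
  proof
    assume *: "\<forall>U\<in>objs X. \<forall>z\<in>dom U. D a U z = 0"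
    have "D a U z = 0" for U z
      by (cases "U \<in> objs X \<and> z \<in> dom U") (use * out in auto)
    then show "D a = 0" by (simp add: fun_eq_iff)
  qed simp
  then show ?thesis
    using one_form_eq_0_iff [OF one] body_fedosov_D [OF a] by simp
qed

text \<open>\<omega> has constant coefficients in the Darboux charts, so for coordinate fields the
  derivative term of the symplectic condition is 0. What remains places the connection matrix in the
  symplectic Lie algebra, as \<open>wlinear_star\<close> requires.\<close>

lemma christ_symplectic:
  assumes U: "U \<in> objs X" and z: "z \<in> dom U" and j: "j < dm U" and q: "q < dm U" and l: "l < dm U"
  shows "(\<Sum>k<dm U. christ U z j q k * omega (hdim X U) k l) + (\<Sum>k<dm U. omega (hdim X U) q k * christ U z j l k) = 0"
proof -
  have vf: "is_vfield (dm U) (dom U) (coord_field i)" if "i < dm U" for i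
    using that open_dom [OF U]
    by (auto simp: is_vfield_def smooth_map_def coord_field_def topspace_Euclidean_space smooth_fun_const)
  have left: "omega_form (hdim X U) v (coord_field l z) = (\<Sum>k<dm U. v k * omega (hdim X U) k l)" for v
  proof -
    have "(\<Sum>i<dm U. omega (hdim X U) k i * v k * coord_field l z i) = v k * omega (hdim X U) k l" for k
    proof -
      have "(\<Sum>i<dm U. omega (hdim X U) k i * v k * coord_field l z i) =
          (\<Sum>i<dm U. if i = l then v k * omega (hdim X U) k l else 0)"
        by (intro sum.cong) (auto simp: coord_field_def)
      then show ?thesis using l by simp
    qed
    then show ?thesis by (simp add: omega_form_def)
  qed
  have right: "omega_form (hdim X U) (coord_field q z) v = (\<Sum>k<dm U. omega (hdim X U) q k * v k)" for v
  proof -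
    have "omega_form (hdim X U) (coord_field q z) v =
        (\<Sum>k<dm U. if k = q then \<Sum>i<dm U. omega (hdim X U) q i * v i else 0)"
      unfolding omega_form_def by (intro sum.cong) (auto simp: coord_field_def)
    then show ?thesis using q by simp
  qed
  have "dderiv (dm U) (coord_field j) (\<lambda>z. omega_form (hdim X U) (coord_field q z) (coord_field l z)) z
        - omega_form (hdim X U) (nab U (coord_field j) (coord_field q) z) (coord_field l z)
        - omega_form (hdim X U) (coord_field q z) (nab U (coord_field j) (coord_field l) z) = 0"
    using connection vf [OF j] vf [OF q] vf [OF l] U z unfolding symplectic_connection_def by blast
  moreover have "dderiv (dm U) (coord_field j) (\<lambda>z. omega_form (hdim X U) (coord_field q z) (coord_field l z)) z = 0"
    by (simp add: dderiv_def coord_field_def)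
  ultimately show ?thesis by (simp add: left right)
qed

lemma D_comp_moyal:
  assumes a: "a \<in> str_forms X 0" and b: "b \<in> str_forms X 0" and U: "U \<in> objs X" and z: "z \<in> dom U" and j: "j < dm U"
  shows "D_comp j (section_moyal X a b) U z =
    weyl.star (hdim X U) (D_comp j a U z) (body {} (b U z)) + weyl.star (hdim X U) (body {} (a U z)) (D_comp j b U z)"
proof -
  let ?A = "body {} (a U z)" and ?B = "body {} (b U z)" and ?n = "hdim X U"
  note A = str_forms_0D [OF a] and B = str_forms_0D [OF b]
  \<comment> \<open>Stated at every point, because the derivative in the base point is taken
    next.\<close>
  have ab: "body {} (section_moyal X a b U z) = weyl.star ?n (body {} (a U z)) (body {} (b U z))" for z
    by (simp add: section_moyal_def body_moyal_right A(2) B(2))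
  have "has_wpd j (\<lambda>z. body {} (section_moyal X a b U z))
      (weyl.star ?n (body {} (wpd j (a U) z)) ?B + weyl.star ?n ?A (body {} (wpd j (b U) z))) z"
    unfolding ab by (intro has_wpd_star has_wpd_body [OF _ j z] A(4) B(4) U)
  then have pd: "body {} (wpd j (section_moyal X a b U) z) =
      weyl.star ?n (body {} (wpd j (a U) z)) ?B + weyl.star ?n ?A (body {} (wpd j (b U) z))"
    by (rule body_wpd_eqI)
  have wl: "wlinear ?n (christ U z j) (weyl.star ?n ?A ?B) =
      weyl.star ?n (wlinear ?n (christ U z j) ?A) ?B + weyl.star ?n ?A (wlinear ?n (christ U z j) ?B)"
    by (rule wlinear_star) (rule christ_symplectic [OF U z j])
  show ?thesis
    by (simp only: D_comp_def ab pd wl weyl.d_star weyl.ad_derivation weyl.star_add_left weyl.star_add_right weyl.star_diff_left weyl.star_diff_right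
        weyl.star_scale wderiv_wconst) (simp add: algebra_simps)
qed

abbreviation flat :: "'x wsection set" where
  "flat \<equiv> flat_sections X D"

lemma flat_iff:
  "a \<in> flat \<longleftrightarrow> a \<in> str_forms X 0 \<and> (\<forall>U\<in>objs X. \<forall>z\<in>dom U. \<forall>j<dm U. D_comp j a U z = 0)"
  using fedosov_D_eq_0_iff by (auto simp: flat_sections_def)

lemma flat_moyal: "a \<in> flat \<Longrightarrow> b \<in> flat \<Longrightarrow> section_moyal X a b \<in> flat"
  by (simp add: flat_iff section_moyal_closed D_comp_moyal)

lemma flat_add:
  assumes "a \<in> flat" "b \<in> flat"
  shows "a + b \<in> flat"
proof -
  note a = assms(1) [unfolded flat_iff] and b = assms(2) [unfolded flat_iff]
  note A = str_forms_0D [OF a [THEN conjunct1]] and B = str_forms_0D [OF b [THEN conjunct1]]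
  have "D_comp j (a + b) U z = 0" if "U \<in> objs X" "z \<in> dom U" "j < dm U" for j U z
  proof -
    have "body {} (wpd j ((a + b) U) z) = body {} (wpd j (a U) z) + body {} (wpd j (b U) z)"
      using has_wpd_add [OF has_wpd_body [OF A(4) that(3,2)] has_wpd_body [OF B(4) that(3,2)]] that(1)
      by (intro body_wpd_eqI) simp
    then have "D_comp j (a + b) U z = D_comp j a U z + D_comp j b U z"
      by (simp only: D_comp_def plus_fun_apply body_simps wlinear_add wderiv_add weyl.ad_add)
         (simp add: algebra_simps)
    then show ?thesis using a b that by simp
  qed
  then show ?thesis using a b by (simp add: flat_iff section_add_closed)
qed

text \<open>D commutes with multiplication by \<lambda>. Together with \<open>flat_add\<close> this
  is the linearity of Q that the extension of the product from functions to series relies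
  on.\<close>

lemma flat_shift:
  assumes "a \<in> flat"
  shows "section_shift a \<in> flat"
proof -
  note a = assms [unfolded flat_iff]
  note A = str_forms_0D [OF a [THEN conjunct1]]
  have "D_comp j (section_shift a) U z = 0" if "U \<in> objs X" "z \<in> dom U" "j < dm U" for j U z
  proof -
    have "body {} (wpd j (section_shift a U) z) = fps_X * body {} (wpd j (a U) z)"
      using has_wpd_X [OF has_wpd_body [OF A(4) that(3,2)]] that(1)
      by (intro body_wpd_eqI) (simp add: section_shift_def body_wshift)
    then have "D_comp j (section_shift a) U z = fps_X * D_comp j a U z"
      by (simp only: D_comp_def section_shift_def body_wshift wlinear_X weyl.ad_X wderiv_mult weyl.d_X)
         (simp add: algebra_simps)
    then show ?thesis using a that by simp
  qed
  then show ?thesis using a by (simp add: flat_iff section_shift_closed)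
qed

lemma flat_one: "section_one \<in> flat"
proof -
  have "D_comp j section_one U z = 0" if "U \<in> objs X" "z \<in> dom U" "j < dm U" for j U z
  proof -
    have "pd j (\<lambda>z. section_one U z k \<alpha> {}) z = pd j (\<lambda>z. wone k \<alpha> {}) z" for k \<alpha>
      by (rule pd_cong [OF open_dom [OF that(1)] that(2,3)]) (simp add: section_one_def that(1))
    then have "body {} (wpd j (section_one U) z) = 0"
      by (intro wfps_eqI) (simp add: wpd_def)
    moreover have "body {} (section_one U z) = 1"
      using that by (simp add: section_one_def)
    ultimately show ?thesis
      by (simp add: D_comp_def wlinear_1 weyl.d_1 weyl.ad_1)
  qed
  then show ?thesis by (simp add: flat_iff section_one_closed)
qed

end

section \<open>Low Fedosov degrees\<close>

lemma gamma_form_coeff_eq_0: "gamma_form n nab x k {#} J = 0" "gamma_form n nab x k {#i#} J = 0"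
  by (auto simp: gamma_form_def wscale_def sum_fun_apply ymul_def intro!: sum.neutral)

text \<open>The y-free part at order 1 in \<lambda> sees only the constant terms of a (plain
  product) and its linear terms (first bidifferential term). Order 1 is the relevant one, since
  division by \<lambda> moves it to order 0.\<close>

lemma moyal_coeff_1_eq_0:
  assumes "\<And>k K. a k {#} K = 0" "\<And>k i K. a k {#i#} K = 0"
  shows "moyal n a b (Suc 0) {#} J = 0"
proof -
  have w: "wmult c e k {#} J = 0" if "\<And>k K. c k {#} K = 0" for c e k J
    unfolding wmult_def using that by (intro sum.neutral ballI) auto
  have "ydiff i a k {#} K = 0" for i k K
    by (simp add: ydiff_def assms(2))
  then show ?thesis
    by (simp add: moyal_def w assms(1) sum_fun_apply wscale_def)
qed

lemma curvature_coeff_eq_0: "curvature X nab U z 0 {#} J = 0"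
proof -
  let ?\<Gamma> = "gamma_form (hdim X U) (nab U)"
  \<comment> \<open>In the commutator of \<Gamma> with itself the first factor is \<Gamma> in either
    order, so a condition on the first factor covers both terms.\<close>
  have fp: "moyal n (form_part p (?\<Gamma> z)) b (Suc 0) {#} J = 0" for n p b
    by (rule moyal_coeff_1_eq_0) (simp_all add: form_part_def gamma_form_coeff_eq_0)
  have "wd (hdim X U) ?\<Gamma> z 0 {#} J = 0"
    by (auto simp: wd_def sum_fun_apply dxwedge_def wpd_def gamma_form_coeff_eq_0 intro!: sum.neutral)
  then show ?thesis
    by (simp add: curvature_def on_domains_def i_over_lambda_def wscale_def gcomm_def sum_fun_apply fp)
qed

text \<open>A positive power of \<lambda> already counts 2. At order 0 the operator
  \<open>\<delta>\<^sup>-\<close> multiplies a term of R by some y_i, and that term contains a y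
  already.\<close>

lemma delta_inv_curvature_degree: "2 \<le> fedosov_degree (section_delta_inv X (curvature X nab))"
  unfolding fedosov_degree_def
proof (rule INF_greatest, clarify)
  fix U z k \<alpha> J
  assume nz: "section_delta_inv X (curvature X nab) U z k \<alpha> J \<noteq> 0"
  have "2 \<le> size \<alpha> + 2 * k"
  proof (cases "k = 0")
    case True
    obtain i where i: "i \<in># \<alpha>" "curvature X nab U z 0 (\<alpha> - {#i#}) (insert i J) \<noteq> 0"
      using nz True
      by (auto simp: section_delta_inv_def delta_inv_def delta_star_def sum_fun_apply ymul_def dxcontract_def
          split: if_splits elim!: sum.not_neutral_contains_not_neutral)
    then have "\<alpha> - {#i#} \<noteq> {#}" using curvature_coeff_eq_0 by metis
    then obtain j \<beta> where "\<alpha> - {#i#} = add_mset j \<beta>" by (meson multiset_cases)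
    then have "\<alpha> = add_mset i (add_mset j \<beta>)" using i(1) by (metis insert_DiffM)
    then show ?thesis by simp
  qed simp
  then show "2 \<le> enat (size \<alpha> + 2 * k)"
    by (metis enat_ord_simps(1) numeral_eq_enat)
qed

lemma fedosov_degree_ge_2:
  assumes "2 \<le> fedosov_degree b"
  shows "b U z 0 {#i#} J = 0"
proof (rule ccontr)
  assume "b U z 0 {#i#} J \<noteq> 0"
  then have "fedosov_degree b \<le> enat (size {#i#} + 2 * 0)"
    unfolding fedosov_degree_def by (intro INF_lower2 [of "(U, z, 0, {#i#}, J)"]) auto
  from order_trans [OF assms this] have "2 \<le> enat 1" by simp
  then show False by (simp add: numeral_eq_enat)
qed

lemma wcoeff_star_1:
  "wcoeff (weyl.star n A B) 1 {#} = wcoeff (A * B) 1 {#} -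
     \<i> * (\<Sum>i<2*n. \<Sum>j<2*n. of_real (bivec n i j) * (wcoeff A 0 {#i#} * wcoeff B 0 {#j#}))"
proof -
  have "{..Suc 0} = {0, Suc 0}" by auto
  then show ?thesis
    by (simp add: weyl.star_def wcoeff_series moyal_coeff_def wbivec_def wcoeff_sum wcoeff_mult [of "wderiv _ _"])
qed

text \<open>The plain products cancel, and antisymmetry doubles the first order term: -i times 2
  times -\<omega>/2 is i\<omega>. This is what the factor 1/2 in \<open>bivec\<close> is
  for.\<close>

lemma wcoeff_commutator_1:
  "wcoeff (weyl.star n A B - weyl.star n B A) 1 {#} =
     \<i> * (\<Sum>i<2*n. \<Sum>j<2*n. of_real (omega n i j) * (wcoeff A 0 {#i#} * wcoeff B 0 {#j#}))"
proof -
  have "(\<Sum>i<2*n. \<Sum>j<2*n. of_real (bivec n i j) * (wcoeff B 0 {#i#} * wcoeff A 0 {#j#})) =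
      (\<Sum>i<2*n. \<Sum>j<2*n. of_real (bivec n j i) * (wcoeff B 0 {#j#} * wcoeff A 0 {#i#}))"
    by (rule sum.swap)
  also have "\<dots> = (\<Sum>i<2*n. \<Sum>j<2*n. - of_real (bivec n i j) * (wcoeff A 0 {#i#} * wcoeff B 0 {#j#}))"
    by (intro sum.cong refl) (auto simp: bivec_def omega_def)
  finally have "wcoeff (weyl.star n A B - weyl.star n B A) 1 {#} =
      - 2 * \<i> * (\<Sum>i<2*n. \<Sum>j<2*n. of_real (bivec n i j) * (wcoeff A 0 {#i#} * wcoeff B 0 {#j#}))"
    unfolding wcoeff_simps wcoeff_star_1 by (simp add: mult.commute [of B A] sum_negf)
  also have "\<dots> = \<i> * (\<Sum>i<2*n. \<Sum>j<2*n. (- 2 * of_real (bivec n i j)) * (wcoeff A 0 {#i#} * wcoeff B 0 {#j#}))"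
    by (simp only: sum_distrib_left) (simp add: ac_simps)
  also have "\<dots> = \<i> * (\<Sum>i<2*n. \<Sum>j<2*n. of_real (omega n i j) * (wcoeff A 0 {#i#} * wcoeff B 0 {#j#}))"
    by (simp add: bivec_def)
  finally show ?thesis .
qed

section \<open>Smooth functions on an orbispace\<close>

lemma continuous_map_complex_diff:
  fixes f g :: "'x \<Rightarrow> complex"
  assumes "continuous_map T euclidean f" "continuous_map T euclidean g"
  shows "continuous_map T euclidean (\<lambda>x. f x - g x)"
proof -
  have "continuous_map T euclidean (\<lambda>x. (f x, g x))"
    using assms continuous_map_pairedI [of T euclidean f euclidean g] by simp
  then have "continuous_map T euclidean ((\<lambda>p. fst p - snd p) \<circ> (\<lambda>x. (f x, g x)))"
  proof (rule continuous_map_compose)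
    have "continuous_on UNIV (\<lambda>p :: complex \<times> complex. fst p - snd p)"
      by (intro continuous_intros)
    then show "continuous_map euclidean euclidean (\<lambda>p :: complex \<times> complex. fst p - snd p)"
      by simp
  qed
  then show ?thesis by (simp add: o_def)
qed

context symplectic_orbi
begin

lemma smooth_functions_diff:
  assumes "f \<in> smooth_functions X" "g \<in> smooth_functions X"
  shows "f - g \<in> smooth_functions X"
proof -
  have "smooth_fun (dm U) (dom U) (\<lambda>z. f (rho U z) + (-1) * g (rho U z))" if "U \<in> objs X" for U
    using assms that open_dom [OF that] cdim_eq [OF that]
    by (intro smooth_fun_add smooth_fun_mult smooth_fun_const) (auto simp: smooth_functions_def)
  then show ?thesis
    using assms by (simp add: smooth_functions_def continuous_map_complex_diff cdim_eq fun_diff_def)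
qed

lemma smooth_functions_0: "0 \<in> smooth_functions X"
  using open_dom by (simp add: smooth_functions_def zero_fun_def cdim_eq smooth_fun_const)

lemma const_series_smooth: "f \<in> smooth_functions X \<Longrightarrow> const_series f \<in> smooth_series X"
  by (simp add: smooth_series_def const_series_def smooth_functions_0)

lemma smooth_series_Suc: "F \<in> smooth_series X \<Longrightarrow> (\<lambda>k. F (Suc k)) \<in> smooth_series X"
  by (simp add: smooth_series_def)

lemma series_scale_X_smooth: "F \<in> smooth_series X \<Longrightarrow> series_scale fps_X F \<in> smooth_series X"
  by (simp add: smooth_series_def series_scale_X smooth_functions_0)

lemma smooth_function_outside: "f \<in> smooth_functions X \<Longrightarrow> x \<notin> topspace (otop X) \<Longrightarrow> f x = 0"
  by (simp add: smooth_functions_def)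

end

lemma series_decompose: "F = const_series (F 0) + series_scale fps_X (\<lambda>k. F (Suc k))"
  by (auto simp: fun_eq_iff const_series_def series_scale_X)

text \<open>Splitting off the coefficients of order 0 of F and G expresses order k + 1 of a product
  through a product of two functions and order k of two other products. Induction on the order thus
  replaces a continuity argument. For T only additivity and compatibility with \<open>fps_X\<close>
  are asked, which is what is available for Q.\<close>

lemma (in symplectic_orbi) bilinear_product_unique:
  fixes star T :: "'x fseries \<Rightarrow> 'x fseries \<Rightarrow> 'x fseries"
  assumes star: "bilinear_product X star"
    and add: "\<And>F F' G. F \<in> smooth_series X \<Longrightarrow> F' \<in> smooth_series X \<Longrightarrow> G \<in> smooth_series X \<Longrightarrow>
        T (F + F') G = T F G + T F' G \<and> T G (F + F') = T G F + T G F'"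
    and scale: "\<And>F G. F \<in> smooth_series X \<Longrightarrow> G \<in> smooth_series X \<Longrightarrow>
        T (series_scale fps_X F) G = series_scale fps_X (T F G) \<and> T F (series_scale fps_X G) = series_scale fps_X (T F G)"
    and const: "\<And>f g. f \<in> smooth_functions X \<Longrightarrow> g \<in> smooth_functions X \<Longrightarrow>
        star (const_series f) (const_series g) = T (const_series f) (const_series g)"
    and F: "F \<in> smooth_series X" and G: "G \<in> smooth_series X"
  shows "star F G = T F G"
proof -
  \<comment> \<open>Formulated for an arbitrary product S, to be applied to both \<open>star\<close>
    and T.\<close>
  have expand: "S F G = S (const_series (F 0)) (const_series (G 0)) +
      series_scale fps_X (S (const_series (F 0)) (\<lambda>k. G (Suc k))) + series_scale fps_X (S (\<lambda>k. F (Suc k)) G)"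
    if S: "\<And>F F' G. F \<in> smooth_series X \<Longrightarrow> F' \<in> smooth_series X \<Longrightarrow> G \<in> smooth_series X \<Longrightarrow>
          S (F + F') G = S F G + S F' G \<and> S G (F + F') = S G F + S G F'"
      "\<And>F G. F \<in> smooth_series X \<Longrightarrow> G \<in> smooth_series X \<Longrightarrow>
          S (series_scale fps_X F) G = series_scale fps_X (S F G) \<and> S F (series_scale fps_X G) = series_scale fps_X (S F G)"
      and F: "F \<in> smooth_series X" and G: "G \<in> smooth_series X"
    for S :: "'x fseries \<Rightarrow> 'x fseries \<Rightarrow> 'x fseries" and F G
  proof -
    have c: "const_series (H 0) \<in> smooth_series X" if "H \<in> smooth_series X" for H
      using that by (intro const_series_smooth) (simp add: smooth_series_def)
    have "S F G = S (const_series (F 0) + series_scale fps_X (\<lambda>k. F (Suc k))) G"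
      using series_decompose [of F] by simp
    also have "\<dots> = S (const_series (F 0)) G + series_scale fps_X (S (\<lambda>k. F (Suc k)) G)"
      by (simp add: S F G c smooth_series_Suc series_scale_X_smooth)
    also have "S (const_series (F 0)) G = S (const_series (F 0)) (const_series (G 0) + series_scale fps_X (\<lambda>k. G (Suc k)))"
      using series_decompose [of G] by simp
    also have "\<dots> = S (const_series (F 0)) (const_series (G 0)) +
        series_scale fps_X (S (const_series (F 0)) (\<lambda>k. G (Suc k)))"
      by (simp add: S F G c smooth_series_Suc series_scale_X_smooth)
    finally show ?thesis .
  qed
  have star_add: "star (F + F') G = star F G + star F' G \<and> star G (F + F') = star G F + star G F'"
    if "F \<in> smooth_series X" "F' \<in> smooth_series X" "G \<in> smooth_series X" for F F' G
    using star that unfolding bilinear_product_def by blast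
  have star_scale: "star (series_scale fps_X F) G = series_scale fps_X (star F G) \<and>
      star F (series_scale fps_X G) = series_scale fps_X (star F G)"
    if "F \<in> smooth_series X" "G \<in> smooth_series X" for F G
    using star that unfolding bilinear_product_def by blast
  note expand_star = expand [of star, OF star_add star_scale] and expand_T = expand [of T, OF add scale]
  have "star F G k = T F G k" if "F \<in> smooth_series X" "G \<in> smooth_series X" for F G k
    using that
  proof (induction k arbitrary: F G)
    case 0
    have "star F G 0 = star (const_series (F 0)) (const_series (G 0)) 0"
      by (subst expand_star) (simp_all add: 0 series_scale_X)
    moreover have "T F G 0 = T (const_series (F 0)) (const_series (G 0)) 0"
      by (subst expand_T) (simp_all add: 0 series_scale_X)
    ultimately show ?case using const 0 by (simp add: smooth_series_def)
  next
    case (Suc k)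
    have c: "const_series (F 0) \<in> smooth_series X"
      using Suc.prems by (intro const_series_smooth) (simp add: smooth_series_def)
    have "star F G (Suc k) = star (const_series (F 0)) (const_series (G 0)) (Suc k) +
        star (const_series (F 0)) (\<lambda>k. G (Suc k)) k + star (\<lambda>k. F (Suc k)) G k"
      by (subst expand_star) (simp_all add: Suc.prems series_scale_X)
    moreover have "T F G (Suc k) = T (const_series (F 0)) (const_series (G 0)) (Suc k) +
        T (const_series (F 0)) (\<lambda>k. G (Suc k)) k + T (\<lambda>k. F (Suc k)) G k"
      by (subst expand_T) (simp_all add: Suc.prems series_scale_X)
    moreover have "star (const_series (F 0)) (\<lambda>k. G (Suc k)) k = T (const_series (F 0)) (\<lambda>k. G (Suc k)) k"
      "star (\<lambda>k. F (Suc k)) G k = T (\<lambda>k. F (Suc k)) G k"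
      using Suc c by (simp_all add: smooth_series_Suc)
    ultimately show ?case using const Suc.prems by (simp add: smooth_series_def)
  qed
  then show ?thesis using F G by blast
qed

section \<open>The star product\<close>

locale fedosov_star = fedosov X nab r eps
  for X :: "('g, 'x) orbispace" and nab r eps +
  fixes Q :: "'x fseries \<Rightarrow> 'x wsection" and star :: "'x fseries \<Rightarrow> 'x fseries \<Rightarrow> 'x fseries"
  assumes eps: "eps * eps = 1"
    and r_degree: "2 \<le> fedosov_degree r"
    and bij: "bij_betw (symbol_map X) flat (smooth_series X)"
    and Q: "Q = inv_into flat (symbol_map X)"
    and bilinear: "bilinear_product X star"
    and star_const: "\<And>f g. f \<in> smooth_functions X \<Longrightarrow> g \<in> smooth_functions X \<Longrightarrow>
      star (const_series f) (const_series g) =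
        symbol_map X (section_moyal X (Q (const_series f)) (Q (const_series g)))"
begin

abbreviation symb :: "'x wsection \<Rightarrow> 'x fseries" where
  "symb \<equiv> symbol_map X"

abbreviation smooth :: "'x fseries set" where
  "smooth \<equiv> smooth_series X"

lemma flat_str_forms: "a \<in> flat \<Longrightarrow> a \<in> str_forms X 0"
  by (simp add: flat_iff)

lemma symb_smooth: "a \<in> flat \<Longrightarrow> symb a \<in> smooth"
  using bij by (rule bij_betw_apply)

lemma Q_flat: "F \<in> smooth \<Longrightarrow> Q F \<in> flat"
  unfolding Q using bij by (simp add: bij_betw_def inv_into_into)

lemma symb_Q: "F \<in> smooth \<Longrightarrow> symb (Q F) = F"
  unfolding Q using bij by (simp add: bij_betw_def f_inv_into_f)

lemma Q_symb: "a \<in> flat \<Longrightarrow> Q (symb a) = a"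
  unfolding Q using bij by (simp add: bij_betw_def inv_into_f_f)

lemma Q_str_forms: "F \<in> smooth \<Longrightarrow> Q F \<in> str_forms X 0"
  by (simp add: Q_flat flat_str_forms)

lemma Q_add:
  assumes "F \<in> smooth" "G \<in> smooth"
  shows "Q (F + G) = Q F + Q G"
proof -
  have "symb (Q F + Q G) = F + G"
    by (simp add: symbol_map_add Q_str_forms symb_Q assms)
  then show ?thesis
    using Q_symb [OF flat_add [OF Q_flat Q_flat], of F G] assms by simp
qed

lemma Q_X:
  assumes "F \<in> smooth"
  shows "Q (series_scale fps_X F) = section_shift (Q F)"
proof -
  have "symb (section_shift (Q F)) = series_scale fps_X F"
    by (simp add: symbol_map_shift Q_str_forms symb_Q assms)
  then show ?thesis
    using Q_symb [OF flat_shift [OF Q_flat], of F] assms by simp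
qed

lemma Q_one: "Q (const_series (one_fun X)) = section_one"
  using Q_symb [OF flat_one] by (simp add: symbol_map_one)

text \<open>Read off from the flat unit section: the symbol map sends flat sections to smooth
  series.\<close>

lemma one_fun_smooth: "one_fun X \<in> smooth_functions X"
  using symb_smooth [OF flat_one] unfolding symbol_map_one smooth_series_def const_series_def
  by (auto dest: spec [of _ 0])

lemma star_eq:
  assumes "F \<in> smooth" "G \<in> smooth"
  shows "star F G = symb (section_moyal X (Q F) (Q G))"
proof (rule bilinear_product_unique [OF bilinear _ _ _ assms, where T = "\<lambda>F G. symb (section_moyal X (Q F) (Q G))"])
  fix F F' G assume *: "F \<in> smooth" "F' \<in> smooth" "G \<in> smooth"
  show "symb (section_moyal X (Q (F + F')) (Q G)) = symb (section_moyal X (Q F) (Q G)) + symb (section_moyal X (Q F') (Q G)) \<and>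
      symb (section_moyal X (Q G) (Q (F + F'))) = symb (section_moyal X (Q G) (Q F)) + symb (section_moyal X (Q G) (Q F'))"
    by (simp add: Q_add section_moyal_add Q_str_forms symbol_map_add section_moyal_closed *)
next
  fix F G assume *: "F \<in> smooth" "G \<in> smooth"
  show "symb (section_moyal X (Q (series_scale fps_X F)) (Q G)) = series_scale fps_X (symb (section_moyal X (Q F) (Q G))) \<and>
      symb (section_moyal X (Q F) (Q (series_scale fps_X G))) = series_scale fps_X (symb (section_moyal X (Q F) (Q G)))"
    by (simp add: Q_X section_moyal_shift Q_str_forms symbol_map_shift section_moyal_closed *)
qed (rule star_const)

lemma Q_star: "F \<in> smooth \<Longrightarrow> G \<in> smooth \<Longrightarrow> Q (star F G) = section_moyal X (Q F) (Q G)"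
  by (simp add: star_eq Q_symb flat_moyal Q_flat)

lemma star_smooth: "F \<in> smooth \<Longrightarrow> G \<in> smooth \<Longrightarrow> star F G \<in> smooth"
  by (simp add: star_eq symb_smooth flat_moyal Q_flat)

lemma star_assoc: "F \<in> smooth \<Longrightarrow> G \<in> smooth \<Longrightarrow> H \<in> smooth \<Longrightarrow> star (star F G) H = star F (star G H)"
  by (simp add: star_eq [of "star F G" H] star_eq [of F "star G H"] star_smooth Q_star
      section_moyal_assoc Q_str_forms)

lemma star_unit:
  assumes "F \<in> smooth"
  shows "star F (const_series (one_fun X)) = F" "star (const_series (one_fun X)) F = F"
  using assms by (simp_all add: star_eq const_series_smooth one_fun_smooth Q_one section_moyal_one Q_str_forms symb_Q)

lemma star_at_chart:
  assumes "F \<in> smooth" "G \<in> smooth" "U \<in> objs X" "u \<in> dom U"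
  shows "star F G k (rho U u) = wcoeff (weyl.star (hdim X U) (body {} (Q F U u)) (body {} (Q G U u))) k {#}"
proof -
  have "star F G k (rho U u) = moyal (hdim X U) (Q F U u) (Q G U u) k {#} {}"
    using assms by (simp add: star_eq symbol_map_eq section_moyal_closed Q_str_forms) (simp add: section_moyal_def)
  also have "\<dots> = wcoeff (body {} (moyal (hdim X U) (Q F U u) (Q G U u))) k {#}"
    by simp
  finally show ?thesis
    by (simp add: body_moyal_right str_forms_0D(2) [OF Q_str_forms] assms del: wcoeff_body)
qed

lemma Q_at_chart:
  "F \<in> smooth \<Longrightarrow> U \<in> objs X \<Longrightarrow> u \<in> dom U \<Longrightarrow> Q F U u k {#} {} = F k (rho U u)"
  using symbol_map_eq [OF Q_str_forms, of F U u k] by (simp add: symb_Q)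

lemma smooth_outside: "F \<in> smooth \<Longrightarrow> x \<notin> topspace (otop X) \<Longrightarrow> F k x = 0"
  by (simp add: smooth_series_def smooth_function_outside)

lemma star_coeff_0:
  assumes "F \<in> smooth" "G \<in> smooth"
  shows "star F G 0 = (\<lambda>x. F 0 x * G 0 x)"
proof (rule function_eqI)
  show "star F G 0 (rho U u) = F 0 (rho U u) * G 0 (rho U u)" if "U \<in> objs X" "u \<in> dom U" for U u
    using assms that by (simp add: star_at_chart wcoeff_def weyl.star_nth_0 mps_coeff_mult)
      (simp add: wcoeff_body [unfolded wcoeff_def] Q_at_chart)
qed (use assms in \<open>simp add: smooth_outside star_smooth\<close>)

text \<open>In lowest degree the equation \<open>D a = 0\<close> reads \<open>da\<^sub>0 + \<epsilon> \<delta>a\<^sub>1 = 0\<close>, as \<open>r\<close> has no terms of degree 1.\<close>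

lemma pd_eq_Q_coeff:
  assumes f: "f \<in> smooth_functions X" and U: "U \<in> objs X" and u: "u \<in> dom U" and j: "j < dm U"
  shows "pd j (f \<circ> rho U) u = - eps * Q (const_series f) U u 0 {#j#} {}"
proof -
  let ?a = "Q (const_series f)"
  have a: "?a \<in> flat" using f by (simp add: Q_flat const_series_smooth)
  have "pd j (f \<circ> rho U) u = pd j (\<lambda>z. ?a U z 0 {#} {}) u"
    by (rule pd_cong [OF open_dom [OF U] u j])
       (use f U in \<open>simp add: Q_at_chart const_series_smooth, simp add: const_series_def\<close>)
  then have "wcoeff (body {} (wpd j (?a U) u)) 0 {#} = pd j (f \<circ> rho U) u"
    by (simp add: wpd_def)
  moreover have "wcoeff (wlinear (hdim X U) (christ U u j) (body {} (?a U u))) 0 {#} = 0"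
    by (simp add: wlinear_def wcoeff_sum wcoeff_wvar_mult)
  \<comment> \<open>As \<open>ad\<close> divides by \<lambda>, its order 0 is order 1 of the
    commutator. That pairs the y-linear terms of order 0 in \<lambda> of r and a, and those of r
    vanish.\<close>
  moreover have "wcoeff (weyl.ad (hdim X U) (body {j} (r U u)) (body {} (?a U u))) 0 {#} = 0"
  proof -
    have "wcoeff (weyl.ad (hdim X U) (body {j} (r U u)) (body {} (?a U u))) 0 {#} =
        wcoeff (weyl.star (hdim X U) (body {j} (r U u)) (body {} (?a U u)) -
          weyl.star (hdim X U) (body {} (?a U u)) (body {j} (r U u))) 1 {#}"
      by (simp add: weyl.ad_def)
    also have "\<dots> = 0"
      unfolding wcoeff_commutator_1 by (simp add: fedosov_degree_ge_2 [OF r_degree])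
    finally show ?thesis .
  qed
  ultimately have "wcoeff (D_comp j ?a U u) 0 {#} = pd j (f \<circ> rho U) u + eps * ?a U u 0 {#j#} {}"
    by (simp add: D_comp_def)
  moreover have "D_comp j ?a U u = 0" using a U u j by (simp add: flat_iff)
  ultimately show ?thesis by (simp add: add_eq_0_iff2)
qed

text \<open>By \<open>pd_eq_Q_coeff\<close> both derivatives carry the same factor -
  \<open>eps\<close>, which cancels from the bracket because its square is 1.\<close>

lemma star_commutator_1:
  assumes f: "f \<in> smooth_functions X" and g: "g \<in> smooth_functions X" and U: "U \<in> objs X" and u: "u \<in> dom U"
  shows "star (const_series f) (const_series g) 1 (rho U u) - star (const_series g) (const_series f) 1 (rho U u) =
    \<i> * pbracket (hdim X U) (f \<circ> rho U) (g \<circ> rho U) u"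
proof -
  let ?a = "Q (const_series f) U u" and ?b = "Q (const_series g) U u"
  have "of_real (omega (hdim X U) k l) * pd k (f \<circ> rho U) u * pd l (g \<circ> rho U) u =
      of_real (omega (hdim X U) k l) * (?a 0 {#k#} {} * ?b 0 {#l#} {})" if "k < dm U" "l < dm U" for k l
  proof -
    have "pd k (f \<circ> rho U) u * pd l (g \<circ> rho U) u = (eps * eps) * (?a 0 {#k#} {} * ?b 0 {#l#} {})"
      by (simp only: pd_eq_Q_coeff [OF f U u that(1)] pd_eq_Q_coeff [OF g U u that(2)]) (simp add: ac_simps)
    then show ?thesis by (simp add: eps mult.assoc)
  qed
  then have "pbracket (hdim X U) (f \<circ> rho U) (g \<circ> rho U) u =
      (\<Sum>k<dm U. \<Sum>l<dm U. of_real (omega (hdim X U) k l) * (?a 0 {#k#} {} * ?b 0 {#l#} {}))"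
    unfolding pbracket_def by (intro sum.cong refl) simp
  then show ?thesis
    using wcoeff_commutator_1 [of "hdim X U" "body {} ?a" "body {} ?b"] f g U u
    by (simp add: star_at_chart const_series_smooth)
qed

text \<open>The consistency of the local brackets needs no computation with charts: each equals -i
  times a first order commutator, which is already a function on X.\<close>

lemma poisson_bracket_eq:
  assumes f: "f \<in> smooth_functions X" and g: "g \<in> smooth_functions X"
  shows "star (const_series f) (const_series g) 1 - star (const_series g) (const_series f) 1 =
    (\<lambda>x. \<i> * poisson_bracket X f g x)"
proof (rule function_eqI)
  let ?C = "\<lambda>x. star (const_series f) (const_series g) 1 x - star (const_series g) (const_series f) 1 x"
  let ?F = "\<lambda>U. pbracket (hdim X U) (f \<circ> rho U) (g \<circ> rho U)"
  have F: "?F U u = - \<i> * ?C (rho U u)" if "U \<in> objs X" "u \<in> dom U" for U u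
    using star_commutator_1 [OF f g that] by simp
  have "chartwise_consistent ?F"
    unfolding chartwise_consistent_def using F by metis
  then have "poisson_bracket X f g (rho U u) = ?F U u" if "U \<in> objs X" "u \<in> dom U" for U u
    unfolding poisson_bracket_def using that by (rule descend_eq)
  then show "(star (const_series f) (const_series g) 1 - star (const_series g) (const_series f) 1) (rho U u) =
      \<i> * poisson_bracket X f g (rho U u)" if "U \<in> objs X" "u \<in> dom U" for U u
    using star_commutator_1 [OF f g that] that by simp
  show "(star (const_series f) (const_series g) 1 - star (const_series g) (const_series f) 1) x =
      \<i> * poisson_bracket X f g x" if "x \<notin> topspace (otop X)" for x
    using that f g
    by (simp add: poisson_bracket_def descend_outside smooth_outside star_smooth const_series_smooth)
qed

lemma star_commutator:
  assumes f: "f \<in> smooth_functions X" and g: "g \<in> smooth_functions X"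
  shows "\<exists>H\<in>smooth. star (const_series f) (const_series g) - star (const_series g) (const_series f)
      - series_scale (fps_const \<i> * fps_X) (const_series (poisson_bracket X f g)) = series_scale (fps_X ^ 2) H"
proof
  let ?f = "const_series f" and ?g = "const_series g"
  \<comment> \<open>Order 0 cancels because the pointwise product is commutative, order 1 by
    \<open>poisson_bracket_eq\<close>; the witness is what is left, divided by \<lambda>^2.\<close>
  let ?H = "\<lambda>k. star ?f ?g (k + 2) - star ?g ?f (k + 2)"
  have s: "?f \<in> smooth" "?g \<in> smooth" using f g by (simp_all add: const_series_smooth)
  show "?H \<in> smooth"
    using star_smooth [OF s] star_smooth [OF s(2,1)] by (simp add: smooth_series_def smooth_functions_diff)
  have iX: "series_scale (fps_const \<i> * fps_X) (const_series p) k x = (if k = 1 then \<i> * p x else 0)"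
    for p :: "'x \<Rightarrow> complex" and k x
  proof -
    have "(\<Sum>i\<le>k. fps_nth (fps_const \<i> * fps_X) i * const_series p (k - i) x) =
        (\<Sum>i\<le>k. if i = 1 then \<i> * const_series p (k - i) x else 0)"
      by (intro sum.cong) (auto simp: fps_X_def)
    then show ?thesis by (auto simp: series_scale_def const_series_def)
  qed
  have X2: "series_scale (fps_X ^ 2) H k x = (if k < 2 then 0 else H (k - 2) x)"
    for H :: "'x fseries" and k x
  proof -
    have "(\<Sum>i\<le>k. fps_nth (fps_X ^ 2) i * H (k - i) x) = (\<Sum>i\<le>k. if i = 2 then H (k - i) x else 0)"
      by (intro sum.cong) (auto simp: fps_X_power_nth)
    then show ?thesis by (simp add: series_scale_def)
  qed
  show "star ?f ?g - star ?g ?f - series_scale (fps_const \<i> * fps_X) (const_series (poisson_bracket X f g)) =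
      series_scale (fps_X ^ 2) ?H"
  proof (intro ext)
    fix k :: nat and x
    consider "k = 0" | "k = 1" | "k \<ge> 2" by linarith
    then show "(star ?f ?g - star ?g ?f - series_scale (fps_const \<i> * fps_X) (const_series (poisson_bracket X f g))) k x =
        series_scale (fps_X ^ 2) ?H k x"
    proof cases
      case 1
      then show ?thesis by (simp add: iX X2 star_coeff_0 s)
    next
      case 2
      then show ?thesis
        using fun_cong [OF poisson_bracket_eq [OF f g], of x] by (simp add: iX X2)
    next
      case 3
      then have "k - 2 + 2 = k" by simp
      then show ?thesis using 3 by (simp add: iX X2 del: add_2_eq_Suc')
    qed
  qed
qed

lemma star_bilinear_coeff: "bilinear_functions X (\<lambda>f g. star (const_series f) (const_series g) k)"
proof -
  have add: "const_series (f + g) = const_series f + const_series g" for f g :: "'x \<Rightarrow> complex"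
    by (auto simp: const_series_def fun_eq_iff)
  have scale: "const_series (\<lambda>x. c * f x) = series_scale (fps_const c) (const_series f)" for c and f :: "'x \<Rightarrow> complex"
  proof (intro ext)
    fix k :: nat and x
    have "(\<Sum>i\<le>k. fps_nth (fps_const c) i * const_series f (k - i) x) = (\<Sum>i\<le>k. if i = 0 then c * const_series f k x else 0)"
      by (intro sum.cong) auto
    then show "const_series (\<lambda>x. c * f x) k x = series_scale (fps_const c) (const_series f) k x"
      by (simp add: series_scale_def const_series_def)
  qed
  have scale': "series_scale (fps_const c) F k = (\<lambda>x. c * F k x)" for c and F :: "'x fseries"
  proof
    fix x
    have "(\<Sum>i\<le>k. fps_nth (fps_const c) i * F (k - i) x) = (\<Sum>i\<le>k. if i = 0 then c * F k x else 0)"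
      by (intro sum.cong) auto
    then show "series_scale (fps_const c) F k x = c * F k x"
      by (simp add: series_scale_def)
  qed
  have "star F G k \<in> smooth_functions X" if "F \<in> smooth" "G \<in> smooth" for F G
    using star_smooth [OF that] by (simp add: smooth_series_def)
  then show ?thesis
    using bilinear unfolding bilinear_functions_def bilinear_product_def add scale
    by (simp add: const_series_smooth scale')
qed

lemma star_product: "star_product X star"
  unfolding star_product_def
proof (intro conjI ballI exI [of _ "\<lambda>k f g. star (const_series f) (const_series g) k"] allI)
  show "star (const_series f) (const_series g) 0 = (\<lambda>x. f x * g x)"
    if "f \<in> smooth_functions X" "g \<in> smooth_functions X" for f g
    using star_coeff_0 [of "const_series f" "const_series g"] that const_series_smooth
    by (simp add: const_series_def)
qed (simp_all add: bilinear star_assoc star_bilinear_coeff star_commutator star_unit const_series_smooth)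

end

theorem corollary4p13:
  fixes X :: "('g, 'x) orbispace"
    and nab :: "'x set \<Rightarrow> vfield \<Rightarrow> vfield \<Rightarrow> vfield"
    and r :: "'x wsection"
    and eps :: complex
    and D :: "'x wsection \<Rightarrow> 'x wsection"
    and Q :: "'x fseries \<Rightarrow> 'x wsection"
    and star :: "'x fseries \<Rightarrow> 'x fseries \<Rightarrow> 'x fseries"
  assumes "symplectic_orbispace X"
    and "symplectic_connection X nab"
    and "r \<in> str_forms X 1"
    and "fedosov_degree r \<ge> fedosov_degree (section_delta_inv X (curvature X nab))"
    and "r = section_delta_inv X (curvature X nab)
           + section_delta_inv X (nabla X nab r + section_i_over_lambda (section_moyal X r r))"
    and "eps = 1 \<or> eps = -1"
    and "D = fedosov_D X nab eps r"
    and "\<forall>b \<in> str_sections X. D (D b) = 0"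
    and "bij_betw (symbol_map X) (flat_sections X D) (smooth_series X)"
    and "Q = inv_into (flat_sections X D) (symbol_map X)"
    and "bilinear_product X star"
    and "\<forall>f \<in> smooth_functions X. \<forall>g \<in> smooth_functions X.
           star (const_series f) (const_series g) =
             symbol_map X (section_moyal X (Q (const_series f)) (Q (const_series g)))"
  shows "star_product X star"
proof -
  interpret fedosov_star X nab r eps Q star
  proof
    show "eps * eps = 1" using assms(6) by auto
    show "2 \<le> fedosov_degree r"
      using delta_inv_curvature_degree assms(4) by (rule order_trans)
  qed (use assms in auto)
  show ?thesis by (rule star_product)
qed

end
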